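(* Let $\{A_\gamma:\gamma\in\Gamma\}$ be a direct system of Noetherian Cohen-Macaulay rings and let $\mathfrak{p}$ be a prime ideal of $A:=\varinjlim_{\gamma\in\Gamma}A_\gamma$. Set $\mathfrak{p}_\gamma=\mathfrak{p}\cap A_\gamma$ for all $\gamma\in\Gamma$. Assume that one of the following holds: (i) $\operatorname{c.grade}_{A_\gamma}(\mathfrak{p}_\gamma,A_\gamma)=\operatorname{c.grade}_{A_\gamma}(\mathfrak{p}_\delta A_\gamma,A_\gamma)$ for all $\delta\le\gamma$; (ii) $\operatorname{c.grade}_{A_\delta}(\mathfrak{p}_\delta,A_\delta)\le\operatorname{c.grade}_{A_\gamma}(\mathfrak{p}_\delta A_\gamma,A_\gamma)$ for all $\delta\le\gamma$. Then $\operatorname{p.grade}_A(\mathfrak{p},A)=\operatorname{ht}_A(\mathfrak{p})$.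
   Context: All rings are commutative, not necessarily Noetherian. All direct systems are assumed to be filtered (indexed by a directed set). For an ideal $\mathfrak{a}$ of $A$, $\mathfrak{a}\cap A_\gamma$ denotes the preimage of $\mathfrak{a}$ under the canonical map $A_\gamma\to A$; for $\delta\le\gamma$, $\mathfrak{p}_\delta A_\gamma$ is the ideal of $A_\gamma$ generated by the image of $\mathfrak{p}_\delta$ under the transition map $A_\delta\to A_\gamma$. Let $R$ be a ring, $M$ an $R$-module. A sequence $x_1,\dots,x_\ell$ in $R$ is a weak regular sequence on $M$ if each $x_i$ is a nonzero-divisor on $M/(x_1,\dots,x_{i-1})M$. The classical grade $\operatorname{c.grade}_R(\mathfrak{a},M)$ of an ideal $\mathfrak{a}$ on $M$ is the supremum of the lengths of all weak regular sequences on $M$ contained in $\mathfrak{a}$. The polynomial grade is $$\operatorname{p.grade}_R(\mathfrak{a},M):=\lim_{m\to\infty}\operatorname{c.grade}_{R[t_1,\dots,t_m]}\bigl(\mathfrak{a}R[t_1,\dots,t_m],\,R[t_1,\dots,t_m]\otimes_R M\bigr).$$ *)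

theory Defs
  imports "HOL-Algebra.Algebra" "HOL-Library.Extended_Real"
begin

section \<open>Modules\<close>

text \<open>The \<open>mult\<close> and \<open>one\<close> fields inherited by the \<open>module\<close> record carry no meaning
  for a module; where a module is built below without a natural choice they are \<open>undefined\<close>.\<close>

definition self_module :: "('a, 'm) ring_scheme \<Rightarrow> ('a, 'a) module" where
  "self_module R =
     \<lparr>carrier = carrier R, monoid.mult = monoid.mult R, one = one R,
      ring.zero = ring.zero R, add = add R, smult = monoid.mult R\<rparr>"

definition quotient_module :: "('a, 'b, 'n) module_scheme \<Rightarrow> 'b set \<Rightarrow> ('a, 'b set) module" where
  "quotient_module M N =
     \<lparr>carrier = a_rcosets\<^bsub>M\<^esub> N, monoid.mult = undefined, one = undefined, ring.zero = N, add = set_add M,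
      smult = (\<lambda>r U. \<Union>x\<in>U. N +>\<^bsub>M\<^esub> (r \<odot>\<^bsub>M\<^esub> x))\<rparr>"

text \<open>The submodule \<open>I M\<close>.\<close>

definition ideal_smult :: "'a set \<Rightarrow> ('a, 'b, 'n) module_scheme \<Rightarrow> 'b set" where
  "ideal_smult I M = generate (add_monoid M) {a \<odot>\<^bsub>M\<^esub> x | a x. a \<in> I \<and> x \<in> carrier M}"

text \<open>Base change \<open>S \<otimes>\<^sub>R M\<close> along \<open>h : R \<rightarrow> S\<close>: the free abelian group on \<open>S \<times> M\<close>, on which
  \<open>s\<close> acts by \<open>(p, x) \<mapsto> (s p, x)\<close>, modulo the tensor relations.\<close>

definition tensor_free ::
  "('s, 'k) ring_scheme \<Rightarrow> ('a, 'b, 'n) module_scheme \<Rightarrow> ('s, ('s \<times> 'b) \<Rightarrow>\<^sub>0 int) module" where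
  "tensor_free S M =
     \<lparr>carrier = carrier (free_Abelian_group (carrier S \<times> carrier M)),
      monoid.mult = undefined, one = undefined, ring.zero = 0, add = (+),
      smult = (\<lambda>s. frag_extend (\<lambda>(p, x). frag_of (s \<otimes>\<^bsub>S\<^esub> p, x)))\<rparr>"

definition tensor_relations ::
  "('a, 'm) ring_scheme \<Rightarrow> ('s, 'k) ring_scheme \<Rightarrow> ('a \<Rightarrow> 's) \<Rightarrow> ('a, 'b, 'n) module_scheme
     \<Rightarrow> (('s \<times> 'b) \<Rightarrow>\<^sub>0 int) set" where
  "tensor_relations R S h M =
     {frag_of (p \<oplus>\<^bsub>S\<^esub> q, x) - frag_of (p, x) - frag_of (q, x) | p q x.
        p \<in> carrier S \<and> q \<in> carrier S \<and> x \<in> carrier M} \<union>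
     {frag_of (p, x \<oplus>\<^bsub>M\<^esub> y) - frag_of (p, x) - frag_of (p, y) | p x y.
        p \<in> carrier S \<and> x \<in> carrier M \<and> y \<in> carrier M} \<union>
     {frag_of (p \<otimes>\<^bsub>S\<^esub> h r, x) - frag_of (p, r \<odot>\<^bsub>M\<^esub> x) | p r x.
        p \<in> carrier S \<and> r \<in> carrier R \<and> x \<in> carrier M}"

definition base_change ::
  "('a, 'm) ring_scheme \<Rightarrow> ('s, 'k) ring_scheme \<Rightarrow> ('a \<Rightarrow> 's) \<Rightarrow> ('a, 'b, 'n) module_scheme
     \<Rightarrow> ('s, (('s \<times> 'b) \<Rightarrow>\<^sub>0 int) set) module" where
  "base_change R S h M =
     quotient_module (tensor_free S M)
       (generate (add_monoid (tensor_free S M)) (tensor_relations R S h M))"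


section \<open>Grade\<close>

definition nonzero_divisor_on :: "'a \<Rightarrow> ('a, 'b, 'n) module_scheme \<Rightarrow> bool" where
  "nonzero_divisor_on a M \<longleftrightarrow> (\<forall>x\<in>carrier M. a \<odot>\<^bsub>M\<^esub> x = \<zero>\<^bsub>M\<^esub> \<longrightarrow> x = \<zero>\<^bsub>M\<^esub>)"

definition weak_regular_sequence ::
  "('a, 'm) ring_scheme \<Rightarrow> ('a, 'b, 'n) module_scheme \<Rightarrow> 'a list \<Rightarrow> bool" where
  "weak_regular_sequence R M xs \<longleftrightarrow>
     set xs \<subseteq> carrier R \<and>
     (\<forall>i < length xs.
        nonzero_divisor_on (xs ! i) (quotient_module M (ideal_smult (Idl\<^bsub>R\<^esub> (set (take i xs))) M)))"

definition c_grade ::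
  "('a, 'm) ring_scheme \<Rightarrow> 'a set \<Rightarrow> ('a, 'b, 'n) module_scheme \<Rightarrow> enat" where
  "c_grade R I M = (SUP xs \<in> {xs. set xs \<subseteq> I \<and> weak_regular_sequence R M xs}. enat (length xs))"

text \<open>\<open>R[t\<^sub>0, \<dots>, t\<^bsub>m-1\<^esub>]\<close>: monomials are multisets of indices and a polynomial is its coefficient
  function. Carrier, addition and constants come from \<^theory>\<open>HOL-Algebra.Indexed_Polynomials\<close>,
  which lacks the product of two polynomials.\<close>

definition poly_ring :: "('a, 'm) ring_scheme \<Rightarrow> nat \<Rightarrow> (nat multiset \<Rightarrow> 'a) ring" where
  "poly_ring R m =
     \<lparr>carrier = ring.indexed_pset R {..<m} (carrier R),
      monoid.mult = (\<lambda>f g u. \<Oplus>\<^bsub>R\<^esub>v\<in>{v. v \<subseteq># u}. f v \<otimes>\<^bsub>R\<^esub> g (u - v)),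
      one = ring.indexed_const R \<one>\<^bsub>R\<^esub>, ring.zero = ring.indexed_const R \<zero>\<^bsub>R\<^esub>,
      add = ring.indexed_padd R\<rparr>"

text \<open>The limit exists because the sequence is increasing.\<close>

definition p_grade ::
  "('a, 'm) ring_scheme \<Rightarrow> 'a set \<Rightarrow> ('a, 'b, 'n) module_scheme \<Rightarrow> enat" where
  "p_grade R I M =
     lim (\<lambda>m. c_grade (poly_ring R m) (Idl\<^bsub>poly_ring R m\<^esub> (ring.indexed_const R ` I))
                (base_change R (poly_ring R m) (ring.indexed_const R) M))"


section \<open>Height, dimension and Cohen-Macaulay rings\<close>

definition prime_chain :: "('a, 'm) ring_scheme \<Rightarrow> 'a set list \<Rightarrow> bool" where
  "prime_chain R ps \<longleftrightarrow> ps \<noteq> [] \<and> (\<forall>P\<in>set ps. primeideal P R) \<and> sorted_wrt (\<subset>) ps"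

definition height :: "('a, 'm) ring_scheme \<Rightarrow> 'a set \<Rightarrow> enat" where
  "height R P = (SUP ps \<in> {ps. prime_chain R ps \<and> last ps = P}. enat (length ps - 1))"

definition krull_dim :: "('a, 'm) ring_scheme \<Rightarrow> enat" where
  "krull_dim R = (SUP ps \<in> {ps. prime_chain R ps}. enat (length ps - 1))"

definition fraction_rel :: "('a, 'm) ring_scheme \<Rightarrow> 'a set \<Rightarrow> (('a \<times> 'a) \<times> ('a \<times> 'a)) set" where
  "fraction_rel R S =
     {((a, s), (b, t)). a \<in> carrier R \<and> b \<in> carrier R \<and> s \<in> S \<and> t \<in> S \<and>
        (\<exists>u\<in>S. u \<otimes>\<^bsub>R\<^esub> (t \<otimes>\<^bsub>R\<^esub> a) = u \<otimes>\<^bsub>R\<^esub> (s \<otimes>\<^bsub>R\<^esub> b))}"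

definition localization :: "('a, 'm) ring_scheme \<Rightarrow> 'a set \<Rightarrow> ('a \<times> 'a) set ring" where
  "localization R S =
     \<lparr>carrier = (carrier R \<times> S) // fraction_rel R S,
      monoid.mult = (\<lambda>U V. \<Union>(a, s)\<in>U. \<Union>(b, t)\<in>V. fraction_rel R S `` {(a \<otimes>\<^bsub>R\<^esub> b, s \<otimes>\<^bsub>R\<^esub> t)}),
      one = fraction_rel R S `` {(\<one>\<^bsub>R\<^esub>, \<one>\<^bsub>R\<^esub>)},
      ring.zero = fraction_rel R S `` {(\<zero>\<^bsub>R\<^esub>, \<one>\<^bsub>R\<^esub>)},
      add = (\<lambda>U V. \<Union>(a, s)\<in>U. \<Union>(b, t)\<in>V.
               fraction_rel R S `` {((t \<otimes>\<^bsub>R\<^esub> a) \<oplus>\<^bsub>R\<^esub> (s \<otimes>\<^bsub>R\<^esub> b), s \<otimes>\<^bsub>R\<^esub> t)})\<rparr>"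

text \<open>For a Noetherian local ring \<open>(R, I)\<close> the depth of \<open>R\<close> is \<open>c_grade R I R\<close>.\<close>

definition cohen_macaulay_local :: "('a, 'm) ring_scheme \<Rightarrow> bool" where
  "cohen_macaulay_local R \<longleftrightarrow>
     cring R \<and> noetherian_ring R \<and>
     (\<exists>I. {J. maximalideal J R} = {I} \<and> c_grade R I (self_module R) = krull_dim R)"

definition cohen_macaulay_ring :: "('a, 'm) ring_scheme \<Rightarrow> bool" where
  "cohen_macaulay_ring R \<longleftrightarrow>
     cring R \<and> noetherian_ring R \<and>
     (\<forall>I. maximalideal I R \<longrightarrow> cohen_macaulay_local (localization R (carrier R - I)))"


section \<open>Direct limits of rings\<close>

locale direct_system =
  fixes \<Gamma> :: "'i set" and below :: "'i \<Rightarrow> 'i \<Rightarrow> bool"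
    and A :: "'i \<Rightarrow> ('a, 'm) ring_scheme" and \<phi> :: "'i \<Rightarrow> 'i \<Rightarrow> 'a \<Rightarrow> 'a"
  assumes nonempty: "\<Gamma> \<noteq> {}"
    and below_refl: "i \<in> \<Gamma> \<Longrightarrow> below i i"
    and below_trans: "\<lbrakk>i \<in> \<Gamma>; j \<in> \<Gamma>; k \<in> \<Gamma>; below i j; below j k\<rbrakk> \<Longrightarrow> below i k"
    and directed: "\<lbrakk>i \<in> \<Gamma>; j \<in> \<Gamma>\<rbrakk> \<Longrightarrow> \<exists>k\<in>\<Gamma>. below i k \<and> below j k"
    and cring: "i \<in> \<Gamma> \<Longrightarrow> cring (A i)"
    and hom: "\<lbrakk>i \<in> \<Gamma>; j \<in> \<Gamma>; below i j\<rbrakk> \<Longrightarrow> \<phi> i j \<in> ring_hom (A i) (A j)"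
    and hom_refl: "\<lbrakk>i \<in> \<Gamma>; x \<in> carrier (A i)\<rbrakk> \<Longrightarrow> \<phi> i i x = x"
    and hom_trans: "\<lbrakk>i \<in> \<Gamma>; j \<in> \<Gamma>; k \<in> \<Gamma>; below i j; below j k; x \<in> carrier (A i)\<rbrakk>
                      \<Longrightarrow> \<phi> j k (\<phi> i j x) = \<phi> i k x"

definition limit_rel ::
  "'i set \<Rightarrow> ('i \<Rightarrow> 'i \<Rightarrow> bool) \<Rightarrow> ('i \<Rightarrow> ('a, 'm) ring_scheme) \<Rightarrow> ('i \<Rightarrow> 'i \<Rightarrow> 'a \<Rightarrow> 'a)
     \<Rightarrow> (('i \<times> 'a) \<times> ('i \<times> 'a)) set" where
  "limit_rel \<Gamma> below A \<phi> =
     {((i, x), (j, y)). i \<in> \<Gamma> \<and> j \<in> \<Gamma> \<and> x \<in> carrier (A i) \<and> y \<in> carrier (A j) \<and>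
        (\<exists>k\<in>\<Gamma>. below i k \<and> below j k \<and> \<phi> i k x = \<phi> j k y)}"

definition limit_map ::
  "'i set \<Rightarrow> ('i \<Rightarrow> 'i \<Rightarrow> bool) \<Rightarrow> ('i \<Rightarrow> ('a, 'm) ring_scheme) \<Rightarrow> ('i \<Rightarrow> 'i \<Rightarrow> 'a \<Rightarrow> 'a)
     \<Rightarrow> 'i \<Rightarrow> 'a \<Rightarrow> ('i \<times> 'a) set" where
  "limit_map \<Gamma> below A \<phi> i x = limit_rel \<Gamma> below A \<phi> `` {(i, x)}"

text \<open>The unions below are unions of equal classes: the result does not depend on the
  representatives or on the common upper bound \<open>k\<close> (see \<open>limit_map_add\<close>, \<open>limit_map_mult\<close>,
  \<open>limit_map_one\<close>, \<open>limit_map_zero\<close>).\<close>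

definition direct_limit ::
  "'i set \<Rightarrow> ('i \<Rightarrow> 'i \<Rightarrow> bool) \<Rightarrow> ('i \<Rightarrow> ('a, 'm) ring_scheme) \<Rightarrow> ('i \<Rightarrow> 'i \<Rightarrow> 'a \<Rightarrow> 'a)
     \<Rightarrow> ('i \<times> 'a) set ring" where
  "direct_limit \<Gamma> below A \<phi> =
     \<lparr>carrier = (SIGMA i:\<Gamma>. carrier (A i)) // limit_rel \<Gamma> below A \<phi>,
      monoid.mult = (\<lambda>U V. \<Union>(i, x)\<in>U. \<Union>(j, y)\<in>V. \<Union>k\<in>{k\<in>\<Gamma>. below i k \<and> below j k}.
                limit_map \<Gamma> below A \<phi> k (\<phi> i k x \<otimes>\<^bsub>A k\<^esub> \<phi> j k y)),
      one = (\<Union>i\<in>\<Gamma>. limit_map \<Gamma> below A \<phi> i \<one>\<^bsub>A i\<^esub>),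
      ring.zero = (\<Union>i\<in>\<Gamma>. limit_map \<Gamma> below A \<phi> i \<zero>\<^bsub>A i\<^esub>),
      add = (\<lambda>U V. \<Union>(i, x)\<in>U. \<Union>(j, y)\<in>V. \<Union>k\<in>{k\<in>\<Gamma>. below i k \<and> below j k}.
                limit_map \<Gamma> below A \<phi> k (\<phi> i k x \<oplus>\<^bsub>A k\<^esub> \<phi> j k y))\<rparr>"

definition limit_contraction ::
  "'i set \<Rightarrow> ('i \<Rightarrow> 'i \<Rightarrow> bool) \<Rightarrow> ('i \<Rightarrow> ('a, 'm) ring_scheme) \<Rightarrow> ('i \<Rightarrow> 'i \<Rightarrow> 'a \<Rightarrow> 'a)
     \<Rightarrow> ('i \<times> 'a) set set \<Rightarrow> 'i \<Rightarrow> 'a set" where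
  "limit_contraction \<Gamma> below A \<phi> P i = {x \<in> carrier (A i). limit_map \<Gamma> below A \<phi> i x \<in> P}"

context direct_system
begin

abbreviation rel where "rel \<equiv> limit_rel \<Gamma> below A \<phi>"
abbreviation cls where "cls \<equiv> limit_map \<Gamma> below A \<phi>"
abbreviation L where "L \<equiv> direct_limit \<Gamma> below A \<phi>"

lemma hom_closed: "\<lbrakk>i \<in> \<Gamma>; j \<in> \<Gamma>; below i j; x \<in> carrier (A i)\<rbrakk> \<Longrightarrow> \<phi> i j x \<in> carrier (A j)"
  using hom ring_hom_closed by metis

lemma equiv_limit_rel: "equiv (SIGMA i:\<Gamma>. carrier (A i)) rel"
proof (rule equivI)
  show "rel \<subseteq> (SIGMA i:\<Gamma>. carrier (A i)) \<times> (SIGMA i:\<Gamma>. carrier (A i))"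
    by (auto simp: limit_rel_def)
  show "refl_on (SIGMA i:\<Gamma>. carrier (A i)) rel"
  proof (rule refl_onI)
    fix a assume "a \<in> (SIGMA i:\<Gamma>. carrier (A i))"
    then obtain i x where "a = (i, x)" "i \<in> \<Gamma>" "x \<in> carrier (A i)" by blast
    then show "(a, a) \<in> rel" using below_refl[of i] unfolding limit_rel_def by blast
  qed
  show "sym rel"
  proof (rule symI)
    fix a b assume "(a, b) \<in> rel"
    then obtain i x j y k where "a = (i, x)" "b = (j, y)"
      "i \<in> \<Gamma>" "j \<in> \<Gamma>" "x \<in> carrier (A i)" "y \<in> carrier (A j)"
      "k \<in> \<Gamma>" "below i k" "below j k" "\<phi> j k y = \<phi> i k x"
      unfolding limit_rel_def by auto
    then show "(b, a) \<in> rel" unfolding limit_rel_def by blast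
  qed
  show "trans rel"
  proof (rule transI)
    fix a b c assume "(a, b) \<in> rel" "(b, c) \<in> rel"
    then obtain i x j y l z k k' where abc: "a = (i, x)" "b = (j, y)" "c = (l, z)"
      and m: "i \<in> \<Gamma>" "j \<in> \<Gamma>" "l \<in> \<Gamma>" "x \<in> carrier (A i)" "y \<in> carrier (A j)" "z \<in> carrier (A l)"
      and k: "k \<in> \<Gamma>" "below i k" "below j k" "\<phi> i k x = \<phi> j k y"
      and k': "k' \<in> \<Gamma>" "below j k'" "below l k'" "\<phi> j k' y = \<phi> l k' z"
      unfolding limit_rel_def by blast
    obtain n where n: "n \<in> \<Gamma>" "below k n" "below k' n" using directed k(1) k'(1) by blast
    have "\<phi> i n x = \<phi> k n (\<phi> i k x)" using hom_trans[of i k n x] m k n by simp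
    also have "\<dots> = \<phi> j n y" using hom_trans[of j k n y] m k n by simp
    also have "\<dots> = \<phi> k' n (\<phi> j k' y)" using hom_trans[of j k' n y] m k' n by simp
    also have "\<dots> = \<phi> l n z" using hom_trans[of l k' n z] m k' n by simp
    finally have "\<phi> i n x = \<phi> l n z" .
    moreover have "below i n" "below l n"
      using below_trans[of i k n] below_trans[of l k' n] m k k' n by auto
    ultimately show "(a, c) \<in> rel" using m n unfolding limit_rel_def abc by blast
  qed
qed

lemma cls_eq_iff:
  assumes "i \<in> \<Gamma>" "j \<in> \<Gamma>" "x \<in> carrier (A i)" "y \<in> carrier (A j)"
  shows "cls i x = cls j y \<longleftrightarrow> (\<exists>k\<in>\<Gamma>. below i k \<and> below j k \<and> \<phi> i k x = \<phi> j k y)"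
proof -
  have "cls i x = cls j y \<longleftrightarrow> ((i, x), (j, y)) \<in> rel"
    unfolding limit_map_def using equiv_limit_rel assms by (intro eq_equiv_class_iff) auto
  then show ?thesis using assms by (simp add: limit_rel_def)
qed

lemma mem_cls_iff:
  "(j, y) \<in> cls i x \<longleftrightarrow> i \<in> \<Gamma> \<and> j \<in> \<Gamma> \<and> x \<in> carrier (A i) \<and> y \<in> carrier (A j) \<and> cls i x = cls j y"
  using cls_eq_iff[of i j x y] by (auto simp: limit_map_def limit_rel_def)

lemma cls_hom:
  assumes "i \<in> \<Gamma>" "j \<in> \<Gamma>" "below i j" "x \<in> carrier (A i)"
  shows "cls j (\<phi> i j x) = cls i x"
proof -
  have "\<phi> j j (\<phi> i j x) = \<phi> i j x" using assms hom_closed hom_refl by simp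
  then show ?thesis
    using assms cls_eq_iff[of j i "\<phi> i j x" x] hom_closed[of i j x] below_refl by blast
qed

lemma cls_closed: "\<lbrakk>i \<in> \<Gamma>; x \<in> carrier (A i)\<rbrakk> \<Longrightarrow> cls i x \<in> carrier L"
  by (auto simp: direct_limit_def limit_map_def intro: quotientI)

lemma limit_carrierE:
  assumes "U \<in> carrier L"
  obtains i x where "i \<in> \<Gamma>" "x \<in> carrier (A i)" "U = cls i x"
  using assms by (auto simp: direct_limit_def limit_map_def elim!: quotientE)

lemma cls_congruent2:
  assumes "i \<in> \<Gamma>" "j \<in> \<Gamma>" "x \<in> carrier (A i)" "y \<in> carrier (A j)" "cls i x = cls j y"
    and "i' \<in> \<Gamma>" "j' \<in> \<Gamma>" "x' \<in> carrier (A i')" "y' \<in> carrier (A j')" "cls i' x' = cls j' y'"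
    and k: "k \<in> \<Gamma>" "below i k" "below i' k" and l: "l \<in> \<Gamma>" "below j l" "below j' l"
    and opc: "\<And>k x y. \<lbrakk>k \<in> \<Gamma>; x \<in> carrier (A k); y \<in> carrier (A k)\<rbrakk> \<Longrightarrow> opr k x y \<in> carrier (A k)"
    and oph: "\<And>k l x y. \<lbrakk>k \<in> \<Gamma>; l \<in> \<Gamma>; below k l; x \<in> carrier (A k); y \<in> carrier (A k)\<rbrakk>
                \<Longrightarrow> \<phi> k l (opr k x y) = opr l (\<phi> k l x) (\<phi> k l y)"
  shows "cls k (opr k (\<phi> i k x) (\<phi> i' k x')) = cls l (opr l (\<phi> j l y) (\<phi> j' l y'))"
proof -
  have "cls k (\<phi> i k x) = cls l (\<phi> j l y)"
    using cls_hom[of i k x] cls_hom[of j l y] assms by simp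
  then obtain n where n: "n \<in> \<Gamma>" "below k n" "below l n" "\<phi> k n (\<phi> i k x) = \<phi> l n (\<phi> j l y)"
    using cls_eq_iff[of k l "\<phi> i k x" "\<phi> j l y"] assms hom_closed by auto
  have "cls k (\<phi> i' k x') = cls l (\<phi> j' l y')"
    using cls_hom[of i' k x'] cls_hom[of j' l y'] assms by simp
  then obtain n' where n': "n' \<in> \<Gamma>" "below k n'" "below l n'" "\<phi> k n' (\<phi> i' k x') = \<phi> l n' (\<phi> j' l y')"
    using cls_eq_iff[of k l "\<phi> i' k x'" "\<phi> j' l y'"] assms hom_closed by auto
  obtain q where q: "q \<in> \<Gamma>" "below n q" "below n' q" using directed n n' by blast
  have c: "\<phi> i k x \<in> carrier (A k)" "\<phi> i' k x' \<in> carrier (A k)"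
    "\<phi> j l y \<in> carrier (A l)" "\<phi> j' l y' \<in> carrier (A l)"
    using assms hom_closed by auto
  have kq: "below k q" "below l q"
    using below_trans[of k n q] below_trans[of l n q] n q k l by auto
  have e: "\<phi> k q (\<phi> i k x) = \<phi> l q (\<phi> j l y)"
    using hom_trans[of k n q "\<phi> i k x"] hom_trans[of l n q "\<phi> j l y"] n q k l c by simp
  have e': "\<phi> k q (\<phi> i' k x') = \<phi> l q (\<phi> j' l y')"
    using hom_trans[of k n' q "\<phi> i' k x'"] hom_trans[of l n' q "\<phi> j' l y'"] n' q k l c by simp
  have "\<phi> k q (opr k (\<phi> i k x) (\<phi> i' k x')) = \<phi> l q (opr l (\<phi> j l y) (\<phi> j' l y'))"
    using oph[of k q] oph[of l q] k l q kq c e e' by simp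
  then show ?thesis
    using cls_eq_iff[of k l] opc k l q kq c by blast
qed

lemma limit_op:
  assumes i: "i \<in> \<Gamma>" "j \<in> \<Gamma>" "x \<in> carrier (A i)" "y \<in> carrier (A j)"
    and k: "k \<in> \<Gamma>" "below i k" "below j k"
    and opc: "\<And>k x y. \<lbrakk>k \<in> \<Gamma>; x \<in> carrier (A k); y \<in> carrier (A k)\<rbrakk> \<Longrightarrow> opr k x y \<in> carrier (A k)"
    and oph: "\<And>k l x y. \<lbrakk>k \<in> \<Gamma>; l \<in> \<Gamma>; below k l; x \<in> carrier (A k); y \<in> carrier (A k)\<rbrakk>
                \<Longrightarrow> \<phi> k l (opr k x y) = opr l (\<phi> k l x) (\<phi> k l y)"
  shows "(\<Union>(i, x)\<in>cls i x. \<Union>(j, y)\<in>cls j y. \<Union>k\<in>{k\<in>\<Gamma>. below i k \<and> below j k}.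
            cls k (opr k (\<phi> i k x) (\<phi> j k y))) = cls k (opr k (\<phi> i k x) (\<phi> j k y))" (is "?U = ?c")
proof (rule equalityI; rule subsetI)
  fix z assume "z \<in> ?U"
  then obtain i' x' j' y' k' where m: "(i', x') \<in> cls i x" "(j', y') \<in> cls j y"
    "k' \<in> \<Gamma>" "below i' k'" "below j' k'" "z \<in> cls k' (opr k' (\<phi> i' k' x') (\<phi> j' k' y'))"
    by blast
  have "cls k (opr k (\<phi> i k x) (\<phi> j k y)) = cls k' (opr k' (\<phi> i' k' x') (\<phi> j' k' y'))"
    using m i k unfolding mem_cls_iff by (intro cls_congruent2 opc oph) auto
  then show "z \<in> ?c" using m by simp
next
  fix z assume "z \<in> ?c"
  moreover have "(i, x) \<in> cls i x" "(j, y) \<in> cls j y" using i by (auto simp: mem_cls_iff)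
  ultimately show "z \<in> ?U" using k by blast
qed

lemma limit_map_mult:
  assumes "i \<in> \<Gamma>" "x \<in> carrier (A i)" "y \<in> carrier (A i)"
  shows "cls i x \<otimes>\<^bsub>L\<^esub> cls i y = cls i (x \<otimes>\<^bsub>A i\<^esub> y)"
proof -
  have "cls i x \<otimes>\<^bsub>L\<^esub> cls i y = cls i (\<phi> i i x \<otimes>\<^bsub>A i\<^esub> \<phi> i i y)"
    using limit_op[where opr = "\<lambda>k. monoid.mult (A k)", of i i x y i] assms below_refl
    by (simp add: direct_limit_def ring_hom_mult[OF hom] cring.cring_simprules(5)[OF cring])
  then show ?thesis using assms hom_refl by simp
qed

lemma limit_map_add:
  assumes "i \<in> \<Gamma>" "x \<in> carrier (A i)" "y \<in> carrier (A i)"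
  shows "cls i x \<oplus>\<^bsub>L\<^esub> cls i y = cls i (x \<oplus>\<^bsub>A i\<^esub> y)"
proof -
  have "cls i x \<oplus>\<^bsub>L\<^esub> cls i y = cls i (\<phi> i i x \<oplus>\<^bsub>A i\<^esub> \<phi> i i y)"
    using limit_op[where opr = "\<lambda>k. add (A k)", of i i x y i] assms below_refl
    by (simp add: direct_limit_def ring_hom_add[OF hom] cring.cring_simprules(1)[OF cring])
  then show ?thesis using assms hom_refl by simp
qed

lemma limit_const:
  assumes i: "i \<in> \<Gamma>"
    and c: "\<And>k. k \<in> \<Gamma> \<Longrightarrow> c k \<in> carrier (A k)"
    and h: "\<And>k l. \<lbrakk>k \<in> \<Gamma>; l \<in> \<Gamma>; below k l\<rbrakk> \<Longrightarrow> \<phi> k l (c k) = c l"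
  shows "(\<Union>i\<in>\<Gamma>. cls i (c i)) = cls i (c i)"
proof -
  have "cls j (c j) = cls i (c i)" if j: "j \<in> \<Gamma>" for j
  proof -
    obtain k where "k \<in> \<Gamma>" "below i k" "below j k" using directed i j by blast
    then show ?thesis using cls_hom[of i k "c i"] cls_hom[of j k "c j"] h c i j by simp
  qed
  then have "(\<Union>j\<in>\<Gamma>. cls j (c j)) = (\<Union>j\<in>\<Gamma>. cls i (c i))" by (intro SUP_cong refl)
  then show ?thesis using i by auto
qed

lemma limit_map_one: "i \<in> \<Gamma> \<Longrightarrow> cls i \<one>\<^bsub>A i\<^esub> = \<one>\<^bsub>L\<^esub>"
  using limit_const[of i "\<lambda>i. \<one>\<^bsub>A i\<^esub>"] cring.cring_simprules(6)[OF cring] ring_hom_one[OF hom]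
  by (simp add: direct_limit_def)

lemma limit_map_zero:
  assumes "i \<in> \<Gamma>"
  shows "cls i \<zero>\<^bsub>A i\<^esub> = \<zero>\<^bsub>L\<^esub>"
proof -
  have "ring (A k)" if "k \<in> \<Gamma>" for k using cring[OF that] by (rule cring.axioms(1))
  then have "\<phi> k l \<zero>\<^bsub>A k\<^esub> = \<zero>\<^bsub>A l\<^esub>" if "k \<in> \<Gamma>" "l \<in> \<Gamma>" "below k l" for k l
    using ring_hom_zero[OF hom] that by blast
  then show ?thesis
    using limit_const[of i "\<lambda>i. \<zero>\<^bsub>A i\<^esub>"] cring.cring_simprules(2)[OF cring] assms
    by (simp add: direct_limit_def)
qed

lemma common_index3:
  assumes "U \<in> carrier L" "V \<in> carrier L" "W \<in> carrier L"
  obtains k x y z where "k \<in> \<Gamma>" "x \<in> carrier (A k)" "y \<in> carrier (A k)" "z \<in> carrier (A k)"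
    "U = cls k x" "V = cls k y" "W = cls k z"
proof -
  obtain i x j y l z where U: "i \<in> \<Gamma>" "x \<in> carrier (A i)" "U = cls i x"
    and V: "j \<in> \<Gamma>" "y \<in> carrier (A j)" "V = cls j y"
    and W: "l \<in> \<Gamma>" "z \<in> carrier (A l)" "W = cls l z"
    using assms by (elim limit_carrierE) blast
  obtain k where k: "k \<in> \<Gamma>" "below i k" "below j k" using directed U V by blast
  obtain n where n: "n \<in> \<Gamma>" "below k n" "below l n" using directed k W by blast
  have "below i n" "below j n"
    using below_trans[of i k n] below_trans[of j k n] U V k n by auto
  then show ?thesis
    using that[of n "\<phi> i n x" "\<phi> j n y" "\<phi> l n z"] U V W n cls_hom hom_closed by simp
qed

lemma direct_limit_cring: "cring L"
proof (rule cringI)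
  note ops = limit_map_add limit_map_mult cls_closed
  note simps = ops cring.cring_simprules(1,2,5,6,7,11,13,16)[OF cring]
  note add_comm = cring.cring_simprules(10)[OF cring]
  note mult_comm = cring.cring_simprules(14)[OF cring]
  obtain i0 where i0: "i0 \<in> \<Gamma>" using nonempty by blast
  have zc: "\<zero>\<^bsub>L\<^esub> \<in> carrier L"
    using cls_closed[OF i0 cring.cring_simprules(2)[OF cring[OF i0]]]
    unfolding limit_map_zero[OF i0] .
  have oc: "\<one>\<^bsub>L\<^esub> \<in> carrier L"
    using cls_closed[OF i0 cring.cring_simprules(6)[OF cring[OF i0]]]
    unfolding limit_map_one[OF i0] .
  show "abelian_group L"
  proof (rule abelian_groupI)
    fix U V W assume UVW: "U \<in> carrier L" "V \<in> carrier L" "W \<in> carrier L"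
    then obtain k x y z where k: "k \<in> \<Gamma>" "x \<in> carrier (A k)" "y \<in> carrier (A k)"
      "z \<in> carrier (A k)" "U = cls k x" "V = cls k y" "W = cls k z"
      by (rule common_index3)
    show "U \<oplus>\<^bsub>L\<^esub> V \<oplus>\<^bsub>L\<^esub> W = U \<oplus>\<^bsub>L\<^esub> (V \<oplus>\<^bsub>L\<^esub> W)"
      using k by (simp add: simps)
  next
    fix U V assume "U \<in> carrier L" "V \<in> carrier L"
    then obtain k x y where
      k: "k \<in> \<Gamma>" "x \<in> carrier (A k)" "y \<in> carrier (A k)" "U = cls k x" "V = cls k y"
      using common_index3[of U V V] by blast
    show "U \<oplus>\<^bsub>L\<^esub> V \<in> carrier L" "U \<oplus>\<^bsub>L\<^esub> V = V \<oplus>\<^bsub>L\<^esub> U"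
      using k by (simp_all add: simps add_comm mult_comm)
  next
    fix U assume "U \<in> carrier L"
    then obtain k x where k: "k \<in> \<Gamma>" "x \<in> carrier (A k)" "U = cls k x" by (rule limit_carrierE)
    then show "\<zero>\<^bsub>L\<^esub> \<oplus>\<^bsub>L\<^esub> U = U"
      using limit_map_add[OF k(1) _ k(2), of "\<zero>\<^bsub>A k\<^esub>"] k cring.cring_simprules(2,8)[OF cring[OF k(1)]]
      by (simp add: limit_map_zero)
    have "cls k (\<ominus>\<^bsub>A k\<^esub> x) \<oplus>\<^bsub>L\<^esub> U = \<zero>\<^bsub>L\<^esub>"
      using k cring.cring_simprules(3,9)[OF cring[OF k(1)]] by (simp add: limit_map_add limit_map_zero)
    then show "\<exists>V\<in>carrier L. V \<oplus>\<^bsub>L\<^esub> U = \<zero>\<^bsub>L\<^esub>"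
      using k cring.cring_simprules(3)[OF cring[OF k(1)]] cls_closed by blast
  qed (rule zc)
  show "Group.comm_monoid L"
  proof (rule comm_monoidI)
    fix U V W assume UVW: "U \<in> carrier L" "V \<in> carrier L" "W \<in> carrier L"
    then obtain k x y z where k: "k \<in> \<Gamma>" "x \<in> carrier (A k)" "y \<in> carrier (A k)"
      "z \<in> carrier (A k)" "U = cls k x" "V = cls k y" "W = cls k z"
      by (rule common_index3)
    show "U \<otimes>\<^bsub>L\<^esub> V \<otimes>\<^bsub>L\<^esub> W = U \<otimes>\<^bsub>L\<^esub> (V \<otimes>\<^bsub>L\<^esub> W)"
      using k by (simp add: simps)
  next
    fix U V assume "U \<in> carrier L" "V \<in> carrier L"
    then obtain k x y where
      k: "k \<in> \<Gamma>" "x \<in> carrier (A k)" "y \<in> carrier (A k)" "U = cls k x" "V = cls k y"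
      using common_index3[of U V V] by blast
    show "U \<otimes>\<^bsub>L\<^esub> V \<in> carrier L" "U \<otimes>\<^bsub>L\<^esub> V = V \<otimes>\<^bsub>L\<^esub> U"
      using k by (simp_all add: simps add_comm mult_comm)
  next
    fix U assume "U \<in> carrier L"
    then obtain k x where k: "k \<in> \<Gamma>" "x \<in> carrier (A k)" "U = cls k x" by (rule limit_carrierE)
    then show "\<one>\<^bsub>L\<^esub> \<otimes>\<^bsub>L\<^esub> U = U"
      using limit_map_mult[OF k(1) _ k(2), of "\<one>\<^bsub>A k\<^esub>"] k cring.cring_simprules(6,12)[OF cring[OF k(1)]]
      by (simp add: limit_map_one)
  qed (rule oc)
  fix U V W assume UVW: "U \<in> carrier L" "V \<in> carrier L" "W \<in> carrier L"
  then obtain k x y z where k: "k \<in> \<Gamma>" "x \<in> carrier (A k)" "y \<in> carrier (A k)"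
    "z \<in> carrier (A k)" "U = cls k x" "V = cls k y" "W = cls k z"
    by (rule common_index3)
  show "(U \<oplus>\<^bsub>L\<^esub> V) \<otimes>\<^bsub>L\<^esub> W = U \<otimes>\<^bsub>L\<^esub> W \<oplus>\<^bsub>L\<^esub> V \<otimes>\<^bsub>L\<^esub> W"
    using k by (simp add: simps)
qed

lemma limit_map_ring_hom: "i \<in> \<Gamma> \<Longrightarrow> cls i \<in> ring_hom (A i) L"
  by (rule ring_hom_memI) (simp_all add: cls_closed limit_map_add limit_map_mult limit_map_one)

end

end

theory Submission
  imports Defs
begin

text \<open>
  The polynomial grade is squeezed between two bounds. Neither proof uses homological algebra:
  grade is treated through regular sequences on cyclic modules \<open>R / I\<close>.

  \<^bold>\<open>Upper bound.\<close> For a prime \<open>p\<close> of height \<open>n\<close> in any commutative ring \<open>R\<close>, an ideal \<open>p R[t]\<close> contains no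
  weak regular sequence of length \<open>n + 1\<close> (\<open>polynomial_grade_le_height\<close>). Such a sequence involves only
  finitely many coefficients, all in \<open>p\<close>. Kronecker's theorem, in the constructive form of Coquand and
  Lombardi, puts any finite subset of \<open>p\<close> into the radical of an ideal generated by \<open>n\<close> elements of \<open>p\<close>,
  once the elements outside \<open>p\<close> are inverted (\<open>kronecker\<close>). After this localization the sequence lies in
  the radical of an ideal with \<open>n\<close> generators, and an ideal other than the whole ring has grade at most the
  number of elements that generate it up to radical (\<open>grade_le_number_of_radical_generators\<close>). So these
  \<open>n\<close> elements of \<open>p\<close> generate the unit ideal of the localization, which is absurd.

  \<^bold>\<open>Lower bound.\<close> A chain of \<open>n + 1\<close> primes ending at \<open>p\<close> contracts to strict chains ending at the \<open>p\<^sub>\<gamma>\<close> for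
  all large \<open>\<gamma>\<close>. Since \<open>A\<^sub>\<gamma>\<close> is Cohen-Macaulay, \<open>p\<^sub>\<gamma>\<close> contains a weak regular sequence of length \<open>n\<close>
  (\<open>cohen_macaulay_grade_ge_prime_chain\<close>). Under either hypothesis there is then a fixed \<open>\<delta>\<close> such that
  \<open>p\<^sub>\<delta> A\<^sub>\<gamma>\<close> contains one for every \<open>\<gamma>\<close> above \<open>\<delta>\<close>. These sequences vary with \<open>\<gamma>\<close>, so they have no limit. Let
  \<open>c\<^sub>0, \<dots>, c\<^sub>k\<close> generate \<open>p\<^sub>\<delta>\<close>. If \<open>p\<^sub>\<delta> A\<^sub>\<gamma>\<close> contains any weak regular sequence of length \<open>n\<close>, then the generic
  elements \<open>c\<^sub>0 + c\<^sub>1 t\<^sub>i + \<dots> + c\<^sub>k t\<^sub>i\<^sup>k\<close> for \<open>i < n\<close> form one over \<open>A\<^sub>\<gamma>\<close> (\<open>wreg_generic\<close>). They are given by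
  the same formula for all \<open>\<gamma>\<close>, so their regularity passes to the limit (\<open>wreg_generic_limit\<close>).

  Behind all of this is one exchange lemma (\<open>grade_ge_exchange\<close>): if \<open>a\<close> and \<open>b\<close> in \<open>J\<close> are nonzerodivisors
  on \<open>R / I\<close>, then \<open>J\<close> has the same grade on \<open>R / (I + a)\<close> and on \<open>R / (I + b)\<close>. It holds whenever finitely
  many ideals admit a common nonzerodivisor in \<open>J\<close> as soon as each admits one. In a Noetherian ring this is
  prime avoidance; in a polynomial ring with infinitely many variables it is McCoy's theorem, applied to a
  polynomial in a variable that occurs nowhere else.
\<close>

section \<open>Regular sequences modulo an ideal, and their exchange\<close>

definition nzd_mod :: "('a, 'm) ring_scheme \<Rightarrow> 'a set \<Rightarrow> 'a \<Rightarrow> bool" where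
  "nzd_mod R I x \<longleftrightarrow> (\<forall>y\<in>carrier R. x \<otimes>\<^bsub>R\<^esub> y \<in> I \<longrightarrow> y \<in> I)"

text \<open>No nonzero element of \<open>R / I\<close> is killed by \<open>J\<close>. This follows from the presence in \<open>J\<close> of a nonzerodivisor on
  \<open>R / I\<close>, and the content of \<open>noetherian_grade_exchange\<close> and \<open>polynomial_grade_exchange\<close> is the converse.\<close>

definition faithful_mod :: "('a, 'm) ring_scheme \<Rightarrow> 'a set \<Rightarrow> 'a set \<Rightarrow> bool" where
  "faithful_mod R J I \<longleftrightarrow> (\<forall>y\<in>carrier R. (\<forall>x\<in>J. x \<otimes>\<^bsub>R\<^esub> y \<in> I) \<longrightarrow> y \<in> I)"

text \<open>Weak regularity on \<open>R / I\<close>. The ideal is a parameter so that the induction can absorb the first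
  element into it; \<open>wreg_iff_nth\<close> relates this to the condition on initial segments.\<close>

fun wreg :: "('a, 'm) ring_scheme \<Rightarrow> 'a set \<Rightarrow> 'a list \<Rightarrow> bool" where
  "wreg R I [] \<longleftrightarrow> True"
| "wreg R I (x # xs) \<longleftrightarrow> nzd_mod R I x \<and> wreg R (Idl\<^bsub>R\<^esub> (insert x I)) xs"

text \<open>For \<open>J\<close> inside the ring, \<open>grade_ge R J I n\<close> says that \<open>J\<close> has classical grade at least \<open>n\<close> on \<open>R / I\<close>
  (\<open>c_grade_self_module_ge_iff\<close> for \<open>I = 0\<close>).\<close>

fun grade_ge :: "('a, 'm) ring_scheme \<Rightarrow> 'a set \<Rightarrow> 'a set \<Rightarrow> nat \<Rightarrow> bool" where
  "grade_ge R J I 0 \<longleftrightarrow> True"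
| "grade_ge R J I (Suc n) \<longleftrightarrow> (\<exists>x\<in>J. nzd_mod R I x \<and> grade_ge R J (Idl\<^bsub>R\<^esub> (insert x I)) n)"

lemma grade_ge_iff_wreg:
  "grade_ge R J I n \<longleftrightarrow> (\<exists>xs. set xs \<subseteq> J \<and> length xs = n \<and> wreg R I xs)"
proof (induction n arbitrary: I)
  case (Suc n)
  show ?case
  proof
    assume "grade_ge R J I (Suc n)"
    then obtain x xs where "x \<in> J" "nzd_mod R I x" "set xs \<subseteq> J" "length xs = n"
      "wreg R (Idl\<^bsub>R\<^esub> (insert x I)) xs"
      using Suc by auto
    then have "set (x # xs) \<subseteq> J \<and> length (x # xs) = Suc n \<and> wreg R I (x # xs)" by simp
    then show "\<exists>xs. set xs \<subseteq> J \<and> length xs = Suc n \<and> wreg R I xs" by blast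
  next
    assume "\<exists>xs. set xs \<subseteq> J \<and> length xs = Suc n \<and> wreg R I xs"
    then obtain x xs where "x \<in> J" "nzd_mod R I x" "set xs \<subseteq> J" "length xs = n"
      "wreg R (Idl\<^bsub>R\<^esub> (insert x I)) xs"
      by (auto simp: length_Suc_conv)
    then show "grade_ge R J I (Suc n)" using Suc by auto
  qed
qed simp

lemma grade_ge_mono: "grade_ge R J I n \<Longrightarrow> k \<le> n \<Longrightarrow> grade_ge R J I k"
proof (induction n arbitrary: I k)
  case (Suc n)
  then show ?case by (cases k) auto
qed simp

context cring
begin

lemma ideal_sub: "ideal I R \<Longrightarrow> I \<subseteq> carrier R"
  by (rule subsetI) (erule (1) ideal.Icarr)

lemma Idl_Idl_Un:
  assumes "S \<subseteq> carrier R" "U \<subseteq> carrier R"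
  shows "Idl (Idl S \<union> U) = Idl (S \<union> U)"
proof
  have SU: "ideal (Idl (S \<union> U)) R" "S \<union> U \<subseteq> Idl (S \<union> U)"
    using assms genideal_ideal[of "S \<union> U"] genideal_self[of "S \<union> U"] by auto
  then have "Idl S \<subseteq> Idl (S \<union> U)" using genideal_minimal by auto
  then show "Idl (Idl S \<union> U) \<subseteq> Idl (S \<union> U)" using SU genideal_minimal by auto
  have c: "Idl S \<union> U \<subseteq> carrier R"
    using assms ideal.Icarr[OF genideal_ideal] by blast
  then have "Idl S \<union> U \<subseteq> Idl (Idl S \<union> U)" using genideal_self by blast
  then have "S \<union> U \<subseteq> Idl (Idl S \<union> U)" using genideal_self[of S] assms by blast
  then show "Idl (S \<union> U) \<subseteq> Idl (Idl S \<union> U)"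
    using genideal_minimal[OF genideal_ideal[OF c]] by blast
qed

lemma Idl_of_ideal: "ideal I R \<Longrightarrow> Idl I = I"
  using genideal_minimal[of I I] genideal_self[of I] ideal.Icarr[of I R] by blast

lemma Idl_mono: "S \<subseteq> U \<Longrightarrow> U \<subseteq> carrier R \<Longrightarrow> Idl S \<subseteq> Idl U"
  using genideal_minimal[OF genideal_ideal] genideal_self by blast

lemma Idl_empty: "Idl {} = {\<zero>}"
proof -
  have "Idl {} \<subseteq> {\<zero>}" using genideal_minimal[OF zeroideal] by simp
  moreover have "\<zero> \<in> Idl {}" using genideal_ideal[of "{}"] additive_subgroup.zero_closed ideal.axioms(1) by blast
  ultimately show ?thesis by blast
qed

lemma Idl_insert_Idl:
  "S \<subseteq> carrier R \<Longrightarrow> x \<in> carrier R \<Longrightarrow> Idl (insert x (Idl S)) = Idl (insert x S)"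
  using Idl_Idl_Un[of S "{x}"] by simp

lemma idealI_cring:
  assumes "I \<subseteq> carrier R" "\<zero> \<in> I" and add: "\<And>x y. x \<in> I \<Longrightarrow> y \<in> I \<Longrightarrow> x \<oplus> y \<in> I"
    and smult: "\<And>x r. x \<in> I \<Longrightarrow> r \<in> carrier R \<Longrightarrow> r \<otimes> x \<in> I"
  shows "ideal I R"
proof (rule idealI[OF ring_axioms])
  show "subgroup I (add_monoid R)"
  proof
    show "inv\<^bsub>add_monoid R\<^esub> x \<in> I" if x: "x \<in> I" for x
    proof -
      have "x \<in> carrier R" using x assms(1) by blast
      then have "\<ominus> x = (\<ominus> \<one>) \<otimes> x" by (simp add: l_minus)
      then have "\<ominus> x \<in> I" using smult[OF x, of "\<ominus> \<one>"] by simp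
      then show ?thesis by (simp add: a_inv_def)
    qed
  qed (use assms in auto)
  show "r \<otimes> x \<in> I" if "x \<in> I" "r \<in> carrier R" for x r by (rule smult[OF that])
  show "x \<otimes> r \<in> I" if x: "x \<in> I" and r: "r \<in> carrier R" for x r
    using smult[OF x r] m_comm[OF _ r, of x] x assms(1) by auto
qed

lemma mem_Idl_insert:
  assumes I: "ideal I R" and x: "x \<in> carrier R"
  shows "y \<in> Idl (insert x I) \<longleftrightarrow> (\<exists>i\<in>I. \<exists>r\<in>carrier R. y = i \<oplus> r \<otimes> x)"
proof -
  interpret I: ideal I R by fact
  have c: "insert x I \<subseteq> carrier R" using x I.Icarr by blast
  have "Idl (insert x I) = I <+> PIdl x"
  proof -
    have "Idl (I \<union> Idl {x}) = I <+> Idl {x}"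
      by (rule union_genideal[OF I genideal_ideal]) (simp add: x)
    moreover have "Idl (I \<union> Idl {x}) = Idl (insert x I)"
      using Idl_Idl_Un[of "{x}" I] x I.Icarr by (simp add: Un_commute subsetI)
    ultimately show ?thesis using cgenideal_eq_genideal[OF x] by simp
  qed
  then show ?thesis unfolding set_add_def' cgenideal_def by auto
qed

lemma Idl_insert_ideal: "ideal I R \<Longrightarrow> x \<in> carrier R \<Longrightarrow> ideal (Idl (insert x I)) R"
  using ideal.Icarr[of I R] genideal_ideal[of "insert x I"] by blast

lemma Idl_insert_supset: "ideal I R \<Longrightarrow> x \<in> carrier R \<Longrightarrow> I \<subseteq> Idl (insert x I)"
  using ideal.Icarr[of I R] genideal_self[of "insert x I"] by blast

lemma Idl_insert_self: "ideal I R \<Longrightarrow> x \<in> carrier R \<Longrightarrow> x \<in> Idl (insert x I)"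
  using ideal.Icarr[of I R] genideal_self[of "insert x I"] by blast

lemma Idl_insert_commute:
  assumes "ideal I R" "x \<in> carrier R" "y \<in> carrier R"
  shows "Idl (insert x (Idl (insert y I))) = Idl (insert y (Idl (insert x I)))"
proof -
  have I: "I \<subseteq> carrier R" using ideal_sub[OF assms(1)] .
  have "Idl (insert x (Idl (insert y I))) = Idl (insert y I \<union> {x})"
    using Idl_Idl_Un[of "insert y I" "{x}"] assms I by simp
  also have "\<dots> = Idl (insert x I \<union> {y})" by (simp add: insert_commute)
  also have "\<dots> = Idl (insert y (Idl (insert x I)))"
    using Idl_Idl_Un[of "insert x I" "{y}"] assms I by simp
  finally show ?thesis .
qed

lemma ideal_add_left_cancel:
  assumes "ideal I R" "i \<in> I" "y \<in> carrier R"
  shows "i \<oplus> y \<in> I \<longleftrightarrow> y \<in> I"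
proof
  interpret I: ideal I R by fact
  assume h: "i \<oplus> y \<in> I"
  have "y = (i \<oplus> y) \<ominus> i" using assms I.Icarr by algebra
  moreover have "(i \<oplus> y) \<ominus> i \<in> I"
    unfolding a_minus_def by (rule I.a_closed[OF h I.a_inv_closed[OF assms(2)]])
  ultimately show "y \<in> I" by simp
next
  interpret I: ideal I R by fact
  show "y \<in> I \<Longrightarrow> i \<oplus> y \<in> I" using assms(2) I.a_closed by blast
qed

lemma nzd_modD: "nzd_mod R I x \<Longrightarrow> y \<in> carrier R \<Longrightarrow> x \<otimes> y \<in> I \<Longrightarrow> y \<in> I"
  unfolding nzd_mod_def by blast

text \<open>If \<open>a y = r z\<close> modulo \<open>I\<close>, then \<open>z r\<close> vanishes modulo \<open>a\<close>, so \<open>r = s a\<close> and \<open>a\<close> cancels: \<open>y = s z\<close>.\<close>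

lemma nzd_mod_swap:
  assumes I: "ideal I R" and a: "a \<in> carrier R" and z: "z \<in> carrier R"
    and na: "nzd_mod R I a" and nz: "nzd_mod R (Idl (insert a I)) z"
  shows "nzd_mod R (Idl (insert z I)) a"
  unfolding nzd_mod_def
proof (intro ballI impI)
  interpret I: ideal I R by fact
  fix y assume y: "y \<in> carrier R" and ay: "a \<otimes> y \<in> Idl (insert z I)"
  then obtain i r where i: "i \<in> I" and r: "r \<in> carrier R" and e: "a \<otimes> y = i \<oplus> r \<otimes> z"
    using mem_Idl_insert[OF I z] by blast
  have ic: "i \<in> carrier R" using i by (rule I.Icarr)
  have "z \<otimes> r = \<ominus> i \<oplus> (i \<oplus> r \<otimes> z)" using ic r z by algebra
  also have "\<dots> = \<ominus> i \<oplus> y \<otimes> a" using e a y m_comm by simp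
  finally have "z \<otimes> r \<in> Idl (insert a I)" using mem_Idl_insert[OF I a] i y I.a_inv_closed by blast
  then have "r \<in> Idl (insert a I)" using nzd_modD[OF nz r] by blast
  then obtain j s where j: "j \<in> I" and s: "s \<in> carrier R" and rj: "r = j \<oplus> s \<otimes> a"
    using mem_Idl_insert[OF I a] by blast
  have jc: "j \<in> carrier R" using j by (rule I.Icarr)
  have "a \<otimes> (y \<ominus> s \<otimes> z) = a \<otimes> y \<ominus> a \<otimes> (s \<otimes> z)" using a y s z by algebra
  also have "\<dots> = i \<oplus> z \<otimes> j" unfolding e rj using a s z ic jc by algebra
  finally have "a \<otimes> (y \<ominus> s \<otimes> z) \<in> I" using i j z I.a_closed I.I_l_closed by simp
  then have "y \<ominus> s \<otimes> z \<in> I" using nzd_modD[OF na] y s z by simp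
  moreover have "y = (y \<ominus> s \<otimes> z) \<oplus> s \<otimes> z" using y s z by algebra
  ultimately show "y \<in> Idl (insert z I)" using mem_Idl_insert[OF I z] s by blast
qed

text \<open>An element \<open>y\<close> of \<open>R / (I + b)\<close> killed by \<open>J\<close> satisfies \<open>a y = r b\<close>; then \<open>r\<close> is killed by \<open>J\<close> modulo \<open>a\<close>,
  hence divisible by \<open>a\<close> because \<open>w\<close> is a nonzerodivisor there, and cancelling \<open>a\<close> shows \<open>y = 0\<close>.\<close>

lemma faithful_mod_exchange:
  assumes I: "ideal I R" and J: "J \<subseteq> carrier R" and a: "a \<in> J" and b: "b \<in> J" and w: "w \<in> J"
    and na: "nzd_mod R I a" and nb: "nzd_mod R I b" and nw: "nzd_mod R (Idl (insert a I)) w"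
  shows "faithful_mod R J (Idl (insert b I))"
  unfolding faithful_mod_def
proof (intro ballI impI)
  interpret I: ideal I R by fact
  fix y assume y: "y \<in> carrier R" and Jy: "\<forall>x\<in>J. x \<otimes> y \<in> Idl (insert b I)"
  have ac: "a \<in> carrier R" and bc: "b \<in> carrier R" and wc: "w \<in> carrier R" using a b w J by auto
  obtain i r where i: "i \<in> I" and r: "r \<in> carrier R" and e: "a \<otimes> y = i \<oplus> r \<otimes> b"
    using Jy a mem_Idl_insert[OF I bc] by blast
  obtain j t where j: "j \<in> I" and t: "t \<in> carrier R" and e2: "w \<otimes> y = j \<oplus> t \<otimes> b"
    using Jy w mem_Idl_insert[OF I bc] by blast
  note c = I.Icarr[OF i] I.Icarr[OF j] r t y ac bc wc
  have "b \<otimes> (w \<otimes> r \<ominus> a \<otimes> t) = w \<otimes> (i \<oplus> r \<otimes> b) \<ominus> a \<otimes> (j \<oplus> t \<otimes> b) \<oplus> (a \<otimes> j \<ominus> w \<otimes> i)"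
    using c by algebra
  also have "\<dots> = a \<otimes> j \<ominus> w \<otimes> i"
    unfolding e[symmetric] e2[symmetric] using c by algebra
  also have "\<dots> \<in> I" using i j c I.I_l_closed I.a_closed I.a_inv_closed by (simp add: a_minus_def)
  finally have "b \<otimes> (w \<otimes> r \<ominus> a \<otimes> t) \<in> I" .
  moreover have "w \<otimes> r \<ominus> a \<otimes> t \<in> carrier R" using wc r ac t by simp
  ultimately have "w \<otimes> r \<ominus> a \<otimes> t \<in> I" using nzd_modD[OF nb] by blast
  moreover have "w \<otimes> r = (w \<otimes> r \<ominus> a \<otimes> t) \<oplus> t \<otimes> a" using c by algebra
  ultimately have "w \<otimes> r \<in> Idl (insert a I)" using mem_Idl_insert[OF I ac] t by blast
  then have "r \<in> Idl (insert a I)" using nzd_modD[OF nw r] by blast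
  then obtain k u where k: "k \<in> I" and u: "u \<in> carrier R" and rk: "r = k \<oplus> u \<otimes> a"
    using mem_Idl_insert[OF I ac] by blast
  note c = c I.Icarr[OF k] u
  have "a \<otimes> (y \<ominus> u \<otimes> b) = a \<otimes> y \<ominus> a \<otimes> (u \<otimes> b)" using c by algebra
  also have "\<dots> = i \<oplus> b \<otimes> k" unfolding e unfolding rk using c(1,5-) by algebra
  also have "\<dots> \<in> I" using I.a_closed[OF i I.I_l_closed[OF k bc]] .
  finally have "a \<otimes> (y \<ominus> u \<otimes> b) \<in> I" .
  then have "y \<ominus> u \<otimes> b \<in> I"
    by (rule nzd_modD[OF na minus_closed[OF y m_closed[OF u bc]]])
  moreover have "y = (y \<ominus> u \<otimes> b) \<oplus> u \<otimes> b" using c(5,7,10) by algebra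
  ultimately show "y \<in> Idl (insert b I)" using mem_Idl_insert[OF I bc] u by blast
qed

lemma nzd_mod_imp_faithful_mod: "x \<in> J \<Longrightarrow> nzd_mod R I x \<Longrightarrow> faithful_mod R J I"
  unfolding nzd_mod_def faithful_mod_def by blast

end

lemma ring_hom_Idl:
  assumes R: "cring R" and S: "cring S" and h: "h \<in> ring_hom R S" and Y: "Y \<subseteq> carrier R"
  shows "h ` (Idl\<^bsub>R\<^esub> Y) \<subseteq> Idl\<^bsub>S\<^esub> (h ` Y)"
proof -
  interpret R: cring R by fact
  interpret S: cring S by fact
  have hY: "h ` Y \<subseteq> carrier S" using ring_hom_closed[OF h] Y by blast
  have "ideal {x \<in> carrier R. h x \<in> Idl\<^bsub>S\<^esub> (h ` Y)} R"
    by (rule ring_hom_ring.ideal_vimage[OF ring_hom_ringI2[OF R.ring_axioms S.ring_axioms h]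
          S.genideal_ideal[OF hY]])
  then have "Idl\<^bsub>R\<^esub> Y \<subseteq> {x \<in> carrier R. h x \<in> Idl\<^bsub>S\<^esub> (h ` Y)}"
    by (rule R.genideal_minimal) (use Y S.genideal_self[OF hY] in blast)
  then show ?thesis by blast
qed

text \<open>The passage to localizations, to polynomial rings and back to fewer variables has this shape: it suffices
  to transfer nonzerodivisors modulo ideals generated inside \<open>D\<close>.\<close>

lemma wreg_map:
  assumes R: "cring R" and S: "cring S" and D: "D \<subseteq> carrier R" "h ` D \<subseteq> carrier S"
    and nzd: "\<And>Y x. \<lbrakk>Y \<subseteq> D; x \<in> D; nzd_mod R (Idl\<^bsub>R\<^esub> Y) x\<rbrakk> \<Longrightarrow> nzd_mod S (Idl\<^bsub>S\<^esub> (h ` Y)) (h x)"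
    and xs: "set xs \<subseteq> D" "wreg R {\<zero>\<^bsub>R\<^esub>} xs"
  shows "wreg S {\<zero>\<^bsub>S\<^esub>} (map h xs)"
proof -
  interpret R: cring R by fact
  interpret S: cring S by fact
  have "wreg S (Idl\<^bsub>S\<^esub> (h ` Y)) (map h xs)"
    if "Y \<subseteq> D" "set xs \<subseteq> D" "wreg R (Idl\<^bsub>R\<^esub> Y) xs" for Y xs
    using that
  proof (induction xs arbitrary: Y)
    case (Cons x xs)
    have x: "x \<in> D" "insert x Y \<subseteq> D" using Cons.prems by auto
    have "Idl\<^bsub>R\<^esub> (insert x (Idl\<^bsub>R\<^esub> Y)) = Idl\<^bsub>R\<^esub> (insert x Y)"
      by (rule R.Idl_insert_Idl) (use x D in auto)
    then have "wreg S (Idl\<^bsub>S\<^esub> (h ` insert x Y)) (map h xs)"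
      using Cons.IH[OF x(2)] Cons.prems by simp
    moreover have "Idl\<^bsub>S\<^esub> (insert (h x) (Idl\<^bsub>S\<^esub> (h ` Y))) = Idl\<^bsub>S\<^esub> (h ` insert x Y)"
      using S.Idl_insert_Idl[of "h ` Y" "h x"] x D(2) by auto
    ultimately show ?case using nzd[OF Cons.prems(1) x(1)] Cons.prems(3) by simp
  qed simp
  from this[of "{}" xs] show ?thesis using xs by (simp add: R.Idl_empty S.Idl_empty)
qed

text \<open>The ideals \<open>I\<close> with \<open>adm I\<close> are those over which common nonzerodivisors can be found: all ideals in the
  Noetherian case, the finitely generated ones in the polynomial case.\<close>

locale grade_exchange = cring +
  fixes J :: "'a set" and adm :: "'a set \<Rightarrow> bool"
  assumes J: "J \<subseteq> carrier R"
    and adm_ideal: "adm I \<Longrightarrow> ideal I R"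
    and adm_insert: "adm I \<Longrightarrow> x \<in> J \<Longrightarrow> adm (Idl (insert x I))"
    and common_nzd: "\<lbrakk>adm I1; adm I2; adm I3; faithful_mod R J I1; faithful_mod R J I2; faithful_mod R J I3\<rbrakk>
      \<Longrightarrow> \<exists>z\<in>J. nzd_mod R I1 z \<and> nzd_mod R I2 z \<and> nzd_mod R I3 z"
begin

text \<open>Northcott's argument by induction on the length. A common nonzerodivisor \<open>z\<close> on \<open>R / I\<close>, \<open>R / (I + a)\<close> and
  \<open>R / (I + b)\<close> is inserted: over \<open>I + a\<close> the second element of the given sequence may be replaced by \<open>z\<close>, then
  \<open>a\<close> by \<open>b\<close> over \<open>I + z\<close>, and \<open>z\<close> moves back behind \<open>b\<close>.\<close>

lemma grade_ge_exchange:
  assumes "adm I" "a \<in> J" "b \<in> J" "nzd_mod R I a" "nzd_mod R I b" "grade_ge R J (Idl (insert a I)) n"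
  shows "grade_ge R J (Idl (insert b I)) n"
  using assms
proof (induction n arbitrary: I a b)
  case (Suc n)
  note I = adm_ideal[OF Suc.prems(1)]
  have a: "a \<in> carrier R" and b: "b \<in> carrier R" using Suc.prems J by auto
  obtain w where w: "w \<in> J" "nzd_mod R (Idl (insert a I)) w"
    "grade_ge R J (Idl (insert w (Idl (insert a I)))) n"
    using Suc.prems(6) by auto
  have f: "faithful_mod R J I" "faithful_mod R J (Idl (insert a I))" "faithful_mod R J (Idl (insert b I))"
    using Suc.prems w faithful_mod_exchange[OF I J] nzd_mod_imp_faithful_mod by blast+
  have adm: "adm (Idl (insert x I))" if "x \<in> J" for x
    using Suc.prems(1) adm_insert that by blast
  obtain z where z: "z \<in> J" "nzd_mod R I z" "nzd_mod R (Idl (insert a I)) z" "nzd_mod R (Idl (insert b I)) z"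
    using common_nzd[OF Suc.prems(1) adm adm f] Suc.prems by blast
  have zc: "z \<in> carrier R" using z J by blast
  have "grade_ge R J (Idl (insert z (Idl (insert a I)))) n"
    using Suc.IH[OF adm[OF Suc.prems(2)] w(1) z(1) w(2) z(3) w(3)] .
  then have "grade_ge R J (Idl (insert a (Idl (insert z I)))) n"
    using Idl_insert_commute[OF I a zc] by simp
  then have "grade_ge R J (Idl (insert b (Idl (insert z I)))) n"
    using Suc.IH[OF adm[OF z(1)] Suc.prems(2,3)] nzd_mod_swap[OF I _ zc] a b z Suc.prems by blast
  then have "grade_ge R J (Idl (insert z (Idl (insert b I)))) n"
    using Idl_insert_commute[OF I b zc] by simp
  then show ?case using z by auto
qed simp

lemma grade_ge_step:
  assumes "adm I" "b \<in> J" "nzd_mod R I b" "grade_ge R J I (Suc n)"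
  shows "grade_ge R J (Idl (insert b I)) n"
  using assms grade_ge_exchange by auto

lemma grade_ge_wreg_append:
  assumes "adm I" "set xs \<subseteq> J" "wreg R I xs" "grade_ge R J I (length xs + n)"
  shows "grade_ge R J (Idl (I \<union> set xs)) n"
  using assms
proof (induction xs arbitrary: I)
  case Nil
  then show ?case using Idl_of_ideal[OF adm_ideal] by simp
next
  case (Cons x xs)
  have I: "I \<subseteq> carrier R" using ideal_sub[OF adm_ideal[OF Cons.prems(1)]] .
  have "grade_ge R J (Idl (insert x I)) (length xs + n)"
    using grade_ge_step[OF Cons.prems(1)] Cons.prems by auto
  then have "grade_ge R J (Idl (Idl (insert x I) \<union> set xs)) n"
    using Cons.IH[OF adm_insert[OF Cons.prems(1)]] Cons.prems by auto
  moreover have "Idl (Idl (insert x I) \<union> set xs) = Idl (I \<union> set (x # xs))"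
    using Idl_Idl_Un[of "insert x I" "set xs"] I J Cons.prems(2) by (simp add: subset_trans) auto
  ultimately show ?case by simp
qed

end

section \<open>Classical grade and base change in terms of ideals\<close>

lemma (in abelian_group) a_rcos_self:
  "x \<in> carrier G \<Longrightarrow> subgroup H (add_monoid G) \<Longrightarrow> x \<in> H +> x"
  using group.rcos_self[OF a_group] by (simp add: a_r_coset_def)

context cring
begin

lemma wreg_iff_nth:
  assumes "ideal I R" "set xs \<subseteq> carrier R"
  shows "wreg R I xs \<longleftrightarrow> (\<forall>i < length xs. nzd_mod R (Idl (I \<union> set (take i xs))) (xs ! i))"
  using assms
proof (induction xs arbitrary: I)
  case (Cons x xs)
  have x: "x \<in> carrier R" and xs: "set xs \<subseteq> carrier R" using Cons.prems by auto
  have "Idl (Idl (insert x I) \<union> set (take i xs)) = Idl (I \<union> set (take (Suc i) (x # xs)))" for i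
  proof -
    have "set (take i xs) \<subseteq> carrier R" using xs set_take_subset[of i xs] by (rule subset_trans[rotated])
    then show ?thesis
      using Idl_Idl_Un[of "insert x I" "set (take i xs)"] x ideal_sub[OF Cons.prems(1)] by simp
  qed
  then have "wreg R (Idl (insert x I)) xs \<longleftrightarrow>
      (\<forall>i < length xs. nzd_mod R (Idl (I \<union> set (take (Suc i) (x # xs)))) ((x # xs) ! Suc i))"
    using Cons.IH[OF Idl_insert_ideal[OF Cons.prems(1) x] xs] by simp
  then show ?case
    using Idl_of_ideal[OF Cons.prems(1)] by (simp add: All_less_Suc2)
qed simp

text \<open>Regularity transported along an isomorphism \<open>\<theta>\<close> from \<open>R\<close> to \<open>M\<close>. It serves both for the ring as a module over itself
  and for a base change of another ring to \<open>R\<close>.\<close>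

lemma weak_regular_sequence_iff_wreg:
  fixes M :: "('a, 'c, 'n) module_scheme"
  assumes M: "abelian_group M" and bij: "bij_betw \<theta> (carrier R) (carrier M)"
    and add: "\<And>a b. a \<in> carrier R \<Longrightarrow> b \<in> carrier R \<Longrightarrow> \<theta> (a \<oplus> b) = \<theta> a \<oplus>\<^bsub>M\<^esub> \<theta> b"
    and lin: "\<And>a b. a \<in> carrier R \<Longrightarrow> b \<in> carrier R \<Longrightarrow> \<theta> (a \<otimes> b) = a \<odot>\<^bsub>M\<^esub> \<theta> b"
  shows "weak_regular_sequence R M xs \<longleftrightarrow> set xs \<subseteq> carrier R \<and> wreg R {\<zero>} xs"
proof -
  interpret M: abelian_group M by fact
  have im: "\<theta> ` carrier R = carrier M" and inj: "inj_on \<theta> (carrier R)"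
    using bij by (auto simp: bij_betw_def)
  have cl: "\<theta> a \<in> carrier M" if "a \<in> carrier R" for a using im that by blast
  interpret h: group_hom "add_monoid R" "add_monoid M" \<theta>
    by (unfold_locales) (auto simp: hom_def cl add)
  have sub: "subgroup (\<theta> ` I) (add_monoid M)" if "ideal I R" for I
    using h.subgroup_img_is_subgroup[OF additive_subgroup.a_subgroup[OF ideal.axioms(1)[OF that]]] .
  have sm: "ideal_smult I M = \<theta> ` I" if I: "ideal I R" for I
  proof
    interpret I: ideal I R by fact
    have "a \<odot>\<^bsub>M\<^esub> x \<in> \<theta> ` I" if a: "a \<in> I" and x: "x \<in> carrier M" for a x
    proof -
      obtain b where "b \<in> carrier R" "x = \<theta> b" using x im by blast
      then have "a \<odot>\<^bsub>M\<^esub> x = \<theta> (a \<otimes> b)" "a \<otimes> b \<in> I"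
        using lin I.Icarr a I.I_r_closed by auto
      then show ?thesis by blast
    qed
    then show "ideal_smult I M \<subseteq> \<theta> ` I"
      unfolding ideal_smult_def by (intro group.generate_subgroup_incl[OF M.a_group _ sub[OF I]]) blast
    show "\<theta> ` I \<subseteq> ideal_smult I M"
    proof (rule image_subsetI)
      fix a assume a: "a \<in> I"
      then have "\<theta> a = a \<odot>\<^bsub>M\<^esub> \<theta> \<one>" using lin[of a \<one>] I.Icarr by simp
      then show "\<theta> a \<in> ideal_smult I M"
        unfolding ideal_smult_def using a cl[of \<one>] by (intro generate.incl) auto
    qed
  qed
  have mem: "\<theta> a \<in> \<theta> ` I \<longleftrightarrow> a \<in> I" if "ideal I R" "a \<in> carrier R" for a I
    using inj_on_image_mem_iff[OF inj] that ideal_sub by blast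
  have coset: "\<theta> ` I +>\<^bsub>M\<^esub> \<theta> a = \<theta> ` I \<longleftrightarrow> a \<in> I" if I: "ideal I R" and a: "a \<in> carrier R" for a I
    using M.a_coset_join1[OF _ cl[OF a] sub[OF I]] M.a_coset_join2[OF cl[OF a] sub[OF I]] mem[OF I a] by blast
  have "nonzero_divisor_on x (quotient_module M (ideal_smult I M)) \<longleftrightarrow> nzd_mod R I x"
    if I: "ideal I R" and x: "x \<in> carrier R" for x I
  proof -
    interpret I: ideal I R by fact
    have z: "(\<Union>u\<in>\<theta> ` I +>\<^bsub>M\<^esub> \<theta> b. \<theta> ` I +>\<^bsub>M\<^esub> (x \<odot>\<^bsub>M\<^esub> u)) = \<theta> ` I \<longleftrightarrow> x \<otimes> b \<in> I"
      (is "?U = _ \<longleftrightarrow> _") if b: "b \<in> carrier R" for b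
    proof -
      have U: "\<theta> ` I +>\<^bsub>M\<^esub> \<theta> b = (\<lambda>i. \<theta> (i \<oplus> b)) ` I"
        unfolding a_r_coset_def' using add I.Icarr b by auto
      have s: "?U = (\<Union>i\<in>I. \<theta> ` I +>\<^bsub>M\<^esub> \<theta> (x \<otimes> (i \<oplus> b)))"
        unfolding U using lin[OF x] I.Icarr b by simp
      have e: "x \<otimes> (i \<oplus> b) \<in> I \<longleftrightarrow> x \<otimes> b \<in> I" if "i \<in> I" for i
      proof -
        have "x \<otimes> (i \<oplus> b) = x \<otimes> i \<oplus> x \<otimes> b" by (rule r_distr[OF I.Icarr[OF that] b x])
        then show ?thesis using ideal_add_left_cancel[OF I I.I_l_closed[OF that x]] x b by simp
      qed
      have ne: "\<zero> \<in> I" by (rule I.zero_closed)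
      show ?thesis
      proof
        assume "x \<otimes> b \<in> I"
        then have "\<theta> ` I +>\<^bsub>M\<^esub> \<theta> (x \<otimes> (i \<oplus> b)) = \<theta> ` I" if "i \<in> I" for i
          using coset[OF I, of "x \<otimes> (i \<oplus> b)"] e[OF that] x b I.Icarr[OF that] by simp
        then show "?U = \<theta> ` I" unfolding s using ne by auto
      next
        assume "?U = \<theta> ` I"
        then have "\<theta> ` I +>\<^bsub>M\<^esub> \<theta> (x \<otimes> (\<zero> \<oplus> b)) \<subseteq> \<theta> ` I" unfolding s using ne by blast
        moreover have "\<theta> (x \<otimes> b) \<in> \<theta> ` I +>\<^bsub>M\<^esub> \<theta> (x \<otimes> b)"
          by (rule M.a_rcos_self[OF cl sub[OF I]]) (use x b in simp)
        ultimately have "\<theta> (x \<otimes> b) \<in> \<theta> ` I" using b by auto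
        then show "x \<otimes> b \<in> I" using mem[OF I] x b by simp
      qed
    qed
    have c: "a_rcosets\<^bsub>M\<^esub> (\<theta> ` I) = (\<lambda>b. \<theta> ` I +>\<^bsub>M\<^esub> \<theta> b) ` carrier R"
      unfolding A_RCOSETS_def' im[symmetric] by auto
    show ?thesis
      unfolding nonzero_divisor_on_def quotient_module_def sm[OF I] nzd_mod_def
      by (simp add: c z coset[OF I])
  qed
  note nz = this
  have id: "ideal (Idl (set (take i xs))) R" if "set xs \<subseteq> carrier R" for i
    using that set_take_subset[of i xs] by (intro genideal_ideal) blast
  have "Idl ({\<zero>} \<union> set (take i xs)) = Idl (set (take i xs))" if "set xs \<subseteq> carrier R" for i
    using Idl_Idl_Un[of "{}" "set (take i xs)"] that set_take_subset[of i xs] unfolding Idl_empty by auto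
  then show ?thesis
    unfolding weak_regular_sequence_def
    using wreg_iff_nth[OF zeroideal, of xs] nz[OF id] by (auto simp: subset_iff)
qed

lemma weak_regular_sequence_self_module:
  "weak_regular_sequence R (self_module R) xs \<longleftrightarrow> set xs \<subseteq> carrier R \<and> wreg R {\<zero>} xs"
proof (rule weak_regular_sequence_iff_wreg[where \<theta> = "\<lambda>x. x"])
  show "abelian_group (self_module R)"
    by (rule abelian_groupI) (auto simp: self_module_def a_ac intro: l_neg)
qed (auto simp: self_module_def bij_betw_def)

end

lemma c_grade_ge_iff:
  assumes "\<And>xs. weak_regular_sequence R M xs \<longleftrightarrow> set xs \<subseteq> carrier R \<and> wreg R I0 xs" and "I \<subseteq> carrier R"
  shows "enat n \<le> c_grade R I M \<longleftrightarrow> grade_ge R I I0 n"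
proof -
  let ?Q = "{xs. set xs \<subseteq> I \<and> weak_regular_sequence R M xs}"
  have Q: "?Q = {xs. set xs \<subseteq> I \<and> wreg R I0 xs}" using assms by auto
  have "enat n \<le> c_grade R I M \<longleftrightarrow> (\<exists>xs\<in>?Q. n \<le> length xs)"
  proof
    assume h: "enat n \<le> c_grade R I M"
    show "\<exists>xs\<in>?Q. n \<le> length xs"
    proof (rule ccontr)
      assume no: "\<not> (\<exists>xs\<in>?Q. n \<le> length xs)"
      have "[] \<in> ?Q" unfolding Q by simp
      then have n: "n > 0" using no by force
      have "c_grade R I M \<le> enat (n - 1)"
        unfolding c_grade_def
      proof (rule SUP_least)
        fix xs assume "xs \<in> ?Q"
        then have "length xs < n" using no by (meson not_less)
        then show "enat (length xs) \<le> enat (n - 1)" by simp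
      qed
      then have "enat n \<le> enat (n - 1)" using h by (rule order_trans[rotated])
      then show False using n by simp
    qed
  next
    assume "\<exists>xs\<in>?Q. n \<le> length xs"
    then obtain xs where xs: "xs \<in> ?Q" "n \<le> length xs" by blast
    have "enat n \<le> enat (length xs)" using xs by simp
    also have "\<dots> \<le> c_grade R I M" unfolding c_grade_def by (rule SUP_upper[OF xs(1)])
    finally show "enat n \<le> c_grade R I M" .
  qed
  also have "\<dots> \<longleftrightarrow> grade_ge R I I0 n"
  proof
    assume "\<exists>xs\<in>?Q. n \<le> length xs"
    then obtain xs where "set xs \<subseteq> I" "wreg R I0 xs" "n \<le> length xs" unfolding Q by blast
    then show "grade_ge R I I0 n"
      using grade_ge_mono[of R I I0 "length xs" n] by (auto simp: grade_ge_iff_wreg[of _ _ _ "length xs"])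
  next
    assume "grade_ge R I I0 n"
    then show "\<exists>xs\<in>?Q. n \<le> length xs" unfolding Q grade_ge_iff_wreg by blast
  qed
  finally show ?thesis .
qed

lemma (in cring) c_grade_self_module_ge_iff:
  "I \<subseteq> carrier R \<Longrightarrow> enat n \<le> c_grade R I (self_module R) \<longleftrightarrow> grade_ge R I {\<zero>} n"
  by (rule c_grade_ge_iff[OF weak_regular_sequence_self_module])


lemma tensor_free_simps:
  "carrier (tensor_free S M) = {c. Poly_Mapping.keys c \<subseteq> carrier S \<times> carrier M}"
  "\<zero>\<^bsub>tensor_free S M\<^esub> = 0" "x \<oplus>\<^bsub>tensor_free S M\<^esub> y = x + y"
  "s \<odot>\<^bsub>tensor_free S M\<^esub> x = frag_extend (\<lambda>(p, x). frag_of (s \<otimes>\<^bsub>S\<^esub> p, x)) x"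
  by (auto simp: tensor_free_def free_Abelian_group_def)

lemma abelian_group_tensor_free: "abelian_group (tensor_free S M)"
proof (rule abelian_groupI)
  fix x assume x: "x \<in> carrier (tensor_free S M)"
  have "- x \<in> carrier (tensor_free S M)" using x by (simp add: tensor_free_simps)
  moreover have "- x \<oplus>\<^bsub>tensor_free S M\<^esub> x = \<zero>\<^bsub>tensor_free S M\<^esub>" by (simp add: tensor_free_simps)
  ultimately show "\<exists>y\<in>carrier (tensor_free S M). y \<oplus>\<^bsub>tensor_free S M\<^esub> x = \<zero>\<^bsub>tensor_free S M\<^esub>" by blast
next
  fix x y assume "x \<in> carrier (tensor_free S M)" "y \<in> carrier (tensor_free S M)"
  then show "x \<oplus>\<^bsub>tensor_free S M\<^esub> y \<in> carrier (tensor_free S M)"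
    using keys_add[of x y] by (auto simp: tensor_free_simps)
qed (auto simp: tensor_free_simps)

lemma tensor_relations_cases [consumes 1, case_names add_left add_right balance]:
  assumes "z \<in> tensor_relations R T h M"
  obtains p q x where "z = frag_of (p \<oplus>\<^bsub>T\<^esub> q, x) - frag_of (p, x) - frag_of (q, x)"
      "p \<in> carrier T" "q \<in> carrier T" "x \<in> carrier M"
  | p x y where "z = frag_of (p, x \<oplus>\<^bsub>M\<^esub> y) - frag_of (p, x) - frag_of (p, y)"
      "p \<in> carrier T" "x \<in> carrier M" "y \<in> carrier M"
  | p r x where "z = frag_of (p \<otimes>\<^bsub>T\<^esub> h r, x) - frag_of (p, r \<odot>\<^bsub>M\<^esub> x)"
      "p \<in> carrier T" "r \<in> carrier R" "x \<in> carrier M"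
  using assms unfolding tensor_relations_def by blast

text \<open>The map \<open>q \<mapsto> q \<otimes> 1\<close> identifies \<open>T\<close> with \<open>T \<otimes>\<^sub>R R\<close>. It is onto because \<open>p \<otimes> r\<close> equals \<open>p h(r) \<otimes> 1\<close>, and
  injective because the universal property of the free abelian group extends \<open>(p, r) \<mapsto> p h(r)\<close> to a
  homomorphism to \<open>T\<close> that vanishes on the relations.\<close>

lemma weak_regular_sequence_base_change:
  fixes R :: "('a, 'm) ring_scheme" and T :: "('b, 'k) ring_scheme"
  assumes R: "cring R" and T: "cring T" and h: "h \<in> ring_hom R T"
  shows "weak_regular_sequence T (base_change R T h (self_module R)) xs \<longleftrightarrow>
    set xs \<subseteq> carrier T \<and> wreg T {\<zero>\<^bsub>T\<^esub>} xs"
proof -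
  interpret R: cring R by fact
  interpret T: cring T by fact
  let ?M = "self_module R"
  let ?F = "tensor_free T ?M"
  let ?rel = "tensor_relations R T h ?M"
  define N where "N = generate (add_monoid ?F) ?rel"
  have M: "carrier ?M = carrier R" "\<And>r x. r \<odot>\<^bsub>?M\<^esub> x = r \<otimes>\<^bsub>R\<^esub> x" "\<And>x y. x \<oplus>\<^bsub>?M\<^esub> y = x \<oplus>\<^bsub>R\<^esub> y"
    by (simp_all add: self_module_def)
  have hc: "h r \<in> carrier T" if "r \<in> carrier R" for r using ring_hom_closed[OF h that] .
  interpret F: abelian_group ?F by (rule abelian_group_tensor_free)
  have Fc: "x \<in> carrier ?F \<longleftrightarrow> Poly_Mapping.keys x \<subseteq> carrier T \<times> carrier R" for x
    by (simp add: tensor_free_simps M)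
  have of_c: "frag_of (p, x) \<in> carrier ?F" if "p \<in> carrier T" "x \<in> carrier R" for p x
    using that by (simp add: Fc)
  have minus_c: "x - y \<in> carrier ?F" if "x \<in> carrier ?F" "y \<in> carrier ?F" for x y
    using that keys_diff[of x y] by (auto simp: Fc)
  have relc: "?rel \<subseteq> carrier ?F"
    unfolding tensor_relations_def M
    by (auto intro!: minus_c of_c hc)
  have Nsub: "subgroup N (add_monoid ?F)"
    unfolding N_def using group.generate_is_subgroup[OF F.a_group] relc by simp
  have neg: "\<ominus>\<^bsub>?F\<^esub> x = - x" if "x \<in> carrier ?F" for x
  proof -
    have "- x \<oplus>\<^bsub>?F\<^esub> x = \<zero>\<^bsub>?F\<^esub>" by (simp add: tensor_free_simps)
    moreover have "- x \<in> carrier ?F" using that by (simp add: Fc)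
    ultimately show ?thesis using F.minus_equality that by blast
  qed
  have Nc: "x \<in> carrier ?F" if "x \<in> N" for x using subgroup.subset[OF Nsub] that by auto
  have N0: "0 \<in> N" using subgroup.one_closed[OF Nsub] by (simp add: tensor_free_simps)
  have Nadd: "x + y \<in> N" if "x \<in> N" "y \<in> N" for x y
    using subgroup.m_closed[OF Nsub that] by (simp add: tensor_free_simps)
  have Nneg: "- x \<in> N" if "x \<in> N" for x
    using subgroup.m_inv_closed[OF Nsub that] neg[OF Nc[OF that]] by (simp add: a_inv_def)
  have Ndiff: "x - y \<in> N" if "x \<in> N" "y \<in> N" for x y using Nadd[OF that(1) Nneg[OF that(2)]] by simp
  have Nrel: "x \<in> N" if "x \<in> ?rel" for x unfolding N_def using that by (rule generate.incl)
  have coset_eq: "N +>\<^bsub>?F\<^esub> x = N +>\<^bsub>?F\<^esub> y \<longleftrightarrow> x - y \<in> N"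
    if x: "x \<in> carrier ?F" and y: "y \<in> carrier ?F" for x y
  proof
    assume "N +>\<^bsub>?F\<^esub> x = N +>\<^bsub>?F\<^esub> y"
    then have "x \<in> N +>\<^bsub>?F\<^esub> y" using F.a_rcos_self[OF x Nsub] by simp
    then obtain n where "n \<in> N" "x = n + y" unfolding a_r_coset_def' by (auto simp: tensor_free_simps)
    then show "x - y \<in> N" by simp
  next
    assume "x - y \<in> N"
    then have "x \<in> N +>\<^bsub>?F\<^esub> y" unfolding a_r_coset_def'
      by (auto simp: tensor_free_simps intro!: bexI[of _ "x - y"])
    then show "N +>\<^bsub>?F\<^esub> x = N +>\<^bsub>?F\<^esub> y" using F.a_repr_independence[OF _ y Nsub] by simp
  qed
  have rels: "frag_of (p \<oplus>\<^bsub>T\<^esub> q, x) - frag_of (p, x) - frag_of (q, x) \<in> N"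
    if "p \<in> carrier T" "q \<in> carrier T" "x \<in> carrier R" for p q x
    using that by (intro Nrel) (auto simp: tensor_relations_def M)
  have relr: "frag_of (p, x \<oplus>\<^bsub>R\<^esub> y) - frag_of (p, x) - frag_of (p, y) \<in> N"
    if "p \<in> carrier T" "x \<in> carrier R" "y \<in> carrier R" for p x y
    unfolding N_def using that by (intro generate.incl) (auto simp: tensor_relations_def M)
  have relm: "frag_of (p \<otimes>\<^bsub>T\<^esub> h r, x) - frag_of (p, r \<otimes>\<^bsub>R\<^esub> x) \<in> N"
    if "p \<in> carrier T" "r \<in> carrier R" "x \<in> carrier R" for p r x
    using that by (intro Nrel) (auto simp: tensor_relations_def M)
  let ?a = "\<lambda>s. frag_extend (\<lambda>(p, x). frag_of (s \<otimes>\<^bsub>T\<^esub> p, x))"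
  have ac: "?a s x \<in> carrier ?F" if s: "s \<in> carrier T" and x: "x \<in> carrier ?F" for s x
  proof -
    have "Poly_Mapping.keys (?a s x) \<subseteq> (\<Union>z\<in>Poly_Mapping.keys x. Poly_Mapping.keys (case z of (p, x) \<Rightarrow> frag_of (s \<otimes>\<^bsub>T\<^esub> p, x)))"
      by (rule keys_frag_extend)
    also have "\<dots> \<subseteq> carrier T \<times> carrier R" using x s unfolding Fc by auto
    finally show ?thesis unfolding Fc .
  qed
  have arel: "?a s x \<in> N" if s: "s \<in> carrier T" and x: "x \<in> ?rel" for s x
    using x
  proof (cases rule: tensor_relations_cases)
    case (add_left p q y)
    have "?a s x = frag_of (s \<otimes>\<^bsub>T\<^esub> p \<oplus>\<^bsub>T\<^esub> s \<otimes>\<^bsub>T\<^esub> q, y) - frag_of (s \<otimes>\<^bsub>T\<^esub> p, y) - frag_of (s \<otimes>\<^bsub>T\<^esub> q, y)"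
      unfolding add_left(1) using s add_left(2,3) by (simp add: frag_extend_diff T.r_distr)
    then show ?thesis using rels[of "s \<otimes>\<^bsub>T\<^esub> p" "s \<otimes>\<^bsub>T\<^esub> q" y] s add_left by (simp add: M)
  next
    case (add_right p y z)
    have "?a s x = frag_of (s \<otimes>\<^bsub>T\<^esub> p, y \<oplus>\<^bsub>R\<^esub> z) - frag_of (s \<otimes>\<^bsub>T\<^esub> p, y) - frag_of (s \<otimes>\<^bsub>T\<^esub> p, z)"
      unfolding add_right(1) by (simp add: frag_extend_diff M)
    then show ?thesis using relr[of "s \<otimes>\<^bsub>T\<^esub> p" y z] s add_right by (simp add: M)
  next
    case (balance p r y)
    have "?a s x = frag_of ((s \<otimes>\<^bsub>T\<^esub> p) \<otimes>\<^bsub>T\<^esub> h r, y) - frag_of (s \<otimes>\<^bsub>T\<^esub> p, r \<otimes>\<^bsub>R\<^esub> y)"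
      unfolding balance(1) using s balance(2,3) hc[OF balance(3)] by (simp add: frag_extend_diff T.m_assoc M)
    then show ?thesis using relm[of "s \<otimes>\<^bsub>T\<^esub> p" r y] s balance by (simp add: M)
  qed
  have aN: "?a s n \<in> N" if s: "s \<in> carrier T" and n: "n \<in> N" for s n
    using n[unfolded N_def]
  proof (induction rule: generate.induct)
    case one
    show ?case using N0 by (simp add: tensor_free_simps)
  next
    case (incl x)
    then show ?case by (rule arel[OF s])
  next
    case (inv x)
    have "x \<in> carrier ?F" using relc inv by blast
    then have "inv\<^bsub>add_monoid ?F\<^esub> x = - x" using neg by (simp add: a_inv_def)
    then show ?case using Nneg[OF arel[OF s inv]] by (simp add: frag_extend_minus)
  next
    case (eng x y)
    then show ?case using Nadd by (simp add: frag_extend_add tensor_free_simps)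
  qed
  define \<theta> where "\<theta> = (\<lambda>q. N +>\<^bsub>?F\<^esub> frag_of (q, \<one>\<^bsub>R\<^esub>))"
  let ?B = "base_change R T h ?M"
  have B: "carrier ?B = a_rcosets\<^bsub>?F\<^esub> N" "\<And>U V. U \<oplus>\<^bsub>?B\<^esub> V = U <+>\<^bsub>?F\<^esub> V" "\<zero>\<^bsub>?B\<^esub> = N"
    "\<And>s U. s \<odot>\<^bsub>?B\<^esub> U = (\<Union>x\<in>U. N +>\<^bsub>?F\<^esub> ?a s x)"
    by (simp_all add: base_change_def quotient_module_def N_def tensor_free_simps)
  interpret N: abelian_subgroup N ?F
    by (rule abelian_subgroupI3[OF _ abelian_group_tensor_free])
      (simp add: additive_subgroup_def Nsub)
  have abB: "abelian_group ?B"
  proof -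
    interpret Q: comm_group "?F A_Mod N" by (rule N.a_factorgroup_is_comm_group)
    have Q: "carrier (?F A_Mod N) = carrier ?B" "\<And>U V. U \<otimes>\<^bsub>?F A_Mod N\<^esub> V = U \<oplus>\<^bsub>?B\<^esub> V"
      "\<one>\<^bsub>?F A_Mod N\<^esub> = \<zero>\<^bsub>?B\<^esub>"
      by (simp_all add: A_FactGroup_def' B)
    show ?thesis
    proof (rule abelian_groupI)
      show "\<exists>y\<in>carrier ?B. y \<oplus>\<^bsub>?B\<^esub> x = \<zero>\<^bsub>?B\<^esub>" if "x \<in> carrier ?B" for x
        using Q.l_inv_ex[of x] that unfolding Q .
    qed (fact Q.m_closed[unfolded Q] Q.one_closed[unfolded Q] Q.m_assoc[unfolded Q]
        Q.m_comm[unfolded Q] Q.l_one[unfolded Q])+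
  qed
  have sumc: "(N +>\<^bsub>?F\<^esub> x) <+>\<^bsub>?F\<^esub> (N +>\<^bsub>?F\<^esub> y) = N +>\<^bsub>?F\<^esub> (x + y)"
    if "x \<in> carrier ?F" "y \<in> carrier ?F" for x y
    using N.a_rcos_sum[OF that] by (simp add: tensor_free_simps)
  have ex1: "\<exists>q\<in>carrier T. x - frag_of (q, \<one>\<^bsub>R\<^esub>) \<in> N" if "x \<in> carrier ?F" for x
  proof -
    have "Poly_Mapping.keys x \<subseteq> carrier T \<times> carrier R" using that by (simp add: Fc)
    then show ?thesis
    proof (induction rule: frag_induction)
      case zero
      have "frag_of (\<zero>\<^bsub>T\<^esub> \<oplus>\<^bsub>T\<^esub> \<zero>\<^bsub>T\<^esub>, \<one>\<^bsub>R\<^esub>) - frag_of (\<zero>\<^bsub>T\<^esub>, \<one>\<^bsub>R\<^esub>) - frag_of (\<zero>\<^bsub>T\<^esub>, \<one>\<^bsub>R\<^esub>) \<in> N"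
        by (rule rels) auto
      then show ?case by (intro bexI[of _ "\<zero>\<^bsub>T\<^esub>"]) auto
    next
      case (one x)
      obtain p r where x: "x = (p, r)" "p \<in> carrier T" "r \<in> carrier R" using one by auto
      have "- (frag_of (p \<otimes>\<^bsub>T\<^esub> h r, \<one>\<^bsub>R\<^esub>) - frag_of (p, r \<otimes>\<^bsub>R\<^esub> \<one>\<^bsub>R\<^esub>)) \<in> N"
        using x by (intro Nneg relm) auto
      then show ?case using x hc by (intro bexI[of _ "p \<otimes>\<^bsub>T\<^esub> h r"]) auto
    next
      case (diff a b)
      then obtain q q' where q: "q \<in> carrier T" "a - frag_of (q, \<one>\<^bsub>R\<^esub>) \<in> N"
        and q': "q' \<in> carrier T" "b - frag_of (q', \<one>\<^bsub>R\<^esub>) \<in> N" by blast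
      have e: "q = (q \<ominus>\<^bsub>T\<^esub> q') \<oplus>\<^bsub>T\<^esub> q'" using q q' by algebra
      have "frag_of ((q \<ominus>\<^bsub>T\<^esub> q') \<oplus>\<^bsub>T\<^esub> q', \<one>\<^bsub>R\<^esub>) - frag_of (q \<ominus>\<^bsub>T\<^esub> q', \<one>\<^bsub>R\<^esub>) - frag_of (q', \<one>\<^bsub>R\<^esub>) \<in> N"
        by (rule rels) (use q q' in auto)
      then have d: "frag_of (q, \<one>\<^bsub>R\<^esub>) - frag_of (q \<ominus>\<^bsub>T\<^esub> q', \<one>\<^bsub>R\<^esub>) - frag_of (q', \<one>\<^bsub>R\<^esub>) \<in> N"
        unfolding e[symmetric] .
      have "a - b - frag_of (q \<ominus>\<^bsub>T\<^esub> q', \<one>\<^bsub>R\<^esub>) =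
          ((a - frag_of (q, \<one>\<^bsub>R\<^esub>)) - (b - frag_of (q', \<one>\<^bsub>R\<^esub>)))
          + (frag_of (q, \<one>\<^bsub>R\<^esub>) - frag_of (q \<ominus>\<^bsub>T\<^esub> q', \<one>\<^bsub>R\<^esub>) - frag_of (q', \<one>\<^bsub>R\<^esub>))" by simp
      also have "\<dots> \<in> N" by (rule Nadd[OF Ndiff[OF q(2) q'(2)] d])
      finally show ?case using q q' by (intro bexI[of _ "q \<ominus>\<^bsub>T\<^esub> q'"]) auto
    qed
  qed
  have inj: "q = q'" if q: "q \<in> carrier T" and q': "q' \<in> carrier T"
    and d: "frag_of (q, \<one>\<^bsub>R\<^esub>) - frag_of (q', \<one>\<^bsub>R\<^esub>) \<in> N" for q q'
  proof -
    have "(\<lambda>(p, x). p \<otimes>\<^bsub>T\<^esub> h x) ` (carrier T \<times> carrier R) \<subseteq> carrier (add_monoid T)"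
      using hc by auto
    then obtain g where g: "g \<in> hom (free_Abelian_group (carrier T \<times> carrier R)) (add_monoid T)"
      and gof: "\<And>x. x \<in> carrier T \<times> carrier R \<Longrightarrow> g (frag_of x) = (\<lambda>(p, x). p \<otimes>\<^bsub>T\<^esub> h x) x"
      using comm_group.free_Abelian_group_universal[OF T.a_comm_group] by blast
    interpret g: group_hom "free_Abelian_group (carrier T \<times> carrier R)" "add_monoid T" g
      by (simp add: group_hom_def group_hom_axioms_def g T.a_group)
    have gadd: "g (x + y) = g x \<oplus>\<^bsub>T\<^esub> g y" if "x \<in> carrier ?F" "y \<in> carrier ?F" for x y
      using g.hom_mult[of x y] that by (simp add: Fc)
    have gc: "g x \<in> carrier T" if "x \<in> carrier ?F" for x
      using g.hom_closed[of x] that by (simp add: Fc)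
    have gdiff: "g (x - y) = g x \<ominus>\<^bsub>T\<^esub> g y" if x: "x \<in> carrier ?F" and y: "y \<in> carrier ?F" for x y
    proof -
      have "g x = g (x - y) \<oplus>\<^bsub>T\<^esub> g y" using gadd[OF minus_c[OF x y] y] by simp
      then show ?thesis using gc[OF x] gc[OF y] gc[OF minus_c[OF x y]] by algebra
    qed
    have g1: "g (frag_of (p, x)) = p \<otimes>\<^bsub>T\<^esub> h x" if "p \<in> carrier T" "x \<in> carrier R" for p x
      using gof[of "(p, x)"] that by simp
    have grel: "g x = \<zero>\<^bsub>T\<^esub>" if "x \<in> ?rel" for x
      using that
    proof (cases rule: tensor_relations_cases)
      case (add_left p q y)
      have y: "y \<in> carrier R" using add_left by (simp add: M)
      have "(p \<oplus>\<^bsub>T\<^esub> q) \<otimes>\<^bsub>T\<^esub> h y \<ominus>\<^bsub>T\<^esub> p \<otimes>\<^bsub>T\<^esub> h y \<ominus>\<^bsub>T\<^esub> q \<otimes>\<^bsub>T\<^esub> h y = \<zero>\<^bsub>T\<^esub>"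
        using add_left(2,3) hc[OF y] by algebra
      then show ?thesis unfolding add_left(1) using add_left(2,3) y by (simp add: gdiff g1 minus_c of_c)
    next
      case (add_right p y z)
      have yz: "y \<in> carrier R" "z \<in> carrier R" using add_right by (simp_all add: M)
      have "p \<otimes>\<^bsub>T\<^esub> (h y \<oplus>\<^bsub>T\<^esub> h z) \<ominus>\<^bsub>T\<^esub> p \<otimes>\<^bsub>T\<^esub> h y \<ominus>\<^bsub>T\<^esub> p \<otimes>\<^bsub>T\<^esub> h z = \<zero>\<^bsub>T\<^esub>"
        using add_right(2) hc[OF yz(1)] hc[OF yz(2)] by algebra
      then show ?thesis unfolding add_right(1) using add_right(2) yz
        by (simp add: gdiff g1 minus_c of_c M ring_hom_add[OF h])
    next
      case (balance p r y)
      have y: "y \<in> carrier R" using balance by (simp add: M)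
      have "(p \<otimes>\<^bsub>T\<^esub> h r) \<otimes>\<^bsub>T\<^esub> h y \<ominus>\<^bsub>T\<^esub> p \<otimes>\<^bsub>T\<^esub> (h r \<otimes>\<^bsub>T\<^esub> h y) = \<zero>\<^bsub>T\<^esub>"
        using balance(2) hc[OF balance(3)] hc[OF y] by algebra
      then show ?thesis unfolding balance(1) using balance(2,3) y hc
        by (simp add: gdiff g1 minus_c of_c M ring_hom_mult[OF h])
    qed
    have gN: "g n = \<zero>\<^bsub>T\<^esub>" if "n \<in> N" for n
    proof -
      have "N \<subseteq> {n \<in> carrier ?F. g n = \<zero>\<^bsub>T\<^esub>}"
        unfolding N_def
      proof (rule group.generate_subgroup_incl[OF F.a_group])
        show "?rel \<subseteq> {n \<in> carrier ?F. g n = \<zero>\<^bsub>T\<^esub>}" using relc grel by auto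
        show "subgroup {n \<in> carrier ?F. g n = \<zero>\<^bsub>T\<^esub>} (add_monoid ?F)"
        proof
          show "{n \<in> carrier ?F. g n = \<zero>\<^bsub>T\<^esub>} \<subseteq> carrier (add_monoid ?F)" by auto
          show "\<one>\<^bsub>add_monoid ?F\<^esub> \<in> {n \<in> carrier ?F. g n = \<zero>\<^bsub>T\<^esub>}"
            using g.hom_one F.zero_closed by (simp add: tensor_free_simps)
        next
          fix x y assume "x \<in> {n \<in> carrier ?F. g n = \<zero>\<^bsub>T\<^esub>}" "y \<in> {n \<in> carrier ?F. g n = \<zero>\<^bsub>T\<^esub>}"
          then show "x \<otimes>\<^bsub>add_monoid ?F\<^esub> y \<in> {n \<in> carrier ?F. g n = \<zero>\<^bsub>T\<^esub>}"
            using gadd[of x y] F.a_closed[of x y] by (simp add: tensor_free_simps)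
        next
          fix x assume x: "x \<in> {n \<in> carrier ?F. g n = \<zero>\<^bsub>T\<^esub>}"
          have "inv\<^bsub>add_monoid ?F\<^esub> x = 0 - x" using neg x by (simp add: a_inv_def)
          moreover have "g (0 - x) = \<zero>\<^bsub>T\<^esub>" "0 - x \<in> carrier ?F"
            using gdiff[of 0 x] minus_c[of 0 x] F.zero_closed x g.hom_one by (simp_all add: tensor_free_simps T.minus_eq)
          ultimately show "inv\<^bsub>add_monoid ?F\<^esub> x \<in> {n \<in> carrier ?F. g n = \<zero>\<^bsub>T\<^esub>}" by simp
        qed
      qed
      then show ?thesis using that by blast
    qed
    have "q \<ominus>\<^bsub>T\<^esub> q' = \<zero>\<^bsub>T\<^esub>"
      using gN[OF d] q q' by (simp add: gdiff of_c g1 ring_hom_one[OF h])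
    then show ?thesis using q q' by simp
  qed
  show ?thesis
  proof (rule T.weak_regular_sequence_iff_wreg[OF abB])
    have "\<theta> q \<in> carrier ?B" if "q \<in> carrier T" for q
      unfolding B \<theta>_def A_RCOSETS_def' using of_c[OF that R.one_closed] by blast
    moreover have "U \<in> \<theta> ` carrier T" if "U \<in> carrier ?B" for U
    proof -
      have "U \<in> (\<Union>x\<in>carrier ?F. {N +>\<^bsub>?F\<^esub> x})" using that by (simp only: B(1) A_RCOSETS_def')
      then obtain x where x: "x \<in> carrier ?F" "U = N +>\<^bsub>?F\<^esub> x" by (elim UN_E singletonE)
      obtain q where "q \<in> carrier T" "x - frag_of (q, \<one>\<^bsub>R\<^esub>) \<in> N" using ex1[OF x(1)] by blast
      then show ?thesis unfolding \<theta>_def using coset_eq[OF x(1) of_c[of q "\<one>\<^bsub>R\<^esub>"]] x by auto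
    qed
    ultimately have "\<theta> ` carrier T = carrier ?B" by blast
    moreover have "inj_on \<theta> (carrier T)"
      unfolding \<theta>_def by (rule inj_onI) (use inj coset_eq of_c in auto)
    ultimately show "bij_betw \<theta> (carrier T) (carrier ?B)" by (simp add: bij_betw_def)
  next
    fix a b assume ab: "a \<in> carrier T" "b \<in> carrier T"
    have "frag_of (a \<oplus>\<^bsub>T\<^esub> b, \<one>\<^bsub>R\<^esub>) - (frag_of (a, \<one>\<^bsub>R\<^esub>) + frag_of (b, \<one>\<^bsub>R\<^esub>)) \<in> N"
      using rels[OF ab, of "\<one>\<^bsub>R\<^esub>"] by (simp add: diff_diff_eq)
    moreover have "frag_of (a, \<one>\<^bsub>R\<^esub>) + frag_of (b, \<one>\<^bsub>R\<^esub>) \<in> carrier ?F"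
      using F.a_closed[OF of_c of_c, of a "\<one>\<^bsub>R\<^esub>" b "\<one>\<^bsub>R\<^esub>"] ab by (simp add: tensor_free_simps)
    ultimately have "\<theta> (a \<oplus>\<^bsub>T\<^esub> b) = N +>\<^bsub>?F\<^esub> (frag_of (a, \<one>\<^bsub>R\<^esub>) + frag_of (b, \<one>\<^bsub>R\<^esub>))"
      unfolding \<theta>_def using coset_eq of_c ab by simp
    then show "\<theta> (a \<oplus>\<^bsub>T\<^esub> b) = \<theta> a \<oplus>\<^bsub>?B\<^esub> \<theta> b"
      unfolding B \<theta>_def using sumc of_c ab by simp
  next
    fix a b assume ab: "a \<in> carrier T" "b \<in> carrier T"
    have fb: "frag_of (b, \<one>\<^bsub>R\<^esub>) \<in> carrier ?F" using ab by (simp add: of_c)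
    have e: "N +>\<^bsub>?F\<^esub> ?a a x = \<theta> (a \<otimes>\<^bsub>T\<^esub> b)" if x: "x \<in> \<theta> b" for x
    proof -
      obtain n where n: "n \<in> N" "x = n + frag_of (b, \<one>\<^bsub>R\<^esub>)"
        using x unfolding \<theta>_def a_r_coset_def' by (auto simp: tensor_free_simps)
      have xc: "x \<in> carrier ?F" using F.a_closed[OF Nc[OF n(1)] fb] n(2) by (simp add: tensor_free_simps)
      have "?a a x - frag_of (a \<otimes>\<^bsub>T\<^esub> b, \<one>\<^bsub>R\<^esub>) = ?a a n"
        using n by (simp add: frag_extend_add)
      then show ?thesis unfolding \<theta>_def
        using coset_eq[OF ac[OF ab(1) xc] of_c[of "a \<otimes>\<^bsub>T\<^esub> b" "\<one>\<^bsub>R\<^esub>"]] aN[OF ab(1) n(1)] ab by simp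
    qed
    moreover have "\<theta> b \<noteq> {}" unfolding \<theta>_def using F.a_rcos_self[OF fb Nsub] by blast
    ultimately show "\<theta> (a \<otimes>\<^bsub>T\<^esub> b) = a \<odot>\<^bsub>?B\<^esub> \<theta> b" unfolding B by auto
  qed
qed

section \<open>Grade in Noetherian rings\<close>

definition colon :: "('a, 'm) ring_scheme \<Rightarrow> 'a set \<Rightarrow> 'a \<Rightarrow> 'a set" where
  "colon R I a = {x \<in> carrier R. x \<otimes>\<^bsub>R\<^esub> a \<in> I}"

context cring
begin

lemma colon_ideal:
  assumes I: "ideal I R" and a: "a \<in> carrier R"
  shows "ideal (colon R I a) R"
proof (rule idealI_cring)
  interpret I: ideal I R by fact
  show "\<zero> \<in> colon R I a" using a by (simp add: colon_def)
  show "x \<oplus> y \<in> colon R I a" if "x \<in> colon R I a" "y \<in> colon R I a" for x y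
    using that a by (simp add: colon_def l_distr)
  show "r \<otimes> x \<in> colon R I a" if "x \<in> colon R I a" "r \<in> carrier R" for x r
    using that a by (simp add: colon_def m_assoc I.I_l_closed)
qed (auto simp: colon_def)

lemma prime_contains_Inter:
  assumes "finite F" "\<And>Q. Q \<in> F \<Longrightarrow> ideal Q R" "primeideal P R"
    "\<And>x. x \<in> carrier R \<Longrightarrow> (\<forall>Q\<in>F. x \<in> Q) \<Longrightarrow> x \<in> P"
  shows "\<exists>Q\<in>F. Q \<subseteq> P"
  using assms(1,2,4)
proof (induction F rule: finite_induct)
  case empty
  interpret P: primeideal P R by fact
  have "carrier R \<subseteq> P" using empty by auto
  then show ?case using P.I_notcarr P.a_subset by blast
next
  case (insert Q F)
  interpret P: primeideal P R by fact
  interpret Q: ideal Q R using insert by blast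
  show ?case
  proof (cases "Q \<subseteq> P")
    case False
    then obtain x where x: "x \<in> Q" "x \<notin> P" by blast
    have "y \<in> P" if y: "y \<in> carrier R" "\<forall>Q\<in>F. y \<in> Q" for y
    proof -
      have xc: "x \<in> carrier R" using x Q.Icarr by blast
      have "x \<otimes> y \<in> Q'" if "Q' \<in> insert Q F" for Q'
        using that y x Q.I_r_closed ideal.I_l_closed[OF insert.prems(1)[of Q'], of y x] xc by blast
      then have "x \<otimes> y \<in> P" using insert.prems(2)[of "x \<otimes> y"] xc y by blast
      then show ?thesis using P.I_prime x xc y by blast
    qed
    then show ?thesis using insert.IH insert.prems(1) by blast
  qed blast
qed

text \<open>The induction removes a minimal member \<open>P\<close> of \<open>F\<close>: then no remaining prime lies in \<open>P\<close>, so some \<open>w\<close> outside \<open>P\<close>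
  lies in all the others.\<close>

lemma prime_avoidance:
  assumes "finite F" "\<And>Q. Q \<in> F \<Longrightarrow> primeideal Q R" and J: "ideal J R" and "\<And>Q. Q \<in> F \<Longrightarrow> \<not> J \<subseteq> Q"
  shows "\<exists>x\<in>J. \<forall>Q\<in>F. x \<notin> Q"
  using assms(1,2,4)
proof (induction "card F" arbitrary: F)
  case 0
  interpret J: ideal J R by fact
  have "F = {}" using 0 by simp
  then show ?case using J.zero_closed by blast
next
  case (Suc n)
  interpret J: ideal J R by fact
  have "F \<noteq> {}" using Suc by auto
  then obtain P where P: "P \<in> F" "\<forall>Q\<in>F. Q \<subseteq> P \<longrightarrow> P = Q"
    using finite_has_minimal[OF Suc.prems(1)] by blast
  interpret P: primeideal P R using P Suc by blast
  have "n = card (F - {P})" using Suc P by simp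
  then obtain x where x: "x \<in> J" "\<forall>Q\<in>F - {P}. x \<notin> Q"
    using Suc.hyps(1)[of "F - {P}"] Suc.prems by blast
  show ?case
  proof (cases "x \<in> P")
    case False
    then show ?thesis using x by blast
  next
    case True
    have "\<not> (\<exists>Q\<in>F - {P}. Q \<subseteq> P)" using P by blast
    then obtain w where w: "w \<in> carrier R" "\<forall>Q\<in>F - {P}. w \<in> Q" "w \<notin> P"
      using prime_contains_Inter[of "F - {P}" P] Suc.prems(1,2) primeideal.axioms(1) P.primeideal by (metis DiffD1 finite_Diff)
    obtain j where j: "j \<in> J" "j \<notin> P" using Suc.prems(3)[OF P(1)] by blast
    have jc: "j \<in> carrier R" and xc: "x \<in> carrier R" using j x J.Icarr by auto
    \<comment> \<open>Adding \<open>y\<close> moves \<open>x\<close> out of \<open>P\<close> without moving it into another prime of \<open>F\<close>.\<close>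
    define y where "y = j \<otimes> w"
    have y: "y \<in> J" "y \<notin> P" "y \<in> carrier R"
      using J.I_r_closed[OF j(1) w(1)] P.I_prime[OF jc w(1)] j w jc by (auto simp: y_def)
    have "x \<oplus> y \<in> J" using J.a_closed[OF x(1) y(1)] .
    moreover have "x \<oplus> y \<notin> Q" if Q: "Q \<in> F" for Q
    proof (cases "Q = P")
      case True
      then show ?thesis using ideal_add_left_cancel[OF P.is_ideal \<open>x \<in> P\<close> y(3)] y by simp
    next
      case False
      interpret Q: primeideal Q R using Q Suc.prems by blast
      have "y \<in> Q" using w False Q jc by (auto simp: y_def intro: Q.I_l_closed)
      then have "y \<oplus> x \<notin> Q" using ideal_add_left_cancel[OF Q.is_ideal _ xc] x False Q by blast
      then show ?thesis using a_comm[OF xc y(3)] by simp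
    qed
    ultimately show ?thesis by blast
  qed
qed

end

locale noetherian_cring = cring R + noetherian_ring R for R (structure)
begin

lemma ex_maximal_ideal_in:
  assumes "S \<noteq> {}" "\<And>I. I \<in> S \<Longrightarrow> ideal I R"
  shows "\<exists>M\<in>S. \<forall>I\<in>S. M \<subseteq> I \<longrightarrow> I = M"
proof (rule subset_Zorn_nonempty[OF assms(1)])
  fix C assume C: "C \<noteq> {}" "subset.chain S C"
  then have "subset.chain {I. ideal I R} C" using assms(2) by (auto simp: subset_chain_def)
  then show "\<Union>C \<in> S" using ideal_chain_is_trivial[OF C(1)] C(2) by (auto simp: subset_chain_def)
qed

lemma ex_maximalideal_above:
  assumes I: "ideal I R" "\<one> \<notin> I"
  shows "\<exists>M. maximalideal M R \<and> I \<subseteq> M"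
proof -
  let ?S = "{K. ideal K R \<and> I \<subseteq> K \<and> \<one> \<notin> K}"
  have "?S \<noteq> {}" using I by blast
  then obtain M where M: "M \<in> ?S" "\<forall>K\<in>?S. M \<subseteq> K \<longrightarrow> K = M"
    using ex_maximal_ideal_in[of ?S] by blast
  have "maximalideal M R"
  proof (rule maximalidealI)
    show "ideal M R" using M by blast
    show "carrier R \<noteq> M" using M by auto
    fix K assume K: "ideal K R" "M \<subseteq> K" "K \<subseteq> carrier R"
    show "K = M \<or> K = carrier R"
    proof (cases "\<one> \<in> K")
      case True
      then show ?thesis using ideal.one_imp_carrier[OF K(1)] by blast
    next
      case False
      then show ?thesis using M K by blast
    qed
  qed
  then show ?thesis using M by blast
qed

text \<open>The maximal annihilators of nonzero elements of \<open>R / I\<close>; they are associated primes, and the zero divisors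
  on \<open>R / I\<close> are the elements of their union.\<close>

definition max_ann :: "'a set \<Rightarrow> 'a set set" where
  "max_ann I = {P. (\<exists>a\<in>carrier R - I. P = colon R I a) \<and> (\<forall>b\<in>carrier R - I. P \<subseteq> colon R I b \<longrightarrow> colon R I b = P)}"

lemma max_ann_prime:
  assumes I: "ideal I R" and P: "P \<in> max_ann I"
  shows "primeideal P R"
proof -
  interpret I: ideal I R by fact
  obtain a where a: "a \<in> carrier R" "a \<notin> I" "P = colon R I a"
    and mx: "\<And>b. b \<in> carrier R \<Longrightarrow> b \<notin> I \<Longrightarrow> P \<subseteq> colon R I b \<Longrightarrow> colon R I b = P"
    using P unfolding max_ann_def by blast
  show ?thesis
  proof (rule primeidealI[OF _ is_cring])
    show "ideal P R" using colon_ideal[OF I a(1)] a by simp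
    show "carrier R \<noteq> P"
    proof
      assume "carrier R = P"
      then have "\<one> \<otimes> a \<in> I" using one_closed a(3) unfolding colon_def by blast
      then show False using a by simp
    qed
    fix x y assume xy: "x \<in> carrier R" "y \<in> carrier R" "x \<otimes> y \<in> P"
    show "x \<in> P \<or> y \<in> P"
    proof (rule disjCI)
      assume "y \<notin> P"
      then have ya: "y \<otimes> a \<notin> I" using a xy by (auto simp: colon_def)
      have "P \<subseteq> colon R I (y \<otimes> a)"
      proof
        fix z assume "z \<in> P"
        then have z: "z \<in> carrier R" "z \<otimes> a \<in> I" using a by (auto simp: colon_def)
        have "z \<otimes> (y \<otimes> a) = y \<otimes> (z \<otimes> a)" using z xy a by (simp add: m_lcomm)
        then show "z \<in> colon R I (y \<otimes> a)" using z xy I.I_l_closed by (simp add: colon_def)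
      qed
      then have "colon R I (y \<otimes> a) = P" using mx[of "y \<otimes> a"] ya xy a by simp
      moreover have "x \<in> colon R I (y \<otimes> a)" using xy a by (auto simp: colon_def m_assoc)
      ultimately show "x \<in> P" by simp
    qed
  qed
qed

lemma colon_subset_max_ann:
  assumes I: "ideal I R" and a: "a \<in> carrier R" "a \<notin> I"
  shows "\<exists>P\<in>max_ann I. colon R I a \<subseteq> P"
proof -
  let ?S = "{colon R I b | b. b \<in> carrier R - I \<and> colon R I a \<subseteq> colon R I b}"
  have "?S \<noteq> {}" using a by blast
  then obtain P where P: "P \<in> ?S" "\<forall>Q\<in>?S. P \<subseteq> Q \<longrightarrow> Q = P"
    using ex_maximal_ideal_in[of ?S] colon_ideal[OF I] by blast
  then have "P \<in> max_ann I" unfolding max_ann_def by blast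
  then show ?thesis using P by blast
qed

text \<open>Choose \<open>a P\<close> with annihilator \<open>P\<close>. By the maximum principle finitely many \<open>a Q\<close> generate an ideal that
  contains every \<open>a P\<close>; an element of all these \<open>Q\<close> then kills \<open>a P\<close>, so some \<open>Q\<close> lies in \<open>P\<close>, and the two are
  equal by maximality.\<close>

lemma finite_max_ann:
  assumes I: "ideal I R"
  shows "finite (max_ann I)"
proof -
  interpret I: ideal I R by fact
  have "\<forall>P\<in>max_ann I. \<exists>x. x \<in> carrier R \<and> x \<notin> I \<and> P = colon R I x"
    unfolding max_ann_def by auto
  then obtain a where a: "\<And>P. P \<in> max_ann I \<Longrightarrow> a P \<in> carrier R \<and> a P \<notin> I \<and> P = colon R I (a P)"
    using bchoice[of "max_ann I"] by metis
  let ?S = "{Idl (a ` F) | F. F \<subseteq> max_ann I \<and> finite F}"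
  have ac: "a ` F \<subseteq> carrier R" if "F \<subseteq> max_ann I" for F using a that by blast
  have "?S \<noteq> {}" by blast
  moreover have "ideal S R" if "S \<in> ?S" for S using that genideal_ideal ac by blast
  ultimately obtain M where M: "M \<in> ?S" "\<forall>N\<in>?S. M \<subseteq> N \<longrightarrow> N = M"
    using ex_maximal_ideal_in[of ?S] by blast
  then obtain F where F: "F \<subseteq> max_ann I" "finite F" "M = Idl (a ` F)" by blast
  have "P \<in> F" if P: "P \<in> max_ann I" for P
  proof -
    have "a ` insert P F \<subseteq> Idl (a ` insert P F)" by (rule genideal_self[OF ac]) (use F P in blast)
    moreover have "Idl (a ` insert P F) \<in> ?S" using F P by blast
    moreover have "M \<subseteq> Idl (a ` insert P F)"
      unfolding F by (rule Idl_mono[OF _ ac]) (use F P in auto)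
    ultimately have "Idl (a ` insert P F) = Idl (a ` F)" using M(2) F(3) by simp
    then have aP: "a P \<in> Idl (a ` F)" using \<open>a ` insert P F \<subseteq> Idl (a ` insert P F)\<close> by auto
    have "\<exists>Q\<in>F. Q \<subseteq> P"
    proof (rule prime_contains_Inter[OF F(2) _ max_ann_prime[OF I P]])
      show "ideal Q R" if "Q \<in> F" for Q
        using primeideal.axioms(1)[OF max_ann_prime[OF I]] that F by blast
      fix x assume x: "x \<in> carrier R" "\<forall>Q\<in>F. x \<in> Q"
      have "a ` F \<subseteq> colon R I x"
      proof (rule image_subsetI)
        fix Q assume Q: "Q \<in> F"
        have q: "a Q \<in> carrier R" and "Q = colon R I (a Q)" using a Q F(1) by blast+
        then have "x \<otimes> a Q \<in> I" using x Q by (auto simp: colon_def)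
        then show "a Q \<in> colon R I x" using q m_comm[OF x(1) q] by (simp add: colon_def)
      qed
      then have "a P \<in> colon R I x" using genideal_minimal[OF colon_ideal[OF I x(1)]] aP by blast
      then have "x \<otimes> a P \<in> I" using x(1) m_comm[of "a P" x] by (simp add: colon_def)
      then show "x \<in> P" using a[OF P] x(1) by (auto simp: colon_def)
    qed
    then obtain Q where Q: "Q \<in> F" "Q \<subseteq> P" by blast
    have "Q \<in> max_ann I" using Q F by blast
    then have "\<forall>b\<in>carrier R - I. Q \<subseteq> colon R I b \<longrightarrow> colon R I b = Q" unfolding max_ann_def by blast
    then have "P = Q" using a[OF P] Q(2) by (metis DiffI)
    then show ?thesis using Q by simp
  qed
  then have "max_ann I \<subseteq> F" by blast
  then show ?thesis using F(2) by (rule finite_subset)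
qed

text \<open>If \<open>J\<close> kills no nonzero element of \<open>R / I\<close>, it lies in none of the finitely many maximal annihilators, whose
  union consists of the zero divisors; prime avoidance treats three ideals at once.\<close>

lemma noetherian_grade_exchange:
  assumes J: "ideal J R"
  shows "grade_exchange R J (\<lambda>I. ideal I R)"
proof (rule grade_exchange.intro[OF is_cring grade_exchange_axioms.intro])
  interpret J: ideal J R by fact
  show "J \<subseteq> carrier R" by (rule ideal_sub[OF J])
  show "ideal (Idl (insert x I)) R" if "ideal I R" "x \<in> J" for I x
    by (rule Idl_insert_ideal[OF that(1) J.Icarr[OF that(2)]])
  fix I1 I2 I3 assume I: "ideal I1 R" "ideal I2 R" "ideal I3 R"
    and f: "faithful_mod R J I1" "faithful_mod R J I2" "faithful_mod R J I3"
  have nsub: "\<not> J \<subseteq> P" if "ideal I R" "faithful_mod R J I" and P: "P \<in> max_ann I" for I P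
  proof
    assume JP: "J \<subseteq> P"
    obtain a where a: "a \<in> carrier R" "a \<notin> I" "P = colon R I a"
      using P unfolding max_ann_def by blast
    then have "\<forall>x\<in>J. x \<otimes> a \<in> I" using JP by (auto simp: colon_def)
    then show False using that(2) a by (auto simp: faithful_mod_def)
  qed
  have nz: "nzd_mod R I x" if "ideal I R" "x \<in> carrier R" "\<forall>P\<in>max_ann I. x \<notin> P" for I x
    unfolding nzd_mod_def
  proof (intro ballI impI)
    fix y assume y: "y \<in> carrier R" "x \<otimes> y \<in> I"
    then have "x \<in> colon R I y" using that by (simp add: colon_def)
    then show "y \<in> I" using colon_subset_max_ann[OF that(1) y(1)] that(3) by blast
  qed
  have "\<exists>x\<in>J. \<forall>P\<in>max_ann I1 \<union> max_ann I2 \<union> max_ann I3. x \<notin> P"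
    by (rule prime_avoidance[OF _ _ J]) (use finite_max_ann max_ann_prime nsub I f in blast)+
  then show "\<exists>z\<in>J. nzd_mod R I1 z \<and> nzd_mod R I2 z \<and> nzd_mod R I3 z"
    using nz I J.Icarr by blast
qed

end

locale noetherian_local = noetherian_cring +
  fixes m :: "'a set"
  assumes local: "{J. maximalideal J R} = {m}"
begin

sublocale maxideal: maximalideal m R using local by blast

lemma proper_ideal_subset:
  assumes "ideal I R" "\<one> \<notin> I"
  shows "I \<subseteq> m"
  using ex_maximalideal_above[OF assms] local by blast

lemma one_minus_cancel:
  assumes I: "ideal I R" and x: "x \<in> m" and r: "r \<in> carrier R" and n: "n \<in> carrier R"
    and h: "n \<ominus> r \<otimes> x \<otimes> n \<in> I"
  shows "n \<in> I"
proof -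
  have xc: "x \<in> carrier R" using x maxideal.Icarr by blast
  let ?u = "\<one> \<ominus> r \<otimes> x"
  have uc: "?u \<in> carrier R" using xc r by simp
  have "\<one> \<in> PIdl ?u"
  proof (rule ccontr)
    assume "\<one> \<notin> PIdl ?u"
    then have "?u \<in> m" using proper_ideal_subset[OF cgenideal_ideal[OF uc]] cgenideal_self[OF uc] by blast
    moreover have "r \<otimes> x \<in> m" using x r by (rule maxideal.I_l_closed)
    ultimately have "?u \<oplus> r \<otimes> x \<in> m" by (rule maxideal.a_closed)
    moreover have "?u \<oplus> r \<otimes> x = \<one>" using xc r by algebra
    ultimately have "\<one> \<in> m" by simp
    then show False using maxideal.one_imp_carrier maxideal.I_notcarr by blast
  qed
  then obtain v where v: "v \<in> carrier R" "\<one> = v \<otimes> ?u" unfolding cgenideal_def by blast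
  have "v \<otimes> (n \<ominus> r \<otimes> x \<otimes> n) = (v \<otimes> ?u) \<otimes> n" using v(1) xc r n by algebra
  also have "\<dots> = n" using v(2) n by simp
  finally show ?thesis using ideal.I_l_closed[OF I h v(1)] by simp
qed

text \<open>A substitute for Nakayama's lemma: if every \<open>n\<close> in \<open>N\<close> were a multiple \<open>x k\<close> of another \<open>k\<close> in \<open>N\<close> modulo \<open>I\<close>,
  an ideal \<open>I + n\<close> maximal among these would give \<open>k = r n = r x k\<close> modulo \<open>I\<close>, and \<open>1 - r x\<close> is a unit.\<close>

lemma nakayama_cyclic:
  assumes I: "ideal I R" and N: "N \<subseteq> carrier R" and a: "a \<in> N" "a \<notin> I" and x: "x \<in> m"
  shows "\<exists>n\<in>N. \<forall>k\<in>N. n \<ominus> x \<otimes> k \<notin> I"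
proof (rule ccontr)
  assume "\<not> ?thesis"
  then have div: "\<exists>k\<in>N. n \<ominus> x \<otimes> k \<in> I" if "n \<in> N" for n using that by blast
  interpret I: ideal I R by fact
  have xc: "x \<in> carrier R" using x maxideal.Icarr by blast
  let ?S = "{Idl (insert n I) | n. n \<in> N - I}"
  have "?S \<noteq> {}" using a by blast
  moreover have "ideal S R" if "S \<in> ?S" for S using that N Idl_insert_ideal[OF I] by blast
  ultimately obtain M where M: "M \<in> ?S" "\<forall>K\<in>?S. M \<subseteq> K \<longrightarrow> K = M"
    using ex_maximal_ideal_in[of ?S] by blast
  then obtain n where n: "n \<in> N" "n \<notin> I" "M = Idl (insert n I)" by blast
  obtain k where k: "k \<in> N" "n \<ominus> x \<otimes> k \<in> I" using div n by blast
  have nc: "n \<in> carrier R" and kc: "k \<in> carrier R" using n k N by auto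
  have ne: "n = (n \<ominus> x \<otimes> k) \<oplus> x \<otimes> k" using nc kc xc by algebra
  have kI: "k \<notin> I"
  proof
    assume "k \<in> I"
    then have "(n \<ominus> x \<otimes> k) \<oplus> x \<otimes> k \<in> I" using k(2) xc I.I_l_closed I.a_closed by blast
    then show False using ne n(2) by simp
  qed
  have "n \<in> Idl (insert k I)" using mem_Idl_insert[OF I kc] ne k(2) xc by blast
  then have "M \<subseteq> Idl (insert k I)"
    unfolding n(3) using Idl_insert_supset[OF I kc] by (intro genideal_minimal[OF Idl_insert_ideal[OF I kc]]) blast
  then have "Idl (insert k I) = M" using M(2) k kI by blast
  then have "k \<in> Idl (insert n I)" using Idl_insert_self[OF I kc] n by simp
  then obtain i r where i: "i \<in> I" and r: "r \<in> carrier R" and ke: "k = i \<oplus> r \<otimes> n"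
    using mem_Idl_insert[OF I nc] by blast
  have ic: "i \<in> carrier R" using i by (rule I.Icarr)
  have "n \<ominus> r \<otimes> x \<otimes> n = (n \<ominus> x \<otimes> k) \<oplus> x \<otimes> i" unfolding ke using nc xc ic r by algebra
  also have "\<dots> \<in> I" using k(2) I.I_l_closed[OF i xc] by (rule I.a_closed)
  finally show False using one_minus_cancel[OF I x r nc] n(2) by blast
qed

text \<open>The classical inequality depth \<open>R / I \<le>\<close> dim \<open>R / Q\<close> for an associated prime \<open>Q\<close> of \<open>R / I\<close>, by induction along
  a regular sequence \<open>x, \<dots>\<close>: the elements killed by a maximal annihilator \<open>P\<close> are not all divisible by \<open>x\<close>, so
  \<open>P + x\<close> kills a nonzero element of \<open>R / (I + x)\<close>, and \<open>x\<close> is not in \<open>P\<close>.\<close>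

lemma ex_prime_chain_above:
  assumes "ideal I R" "a \<in> carrier R" "a \<notin> I" "Q \<subseteq> colon R I a" "grade_ge R m I s"
  shows "\<exists>qs. prime_chain R qs \<and> length qs = Suc s \<and> Q \<subseteq> hd qs"
  using assms
proof (induction s arbitrary: I a Q)
  case 0
  obtain P where "P \<in> max_ann I" "colon R I a \<subseteq> P" using colon_subset_max_ann[OF 0(1-3)] by blast
  then have "prime_chain R [P] \<and> length [P] = Suc 0 \<and> Q \<subseteq> hd [P]"
    using max_ann_prime[OF 0(1)] 0 by (auto simp: prime_chain_def)
  then show ?case by blast
next
  case (Suc s)
  note I = Suc.prems(1)
  interpret I: ideal I R by fact
  obtain P where P: "P \<in> max_ann I" "Q \<subseteq> P"
    using colon_subset_max_ann[OF Suc.prems(1-3)] Suc.prems(4) by blast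
  then obtain b where b: "b \<in> carrier R" "b \<notin> I" "P = colon R I b" unfolding max_ann_def by blast
  interpret P: primeideal P R by (rule max_ann_prime[OF I P(1)])
  obtain x where x: "x \<in> m" "nzd_mod R I x" "grade_ge R m (Idl (insert x I)) s"
    using Suc.prems(5) by auto
  have xc: "x \<in> carrier R" using x maxideal.Icarr by blast
  define N where "N = {y \<in> carrier R. \<forall>p\<in>P. p \<otimes> y \<in> I}"
  have bN: "b \<in> N" using b(1) unfolding N_def b(3) colon_def by simp
  then obtain n where n: "n \<in> N" "\<And>k. k \<in> N \<Longrightarrow> n \<ominus> x \<otimes> k \<notin> I"
    using nakayama_cyclic[OF I _ bN b(2) x(1)] by (auto simp: N_def)
  have nc: "n \<in> carrier R" using n by (simp add: N_def)
  have nI: "n \<notin> Idl (insert x I)"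
  proof
    assume "n \<in> Idl (insert x I)"
    then obtain i k where i: "i \<in> I" and k: "k \<in> carrier R" and ne: "n = i \<oplus> k \<otimes> x"
      using mem_Idl_insert[OF I xc] by blast
    have ic: "i \<in> carrier R" using i by (rule I.Icarr)
    have "p \<otimes> k \<in> I" if p: "p \<in> P" for p
    proof -
      have pc: "p \<in> carrier R" using p by (rule P.Icarr)
      have "x \<otimes> (p \<otimes> k) = p \<otimes> n \<ominus> p \<otimes> i" unfolding ne using pc k xc ic by algebra
      also have "\<dots> \<in> I" unfolding a_minus_def using n(1) p I.I_l_closed[OF i pc] I.a_closed I.a_inv_closed
        by (simp add: N_def)
      finally show ?thesis using nzd_modD[OF x(2), of "p \<otimes> k"] pc k by simp
    qed
    then have "k \<in> N" using k by (simp add: N_def)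
    moreover have "n \<ominus> x \<otimes> k = i" unfolding ne using k xc ic by algebra
    ultimately show False using n(2) i by force
  qed
  have xI: "ideal (Idl (insert x I)) R" by (rule Idl_insert_ideal[OF I xc])
  have "insert x P \<subseteq> colon R (Idl (insert x I)) n"
    using Idl_insert_self[OF I xc] Idl_insert_supset[OF I xc] ideal.I_r_closed[OF xI _ nc] n(1) xc P.Icarr
    by (auto simp: colon_def N_def)
  then obtain qs where qs: "prime_chain R qs" "length qs = Suc s" "insert x P \<subseteq> hd qs"
    using Suc.IH[OF xI nc nI _ x(3)] by blast
  have "x \<notin> P"
  proof
    assume "x \<in> P"
    then have "x \<otimes> b \<in> I" unfolding b(3) colon_def by blast
    then show False using nzd_modD[OF x(2)] b by blast
  qed
  then have ps: "P \<subset> hd qs" using qs by blast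
  obtain q qs' where qq: "qs = q # qs'" using qs by (cases qs) auto
  have "P \<subset> q'" if "q' \<in> set qs" for q' using that ps qs(1) by (auto simp: qq prime_chain_def)
  then have "prime_chain R (P # qs)" using qs(1) P.primeideal by (auto simp: prime_chain_def)
  then have "prime_chain R (P # qs) \<and> length (P # qs) = Suc (Suc s) \<and> Q \<subseteq> hd (P # qs)"
    using qs(2) P(2) by simp
  then show ?case by blast
qed

text \<open>If the depth were infinite, an ideal maximal among those with infinite grade could be enlarged by any
  nonzerodivisor modulo it.\<close>

lemma depth_finite: "\<exists>k. \<not> grade_ge R m {\<zero>} k"
proof (rule ccontr)
  assume "\<not> ?thesis"
  then have inf: "grade_ge R m {\<zero>} k" for k by blast
  interpret ex: grade_exchange R m "\<lambda>I. ideal I R" by (rule noetherian_grade_exchange[OF maxideal.is_ideal])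
  let ?S = "{I. ideal I R \<and> I \<subseteq> m \<and> (\<forall>k. grade_ge R m I k)}"
  have "{\<zero>} \<in> ?S" using zeroideal maxideal.zero_closed inf by auto
  then have "?S \<noteq> {}" by blast
  then obtain I where I: "I \<in> ?S" "\<forall>K\<in>?S. I \<subseteq> K \<longrightarrow> K = I"
    using ex_maximal_ideal_in[of ?S] by blast
  have id: "ideal I R" using I by blast
  have "grade_ge R m I (Suc 0)" using I by blast
  then obtain x where x: "x \<in> m" "nzd_mod R I x" by auto
  have xc: "x \<in> carrier R" using x maxideal.Icarr by blast
  have "\<forall>k. grade_ge R m (Idl (insert x I)) k" using ex.grade_ge_step[OF id x] I by blast
  moreover have "Idl (insert x I) \<subseteq> m" by (rule genideal_minimal[OF maxideal.is_ideal]) (use x I in blast)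
  ultimately have "Idl (insert x I) = I" using I(2) Idl_insert_ideal[OF id xc] Idl_insert_supset[OF id xc] by blast
  then have "x \<otimes> \<one> \<in> I" using Idl_insert_self[OF id xc] xc by simp
  then have "\<one> \<in> I" using nzd_modD[OF x(2)] by blast
  then have "\<one> \<in> m" using I by blast
  then show False using maxideal.one_imp_carrier maxideal.I_notcarr by blast
qed

text \<open>With \<open>D\<close> the common value of depth and dimension and \<open>g\<close> the length of \<open>xs\<close>, the depth of \<open>R / (xs)\<close> is \<open>D - g\<close> by
  exchange. A chain of that length above the annihilator of \<open>a\<close> extends \<open>ps\<close>, and the total length is at most \<open>D\<close>,
  which is finite by \<open>depth_finite\<close>.\<close>

lemma prime_chain_length_le_regular_sequence:
  assumes cm: "c_grade R m (self_module R) = krull_dim R"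
    and xs: "set xs \<subseteq> m" "wreg R {\<zero>} xs"
    and ps: "prime_chain R ps" and a: "a \<in> carrier R" "a \<notin> Idl (set xs)" "last ps \<subseteq> colon R (Idl (set xs)) a"
  shows "length ps - 1 \<le> length xs"
proof -
  interpret ex: grade_exchange R m "\<lambda>I. ideal I R" by (rule noetherian_grade_exchange[OF maxideal.is_ideal])
  have mc: "m \<subseteq> carrier R" by (rule ideal_sub[OF maxideal.is_ideal])
  note cg = c_grade_self_module_ge_iff[OF mc]
  obtain k where k: "\<not> grade_ge R m {\<zero>} k" using depth_finite by blast
  have lt: "n < k" if "grade_ge R m {\<zero>} n" for n using grade_ge_mono[OF that] k by (meson not_less)
  define D where "D = (GREATEST n. grade_ge R m {\<zero>} n)"
  have D: "grade_ge R m {\<zero>} D"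
    unfolding D_def by (rule GreatestI_nat[where b = k and k = 0]) (use lt less_imp_le in auto)
  have Dmax: "n \<le> D" if "grade_ge R m {\<zero>} n" for n
    unfolding D_def by (rule Greatest_le_nat[where b = k]) (use lt less_imp_le that in auto)
  have g: "length xs \<le> D" using Dmax xs grade_ge_iff_wreg by blast
  have Ie: "Idl ({\<zero>} \<union> set xs) = Idl (set xs)"
    using Idl_Idl_Un[of "{}" "set xs"] xs mc unfolding Idl_empty by auto
  have id: "ideal (Idl (set xs)) R" using xs mc by (intro genideal_ideal) blast
  have "grade_ge R m (Idl (set xs)) (D - length xs)"
    using ex.grade_ge_wreg_append[OF zeroideal xs, of "D - length xs"] D g Ie by simp
  then obtain qs where qs: "prime_chain R qs" "length qs = Suc (D - length xs)" "last ps \<subseteq> hd qs"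
    using ex_prime_chain_above[OF id a] by blast
  have pb: "ps = butlast ps @ [last ps]" using ps by (simp add: prime_chain_def)
  have srt: "sorted_wrt (\<subset>) (butlast ps @ [last ps])" using ps pb by (simp add: prime_chain_def)
  obtain q qs' where qq: "qs = q # qs'" using qs by (cases qs) auto
  have hq: "hd qs \<subseteq> q'" if "q' \<in> set qs" for q' using that qs(1) by (auto simp: qq prime_chain_def)
  have "p \<subset> q'" if "p \<in> set (butlast ps)" "q' \<in> set qs" for p q'
  proof -
    have "p \<subset> last ps" using srt that(1) by (simp add: sorted_wrt_append)
    then show ?thesis using qs(3) hq[OF that(2)] by blast
  qed
  moreover have "sorted_wrt (\<subset>) (butlast ps)" using srt by (simp add: sorted_wrt_append)
  ultimately have "prime_chain R (butlast ps @ qs)"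
    using ps qs(1) by (auto simp: prime_chain_def sorted_wrt_append qq dest: in_set_butlastD)
  then have "enat (length (butlast ps @ qs) - 1) \<le> krull_dim R"
    unfolding krull_dim_def by (intro SUP_upper) simp
  then have "grade_ge R m {\<zero>} (length (butlast ps @ qs) - 1)" using cm cg by simp
  then have "length (butlast ps @ qs) - 1 \<le> D" by (rule Dmax)
  then show ?thesis using qs(2) g by simp
qed

end

section \<open>Localization and Cohen-Macaulay rings\<close>

locale mult_subset = cring R for R (structure) +
  fixes S :: "'a set"
  assumes S_sub: "S \<subseteq> carrier R" and S_one: "\<one> \<in> S"
    and S_mult: "s \<in> S \<Longrightarrow> t \<in> S \<Longrightarrow> s \<otimes> t \<in> S"
begin

abbreviation frac where "frac a s \<equiv> fraction_rel R S `` {(a, s)}"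
abbreviation B where "B \<equiv> localization R S"

lemma S_carr: "s \<in> S \<Longrightarrow> s \<in> carrier R" using S_sub by blast

lemma equiv_fraction_rel: "equiv (carrier R \<times> S) (fraction_rel R S)"
proof (rule equivI)
  show "fraction_rel R S \<subseteq> (carrier R \<times> S) \<times> carrier R \<times> S" by (auto simp: fraction_rel_def)
  show "refl_on (carrier R \<times> S) (fraction_rel R S)"
    using S_one by (auto simp: fraction_rel_def refl_on_def)
  show "sym (fraction_rel R S)"
    by (rule symI) (force simp: fraction_rel_def)
  show "trans (fraction_rel R S)"
  proof (rule transI)
    fix x y z assume "(x, y) \<in> fraction_rel R S" "(y, z) \<in> fraction_rel R S"
    then obtain a s b t c r u v where e: "x = (a, s)" "y = (b, t)" "z = (c, r)"
      and c: "a \<in> carrier R" "b \<in> carrier R" "c \<in> carrier R" "s \<in> S" "t \<in> S" "r \<in> S" "u \<in> S" "v \<in> S"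
      and h: "u \<otimes> (t \<otimes> a) = u \<otimes> (s \<otimes> b)" "v \<otimes> (r \<otimes> b) = v \<otimes> (t \<otimes> c)"
      by (auto simp: fraction_rel_def)
    note d = c(1-3) S_carr[OF c(4)] S_carr[OF c(5)] S_carr[OF c(6)] S_carr[OF c(7)] S_carr[OF c(8)]
    have "(u \<otimes> v \<otimes> t) \<otimes> (r \<otimes> a) = v \<otimes> r \<otimes> (u \<otimes> (t \<otimes> a))" using d by algebra
    also have "\<dots> = u \<otimes> s \<otimes> (v \<otimes> (r \<otimes> b))" unfolding h(1) using d by algebra
    also have "\<dots> = (u \<otimes> v \<otimes> t) \<otimes> (s \<otimes> c)" unfolding h(2) using d by algebra
    finally show "(x, z) \<in> fraction_rel R S"
      unfolding e fraction_rel_def using c S_mult by blast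
  qed
qed

lemma frac_eq_iff:
  assumes "a \<in> carrier R" "s \<in> S" "b \<in> carrier R" "t \<in> S"
  shows "frac a s = frac b t \<longleftrightarrow> (\<exists>u\<in>S. u \<otimes> (t \<otimes> a) = u \<otimes> (s \<otimes> b))"
proof -
  have "frac a s = frac b t \<longleftrightarrow> ((a, s), (b, t)) \<in> fraction_rel R S"
    using equiv_fraction_rel assms by (intro eq_equiv_class_iff) auto
  then show ?thesis using assms by (simp add: fraction_rel_def)
qed

lemma frac_eqI:
  assumes "a \<in> carrier R" "s \<in> S" "b \<in> carrier R" "t \<in> S" "t \<otimes> a = s \<otimes> b"
  shows "frac a s = frac b t"
  using frac_eq_iff[OF assms(1-4)] assms(5) S_one by auto

lemma mem_frac_iff:
  "(b, t) \<in> frac a s \<longleftrightarrow> a \<in> carrier R \<and> s \<in> S \<and> b \<in> carrier R \<and> t \<in> S \<and> frac b t = frac a s"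
  using frac_eq_iff[of a s b t] by (auto simp: fraction_rel_def)

lemma frac_in_carrier: "a \<in> carrier R \<Longrightarrow> s \<in> S \<Longrightarrow> frac a s \<in> carrier B"
  by (auto simp: localization_def intro: quotientI)

lemma carrier_localizationE:
  assumes "U \<in> carrier B"
  obtains a s where "a \<in> carrier R" "s \<in> S" "U = frac a s"
  using assms by (auto simp: localization_def elim!: quotientE)

text \<open>The operations of \<open>localization\<close> are unions over all representatives; a union of equal classes collapses.\<close>

lemma frac_op:
  assumes a: "a \<in> carrier R" "s \<in> S" and b: "b \<in> carrier R" "t \<in> S"
    and cong: "\<And>a' s' b' t'. \<lbrakk>a' \<in> carrier R; s' \<in> S; b' \<in> carrier R; t' \<in> S; frac a' s' = frac a s;
      frac b' t' = frac b t\<rbrakk> \<Longrightarrow> f a' s' b' t' = f a s b t"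
  shows "(\<Union>(a, s)\<in>frac a s. \<Union>(b, t)\<in>frac b t. f a s b t) = f a s b t"
proof -
  have "(case p of (a', s') \<Rightarrow> \<Union>(b', t')\<in>frac b t. f a' s' b' t') = f a s b t" if p: "p \<in> frac a s" for p
  proof -
    obtain a' s' where p': "p = (a', s')" by (cases p)
    have a': "a' \<in> carrier R" "s' \<in> S" "frac a' s' = frac a s" using p unfolding p' mem_frac_iff by auto
    have "(case q of (b', t') \<Rightarrow> f a' s' b' t') = f a s b t" if q: "q \<in> frac b t" for q
    proof -
      obtain b' t' where q': "q = (b', t')" by (cases q)
      then show ?thesis using q a' cong[of a' s' b' t'] unfolding q' mem_frac_iff by auto
    qed
    moreover have "(b, t) \<in> frac b t" by (rule mem_frac_iff[THEN iffD2]) (use b in blast)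
    ultimately show ?thesis unfolding p' by auto
  qed
  moreover have "(a, s) \<in> frac a s" by (rule mem_frac_iff[THEN iffD2]) (use a in blast)
  ultimately show ?thesis by auto
qed

lemma frac_mult:
  assumes a: "a \<in> carrier R" "s \<in> S" and b: "b \<in> carrier R" "t \<in> S"
  shows "frac a s \<otimes>\<^bsub>B\<^esub> frac b t = frac (a \<otimes> b) (s \<otimes> t)"
proof -
  have "frac (a' \<otimes> b') (s' \<otimes> t') = frac (a \<otimes> b) (s \<otimes> t)"
    if c: "a' \<in> carrier R" "s' \<in> S" "b' \<in> carrier R" "t' \<in> S" "frac a' s' = frac a s" "frac b' t' = frac b t"
    for a' s' b' t'
  proof -
    obtain u where u: "u \<in> S" "u \<otimes> (s \<otimes> a') = u \<otimes> (s' \<otimes> a)"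
      using c(5) frac_eq_iff[OF c(1,2) a] by blast
    obtain v where v: "v \<in> S" "v \<otimes> (t \<otimes> b') = v \<otimes> (t' \<otimes> b)"
      using c(6) frac_eq_iff[OF c(3,4) b] by blast
    note d = a(1) b(1) c(1,3) S_carr[OF a(2)] S_carr[OF b(2)] S_carr[OF c(2)] S_carr[OF c(4)] S_carr[OF u(1)] S_carr[OF v(1)]
    have "(u \<otimes> v) \<otimes> ((s \<otimes> t) \<otimes> (a' \<otimes> b')) = (u \<otimes> (s \<otimes> a')) \<otimes> (v \<otimes> (t \<otimes> b'))" using d by algebra
    also have "\<dots> = (u \<otimes> v) \<otimes> ((s' \<otimes> t') \<otimes> (a \<otimes> b))" unfolding u(2) v(2) using d by algebra
    finally show ?thesis
      using frac_eq_iff[OF m_closed[OF c(1,3)] S_mult[OF c(2,4)] m_closed[OF a(1) b(1)] S_mult[OF a(2) b(2)]]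
        S_mult[OF u(1) v(1)] by blast
  qed
  then show ?thesis
    using frac_op[OF a b, of "\<lambda>a s b t. frac (a \<otimes> b) (s \<otimes> t)"] by (simp add: localization_def)
qed

lemma frac_add:
  assumes a: "a \<in> carrier R" "s \<in> S" and b: "b \<in> carrier R" "t \<in> S"
  shows "frac a s \<oplus>\<^bsub>B\<^esub> frac b t = frac (t \<otimes> a \<oplus> s \<otimes> b) (s \<otimes> t)"
proof -
  have "frac (t' \<otimes> a' \<oplus> s' \<otimes> b') (s' \<otimes> t') = frac (t \<otimes> a \<oplus> s \<otimes> b) (s \<otimes> t)"
    if c: "a' \<in> carrier R" "s' \<in> S" "b' \<in> carrier R" "t' \<in> S" "frac a' s' = frac a s" "frac b' t' = frac b t"
    for a' s' b' t'
  proof -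
    obtain u where u: "u \<in> S" "u \<otimes> (s \<otimes> a') = u \<otimes> (s' \<otimes> a)"
      using c(5) frac_eq_iff[OF c(1,2) a] by blast
    obtain v where v: "v \<in> S" "v \<otimes> (t \<otimes> b') = v \<otimes> (t' \<otimes> b)"
      using c(6) frac_eq_iff[OF c(3,4) b] by blast
    note d = a(1) b(1) c(1,3) S_carr[OF a(2)] S_carr[OF b(2)] S_carr[OF c(2)] S_carr[OF c(4)] S_carr[OF u(1)] S_carr[OF v(1)]
    have "(u \<otimes> v) \<otimes> ((s \<otimes> t) \<otimes> (t' \<otimes> a' \<oplus> s' \<otimes> b'))
        = v \<otimes> t \<otimes> t' \<otimes> (u \<otimes> (s \<otimes> a')) \<oplus> u \<otimes> s \<otimes> s' \<otimes> (v \<otimes> (t \<otimes> b'))" using d by algebra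
    also have "\<dots> = (u \<otimes> v) \<otimes> ((s' \<otimes> t') \<otimes> (t \<otimes> a \<oplus> s \<otimes> b))" unfolding u(2) v(2) using d by algebra
    finally have "(u \<otimes> v) \<otimes> ((s \<otimes> t) \<otimes> (t' \<otimes> a' \<oplus> s' \<otimes> b')) = (u \<otimes> v) \<otimes> ((s' \<otimes> t') \<otimes> (t \<otimes> a \<oplus> s \<otimes> b))" .
    moreover have "t' \<otimes> a' \<oplus> s' \<otimes> b' \<in> carrier R" "t \<otimes> a \<oplus> s \<otimes> b \<in> carrier R" using d by auto
    ultimately show ?thesis
      using frac_eq_iff[OF _ S_mult[OF c(2,4)] _ S_mult[OF a(2) b(2)]] S_mult[OF u(1) v(1)] by blast
  qed
  then show ?thesis
    using frac_op[OF a b, of "\<lambda>a s b t. frac (t \<otimes> a \<oplus> s \<otimes> b) (s \<otimes> t)"] by (simp add: localization_def)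
qed

lemma localization_one_zero: "\<one>\<^bsub>B\<^esub> = frac \<one> \<one>" "\<zero>\<^bsub>B\<^esub> = frac \<zero> \<one>"
  by (simp_all add: localization_def)

lemma localization_cring: "cring B"
proof (rule cringI)
  note [simp] = S_carr S_mult S_one frac_mult frac_add localization_one_zero frac_in_carrier
  show "abelian_group B"
  proof (rule abelian_groupI)
    fix U V assume U: "U \<in> carrier B" and V: "V \<in> carrier B"
    obtain a s where a: "a \<in> carrier R" "s \<in> S" "U = frac a s" using U by (rule carrier_localizationE)
    obtain b t where b: "b \<in> carrier R" "t \<in> S" "V = frac b t" using V by (rule carrier_localizationE)
    show "U \<oplus>\<^bsub>B\<^esub> V \<in> carrier B" using a b by simp
    show "U \<oplus>\<^bsub>B\<^esub> V = V \<oplus>\<^bsub>B\<^esub> U" using a b by (simp add: a_comm m_comm)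
    fix W assume W: "W \<in> carrier B"
    obtain c r where c: "c \<in> carrier R" "r \<in> S" "W = frac c r" using W by (rule carrier_localizationE)
    show "U \<oplus>\<^bsub>B\<^esub> V \<oplus>\<^bsub>B\<^esub> W = U \<oplus>\<^bsub>B\<^esub> (V \<oplus>\<^bsub>B\<^esub> W)"
      using a b c by (simp add: r_distr a_assoc m_ac)
  next
    fix U assume U: "U \<in> carrier B"
    obtain a s where a: "a \<in> carrier R" "s \<in> S" "U = frac a s" using U by (rule carrier_localizationE)
    show "\<zero>\<^bsub>B\<^esub> \<oplus>\<^bsub>B\<^esub> U = U" using a by simp
    have "frac (\<ominus> a) s \<oplus>\<^bsub>B\<^esub> U = frac (s \<otimes> \<ominus> a \<oplus> s \<otimes> a) (s \<otimes> s)" using a by simp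
    also have "\<dots> = frac \<zero> \<one>" by (rule frac_eqI) (use a in \<open>simp_all add: r_minus l_neg\<close>)
    finally show "\<exists>V\<in>carrier B. V \<oplus>\<^bsub>B\<^esub> U = \<zero>\<^bsub>B\<^esub>" using a by (intro bexI[of _ "frac (\<ominus> a) s"]) auto
  qed simp
  show "Group.comm_monoid B"
  proof (rule comm_monoidI)
    fix U V assume U: "U \<in> carrier B" and V: "V \<in> carrier B"
    obtain a s where a: "a \<in> carrier R" "s \<in> S" "U = frac a s" using U by (rule carrier_localizationE)
    obtain b t where b: "b \<in> carrier R" "t \<in> S" "V = frac b t" using V by (rule carrier_localizationE)
    show "U \<otimes>\<^bsub>B\<^esub> V \<in> carrier B" using a b by simp
    show "U \<otimes>\<^bsub>B\<^esub> V = V \<otimes>\<^bsub>B\<^esub> U" using a b by (simp add: m_comm)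
    fix W assume W: "W \<in> carrier B"
    obtain c r where c: "c \<in> carrier R" "r \<in> S" "W = frac c r" using W by (rule carrier_localizationE)
    show "U \<otimes>\<^bsub>B\<^esub> V \<otimes>\<^bsub>B\<^esub> W = U \<otimes>\<^bsub>B\<^esub> (V \<otimes>\<^bsub>B\<^esub> W)" using a b c by (simp add: m_ac)
  next
    fix U assume U: "U \<in> carrier B"
    obtain a s where a: "a \<in> carrier R" "s \<in> S" "U = frac a s" using U by (rule carrier_localizationE)
    show "\<one>\<^bsub>B\<^esub> \<otimes>\<^bsub>B\<^esub> U = U" using a by simp
  qed simp
  fix U V W assume U: "U \<in> carrier B" and V: "V \<in> carrier B" and W: "W \<in> carrier B"
  obtain a s where a: "a \<in> carrier R" "s \<in> S" "U = frac a s" using U by (rule carrier_localizationE)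
  obtain b t where b: "b \<in> carrier R" "t \<in> S" "V = frac b t" using V by (rule carrier_localizationE)
  obtain c r where c: "c \<in> carrier R" "r \<in> S" "W = frac c r" using W by (rule carrier_localizationE)
  note d = a(1) b(1) c(1) S_carr[OF a(2)] S_carr[OF b(2)] S_carr[OF c(2)]
  have "frac ((t \<otimes> a \<oplus> s \<otimes> b) \<otimes> c) (s \<otimes> t \<otimes> r)
      = frac ((t \<otimes> r) \<otimes> (a \<otimes> c) \<oplus> (s \<otimes> r) \<otimes> (b \<otimes> c)) ((s \<otimes> r) \<otimes> (t \<otimes> r))"
  proof (rule frac_eqI)
    show "s \<otimes> r \<otimes> (t \<otimes> r) \<otimes> ((t \<otimes> a \<oplus> s \<otimes> b) \<otimes> c) = s \<otimes> t \<otimes> r \<otimes> (t \<otimes> r \<otimes> (a \<otimes> c) \<oplus> s \<otimes> r \<otimes> (b \<otimes> c))"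
      using d by algebra
  qed (use a b c in simp_all)
  then show "(U \<oplus>\<^bsub>B\<^esub> V) \<otimes>\<^bsub>B\<^esub> W = U \<otimes>\<^bsub>B\<^esub> W \<oplus>\<^bsub>B\<^esub> V \<otimes>\<^bsub>B\<^esub> W"
    using a b c by simp
qed

sublocale B: cring B by (rule localization_cring)

definition \<eta> where "\<eta> a = frac a \<one>"

lemma \<eta>_hom: "\<eta> \<in> ring_hom R B"
  by (rule ring_hom_memI)
    (simp_all add: \<eta>_def frac_in_carrier S_one frac_mult frac_add localization_one_zero)

lemma \<eta>_closed: "a \<in> carrier R \<Longrightarrow> \<eta> a \<in> carrier B" using ring_hom_closed[OF \<eta>_hom] .

lemma \<eta>_one: "\<eta> \<one> = \<one>\<^bsub>B\<^esub>" using ring_hom_one[OF \<eta>_hom] .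

lemma frac_eq_\<eta>_mult: "a \<in> carrier R \<Longrightarrow> s \<in> S \<Longrightarrow> frac a s = frac \<one> s \<otimes>\<^bsub>B\<^esub> \<eta> a"
  by (simp add: \<eta>_def frac_mult S_one S_carr)

definition extended :: "'a set \<Rightarrow> ('a \<times> 'a) set set" where
  "extended I = {frac a s | a s. a \<in> I \<and> s \<in> S}"

lemma frac_mem_ext:
  assumes I: "ideal I R" and a: "a \<in> carrier R" and s: "s \<in> S"
  shows "frac a s \<in> extended I \<longleftrightarrow> (\<exists>u\<in>S. u \<otimes> a \<in> I)"
proof
  interpret I: ideal I R by fact
  assume "frac a s \<in> extended I"
  then obtain b t where b: "b \<in> I" "t \<in> S" "frac a s = frac b t" unfolding extended_def by blast
  then obtain u where u: "u \<in> S" "u \<otimes> (t \<otimes> a) = u \<otimes> (s \<otimes> b)"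
    using frac_eq_iff[OF a s I.Icarr[OF b(1)] b(2)] by blast
  have "(u \<otimes> t) \<otimes> a = (u \<otimes> s) \<otimes> b" using u a b I.Icarr[OF b(1)] s S_carr by (simp add: m_assoc)
  then have "(u \<otimes> t) \<otimes> a \<in> I" using b u s S_carr I.I_l_closed by simp
  then show "\<exists>u\<in>S. u \<otimes> a \<in> I" using u b S_mult by blast
next
  assume "\<exists>u\<in>S. u \<otimes> a \<in> I"
  then obtain u where u: "u \<in> S" "u \<otimes> a \<in> I" by blast
  have "frac a s = frac (u \<otimes> a) (u \<otimes> s)"
    by (rule frac_eqI) (use u a s S_carr S_mult in \<open>auto simp: m_ac\<close>)
  then show "frac a s \<in> extended I" unfolding extended_def using u s S_mult by blast
qed

lemma \<eta>_mem_ext: "ideal I R \<Longrightarrow> a \<in> carrier R \<Longrightarrow> \<eta> a \<in> extended I \<longleftrightarrow> (\<exists>u\<in>S. u \<otimes> a \<in> I)"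
  unfolding \<eta>_def by (rule frac_mem_ext[OF _ _ S_one])

lemma ext_ideal:
  assumes I: "ideal I R"
  shows "ideal (extended I) B"
proof (rule B.idealI_cring)
  interpret I: ideal I R by fact
  show "extended I \<subseteq> carrier B" unfolding extended_def using frac_in_carrier I.Icarr by blast
  have "frac \<zero> \<one> \<in> extended I" unfolding extended_def using I.zero_closed S_one by (intro CollectI exI conjI) auto
  then show "\<zero>\<^bsub>B\<^esub> \<in> extended I" by (simp add: localization_one_zero)
  show "V \<otimes>\<^bsub>B\<^esub> U \<in> extended I" if U: "U \<in> extended I" and V: "V \<in> carrier B" for U V
  proof -
    obtain a s where a: "a \<in> I" "s \<in> S" "U = frac a s" using U unfolding extended_def by blast
    obtain b t where b: "b \<in> carrier R" "t \<in> S" "V = frac b t" using V by (rule carrier_localizationE)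
    have "V \<otimes>\<^bsub>B\<^esub> U = frac (b \<otimes> a) (t \<otimes> s)" using a b I.Icarr by (simp add: frac_mult)
    then show ?thesis unfolding extended_def using a b I.I_l_closed S_mult by blast
  qed
  show "U \<oplus>\<^bsub>B\<^esub> V \<in> extended I" if U: "U \<in> extended I" and V: "V \<in> extended I" for U V
  proof -
    obtain a s where a: "a \<in> I" "s \<in> S" "U = frac a s" using U unfolding extended_def by blast
    obtain b t where b: "b \<in> I" "t \<in> S" "V = frac b t" using V unfolding extended_def by blast
    have "U \<oplus>\<^bsub>B\<^esub> V = frac (t \<otimes> a \<oplus> s \<otimes> b) (s \<otimes> t)" using a b I.Icarr by (simp add: frac_add)
    moreover have "t \<otimes> a \<oplus> s \<otimes> b \<in> I"
      by (rule I.a_closed[OF I.I_l_closed[OF a(1) S_carr[OF b(2)]] I.I_l_closed[OF b(1) S_carr[OF a(2)]]])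
    moreover have "s \<otimes> t \<in> S" using a b S_mult by blast
    ultimately show ?thesis unfolding extended_def by blast
  qed
qed

lemma ext_eq_Idl: 
  assumes Y: "Y \<subseteq> carrier R"
  shows "Idl\<^bsub>B\<^esub> (\<eta> ` Y) = extended (Idl Y)"
proof
  have id: "ideal (Idl Y) R" by (rule genideal_ideal[OF Y])
  interpret I: ideal "Idl Y" R by (rule id)
  have Ys: "Y \<subseteq> Idl Y" by (rule genideal_self[OF Y])
  show "Idl\<^bsub>B\<^esub> (\<eta> ` Y) \<subseteq> extended (Idl Y)"
    by (rule B.genideal_minimal[OF ext_ideal[OF id]]) (use Ys S_one in \<open>auto simp: \<eta>_def extended_def\<close>)
  have eY: "\<eta> ` Y \<subseteq> carrier B" using Y \<eta>_closed by blast
  interpret K: ideal "Idl\<^bsub>B\<^esub> (\<eta> ` Y)" B by (rule B.genideal_ideal[OF eY])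
  have e: "\<eta> a \<in> Idl\<^bsub>B\<^esub> (\<eta> ` Y)" if "a \<in> Idl Y" for a
    using ring_hom_Idl[OF is_cring localization_cring \<eta>_hom Y] that by blast
  show "extended (Idl Y) \<subseteq> Idl\<^bsub>B\<^esub> (\<eta> ` Y)"
  proof
    fix U assume "U \<in> extended (Idl Y)"
    then obtain a s where a: "a \<in> Idl Y" "s \<in> S" "U = frac a s" unfolding extended_def by blast
    then show "U \<in> Idl\<^bsub>B\<^esub> (\<eta> ` Y)"
      using frac_eq_\<eta>_mult[OF I.Icarr[OF a(1)] a(2)] K.I_l_closed[OF e[OF a(1)]] frac_in_carrier[OF one_closed a(2)] by simp
  qed
qed

lemma nzd_mod_localize:
  assumes I: "ideal I R" and x: "x \<in> carrier R" and nz: "nzd_mod R I x"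
  shows "nzd_mod B (extended I) (\<eta> x)"
  unfolding nzd_mod_def
proof (intro ballI impI)
  fix U assume U: "U \<in> carrier B" and h: "\<eta> x \<otimes>\<^bsub>B\<^esub> U \<in> extended I"
  obtain a s where a: "a \<in> carrier R" "s \<in> S" "U = frac a s" using U by (rule carrier_localizationE)
  have "\<eta> x \<otimes>\<^bsub>B\<^esub> U = frac (x \<otimes> a) s" using a x by (simp add: \<eta>_def frac_mult S_one S_carr)
  then obtain u where u: "u \<in> S" "u \<otimes> (x \<otimes> a) \<in> I" using h frac_mem_ext[OF I _ a(2), of "x \<otimes> a"] x a by auto
  have "x \<otimes> (u \<otimes> a) = u \<otimes> (x \<otimes> a)" using x u S_carr a by (simp add: m_lcomm)
  then have "u \<otimes> a \<in> I" using nzd_modD[OF nz, of "u \<otimes> a"] u S_carr a by simp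
  then show "U \<in> extended I" using frac_mem_ext[OF I a(1,2)] a u by blast
qed

lemma wreg_localize:
  assumes "set xs \<subseteq> carrier R" "wreg R {\<zero>} xs"
  shows "wreg B {\<zero>\<^bsub>B\<^esub>} (map \<eta> xs)"
proof (rule wreg_map[OF is_cring localization_cring subset_refl _ _ assms])
  show "\<eta> ` carrier R \<subseteq> carrier B" using \<eta>_closed by blast
  show "nzd_mod B (Idl\<^bsub>B\<^esub> (\<eta> ` Y)) (\<eta> x)"
    if "Y \<subseteq> carrier R" "x \<in> carrier R" "nzd_mod R (Idl Y) x" for Y x
    unfolding ext_eq_Idl[OF that(1)] by (rule nzd_mod_localize[OF genideal_ideal[OF that(1)] that(2,3)])
qed

lemma ext_prime:
  assumes P: "primeideal P R" and disj: "P \<inter> S = {}"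
  shows "primeideal (extended P) B"
proof (rule primeidealI[OF _ localization_cring])
  interpret P: primeideal P R by fact
  note PI = P.is_ideal
  have mem: "frac a s \<in> extended P \<longleftrightarrow> a \<in> P" if "a \<in> carrier R" "s \<in> S" for a s
    unfolding frac_mem_ext[OF PI that]
    using P.I_prime[OF _ that(1)] disj S_carr S_one P.I_l_closed that by (metis Int_iff empty_iff l_one)
  show "ideal (extended P) B" by (rule ext_ideal[OF PI])
  have "\<one> \<notin> P" using P.one_imp_carrier P.I_notcarr by blast
  then have "\<one>\<^bsub>B\<^esub> \<notin> extended P" using mem[OF one_closed S_one] by (simp add: localization_one_zero)
  then show "carrier B \<noteq> extended P" using B.one_closed by blast
  fix U V assume U: "U \<in> carrier B" and V: "V \<in> carrier B" and UV: "U \<otimes>\<^bsub>B\<^esub> V \<in> extended P"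
  obtain a s where a: "a \<in> carrier R" "s \<in> S" "U = frac a s" using U by (rule carrier_localizationE)
  obtain b t where b: "b \<in> carrier R" "t \<in> S" "V = frac b t" using V by (rule carrier_localizationE)
  have "a \<otimes> b \<in> P" using UV a b mem[of "a \<otimes> b" "s \<otimes> t"] S_mult by (simp add: frac_mult)
  then show "U \<in> extended P \<or> V \<in> extended P" using P.I_prime a b mem by blast
qed

lemma \<eta>_mem_ext_prime:
  assumes P: "primeideal P R" and disj: "P \<inter> S = {}" and a: "a \<in> carrier R"
  shows "\<eta> a \<in> extended P \<longleftrightarrow> a \<in> P"
proof -
  interpret P: primeideal P R by fact
  have "\<eta> a \<in> extended P" if "a \<in> P" using \<eta>_mem_ext[OF P.is_ideal a] S_one that a by (metis l_one)
  moreover have "a \<in> P" if "\<eta> a \<in> extended P"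
  proof -
    obtain u where u: "u \<in> S" "u \<otimes> a \<in> P" using \<eta>_mem_ext[OF P.is_ideal a] \<open>\<eta> a \<in> extended P\<close> by blast
    then show ?thesis using P.I_prime[of u a] S_carr a disj by blast
  qed
  ultimately show ?thesis by blast
qed

lemma ext_mono: "I \<subseteq> K \<Longrightarrow> extended I \<subseteq> extended K"
  unfolding extended_def by blast

lemma ext_prime_chain:
  assumes ps: "prime_chain R ps" and disj: "\<And>P. P \<in> set ps \<Longrightarrow> P \<inter> S = {}"
  shows "prime_chain B (map extended ps)"
proof -
  have "extended p \<subset> extended q" if p: "p \<in> set ps" and q: "q \<in> set ps" and pq: "p \<subset> q" for p q
  proof -
    obtain a where a: "a \<in> q" "a \<notin> p" using pq by blast
    have pp: "primeideal p R" "primeideal q R" using ps p q by (auto simp: prime_chain_def)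
    have ac: "a \<in> carrier R" by (rule ideal.Icarr[OF primeideal.axioms(1)[OF pp(2)] a(1)])
    then have "\<eta> a \<in> extended q" "\<eta> a \<notin> extended p" using \<eta>_mem_ext_prime pp disj p q a by blast+
    then show ?thesis using ext_mono[of p q] pq by blast
  qed
  then have "sorted_wrt (\<lambda>p q. extended p \<subset> extended q) ps"
    using ps sorted_wrt_mono_rel[of ps "(\<subset>)" "\<lambda>p q. extended p \<subset> extended q"] by (simp add: prime_chain_def)
  moreover have "primeideal P B" if P: "P \<in> set (map extended ps)" for P
  proof -
    obtain p where "p \<in> set ps" "P = extended p" using P by auto
    then show ?thesis using ext_prime[of p] disj ps by (simp add: prime_chain_def)
  qed
  ultimately show ?thesis using ps by (simp add: prime_chain_def sorted_wrt_map)
qed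

end


lemma (in cring) wreg_append_one:
  assumes "ideal I R" "set xs \<subseteq> carrier R"
  shows "wreg R I (xs @ [x]) \<longleftrightarrow> wreg R I xs \<and> nzd_mod R (Idl (I \<union> set xs)) x"
  using assms
proof (induction xs arbitrary: I)
  case Nil
  then show ?case using Idl_of_ideal by simp
next
  case (Cons y xs)
  have y: "y \<in> carrier R" and xs: "set xs \<subseteq> carrier R" using Cons.prems by auto
  have "Idl (Idl (insert y I) \<union> set xs) = Idl (I \<union> set (y # xs))"
    using Idl_Idl_Un[OF _ xs, of "insert y I"] y ideal_sub[OF Cons.prems(1)] by simp
  then show ?case using Cons.IH[OF Idl_insert_ideal[OF Cons.prems(1) y] xs] by simp
qed

text \<open>The bound \<open>prime_chain_length_le_regular_sequence\<close> in the localization at \<open>M\<close>; since \<open>M\<close> contains the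
  annihilator of \<open>a\<close>, the image of \<open>a\<close> is still nonzero modulo the sequence, and the chain stays strict.\<close>

lemma cohen_macaulay_local_at:
  assumes cm: "cohen_macaulay_ring R" and M: "maximalideal M R"
    and ps: "prime_chain R ps" "last ps \<subseteq> M"
    and xs: "set xs \<subseteq> M" "wreg R {\<zero>\<^bsub>R\<^esub>} xs"
    and a: "a \<in> carrier R" "last ps \<subseteq> colon R (Idl\<^bsub>R\<^esub> (set xs)) a" "colon R (Idl\<^bsub>R\<^esub> (set xs)) a \<subseteq> M"
  shows "length ps - 1 \<le> length xs"
proof -
  interpret cring R using cm by (simp add: cohen_macaulay_ring_def)
  interpret M: primeideal M R by (rule maximalideal_prime[OF M])
  let ?S = "carrier R - M"
  have one: "\<one>\<^bsub>R\<^esub> \<notin> M" using M.one_imp_carrier M.I_notcarr by blast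
  interpret loc: mult_subset R ?S
    by (rule mult_subset.intro[OF is_cring mult_subset_axioms.intro]) (use one M.I_prime in auto)
  let ?B = "localization R ?S"
  obtain m where m: "{J. maximalideal J ?B} = {m}" and nB: "noetherian_ring ?B"
    and cg: "c_grade ?B m (self_module ?B) = krull_dim ?B"
    using cm M unfolding cohen_macaulay_ring_def cohen_macaulay_local_def by blast
  interpret B: noetherian_local ?B m
    using m nB loc.localization_cring
    by (simp add: noetherian_local_def noetherian_cring_def noetherian_local_axioms_def)
  have Mx: "set xs \<subseteq> carrier R" using xs(1) M.a_subset by blast
  have extM: "primeideal (loc.extended M) ?B" by (rule loc.ext_prime[OF M.primeideal]) blast
  then have "\<one>\<^bsub>?B\<^esub> \<notin> loc.extended M"
    using ideal.one_imp_carrier[OF primeideal.axioms(1)[OF extM]] primeideal.I_notcarr[OF extM] by blast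
  then have extm: "loc.extended M \<subseteq> m" using B.proper_ideal_subset[OF primeideal.axioms(1)[OF extM]] by blast
  have id: "ideal (Idl\<^bsub>R\<^esub> (set xs)) R" by (rule genideal_ideal[OF Mx])
  have eI: "Idl\<^bsub>?B\<^esub> (set (map loc.\<eta> xs)) = loc.extended (Idl\<^bsub>R\<^esub> (set xs))"
    using loc.ext_eq_Idl[OF Mx] by simp
  have "length (map loc.extended ps) - 1 \<le> length (map loc.\<eta> xs)"
  proof (rule B.prime_chain_length_le_regular_sequence[OF cg])
    show "set (map loc.\<eta> xs) \<subseteq> m"
      using xs(1) extm loc.\<eta>_mem_ext_prime[OF M.primeideal] Mx by auto
    show "wreg ?B {\<zero>\<^bsub>?B\<^esub>} (map loc.\<eta> xs)"
      by (rule loc.wreg_localize[OF Mx xs(2)])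
    have "P \<subseteq> last ps" if P: "P \<in> set ps" for P
    proof -
      have "ps = butlast ps @ [last ps]" using ps(1) by (simp add: prime_chain_def)
      moreover have "sorted_wrt (\<subset>) ps" using ps(1) by (simp add: prime_chain_def)
      ultimately have "\<forall>p\<in>set (butlast ps). p \<subset> last ps"
        by (metis sorted_wrt_append list.set_intros(1))
      moreover have "P \<in> set (butlast ps) \<or> P = last ps"
        using P \<open>ps = butlast ps @ [last ps]\<close> by (metis Un_iff empty_iff empty_set set_append set_ConsD)
      ultimately show ?thesis by blast
    qed
    then show "prime_chain ?B (map loc.extended ps)"
      using ps(2) by (intro loc.ext_prime_chain[OF ps(1)]) blast
    show "loc.\<eta> a \<in> carrier ?B" by (rule loc.\<eta>_closed[OF a(1)])
    show "loc.\<eta> a \<notin> Idl\<^bsub>?B\<^esub> (set (map loc.\<eta> xs))"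
      unfolding eI using loc.\<eta>_mem_ext[OF id a(1)] a(3) by (auto simp: colon_def)
    have "last (map loc.extended ps) = loc.extended (last ps)" using ps(1) by (simp add: prime_chain_def last_map)
    also have "\<dots> \<subseteq> colon ?B (loc.extended (Idl\<^bsub>R\<^esub> (set xs))) (loc.\<eta> a)"
    proof
      fix U assume "U \<in> loc.extended (last ps)"
      then obtain x s where x: "x \<in> last ps" "s \<in> ?S" "U = loc.frac x s" unfolding loc.extended_def by blast
      have xc: "x \<in> carrier R" and xa: "x \<otimes>\<^bsub>R\<^esub> a \<in> Idl\<^bsub>R\<^esub> (set xs)" using x(1) a(2) by (auto simp: colon_def)
      have "U \<otimes>\<^bsub>?B\<^esub> loc.\<eta> a = loc.frac (x \<otimes>\<^bsub>R\<^esub> a) s"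
        using xc a(1) x(2,3) by (simp add: loc.\<eta>_def loc.frac_mult loc.S_one del: Diff_iff) simp
      then have "U \<otimes>\<^bsub>?B\<^esub> loc.\<eta> a \<in> loc.extended (Idl\<^bsub>R\<^esub> (set xs))"
        unfolding loc.extended_def using xa x(2) by blast
      then show "U \<in> colon ?B (loc.extended (Idl\<^bsub>R\<^esub> (set xs))) (loc.\<eta> a)"
        using loc.frac_in_carrier[OF xc x(2)] x(3) by (simp add: colon_def del: Diff_iff)
    qed
    finally show "last (map loc.extended ps) \<subseteq> colon ?B (Idl\<^bsub>?B\<^esub> (set (map loc.\<eta> xs))) (loc.\<eta> a)"
      unfolding eI .
  qed
  then show ?thesis by simp
qed

text \<open>A regular sequence in the top prime \<open>p\<close> of the chain that is shorter than the chain can be prolonged inside \<open>p\<close>: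
  otherwise \<open>p\<close> would kill a nonzero element modulo the sequence, which \<open>cohen_macaulay_local_at\<close> forbids at any
  maximal ideal above the annihilator of that element.\<close>

lemma cohen_macaulay_grade_ge_prime_chain:
  fixes R (structure)
  assumes cm: "cohen_macaulay_ring R" and ps: "prime_chain R ps"
  shows "grade_ge R (last ps) {\<zero>\<^bsub>R\<^esub>} (length ps - 1)"
proof -
  interpret noetherian_cring R using cm by (simp add: cohen_macaulay_ring_def noetherian_cring_def)
  let ?P = "last ps"
  have "primeideal ?P R" using ps by (simp add: prime_chain_def)
  then interpret P: primeideal ?P R .
  interpret ex: grade_exchange R ?P "\<lambda>I. ideal I R" by (rule noetherian_grade_exchange[OF P.is_ideal])
  have "grade_ge R ?P {\<zero>\<^bsub>R\<^esub>} g" if "g \<le> length ps - 1" for g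
    using that
  proof (induction g)
    case (Suc g)
    then obtain xs where xs: "set xs \<subseteq> ?P" "length xs = g" "wreg R {\<zero>\<^bsub>R\<^esub>} xs"
      by (auto simp: grade_ge_iff_wreg)
    have xc: "set xs \<subseteq> carrier R" using xs(1) P.a_subset by blast
    let ?I = "Idl (set xs)"
    have I: "ideal ?I R" by (rule genideal_ideal[OF xc])
    have Ie: "Idl ({\<zero>\<^bsub>R\<^esub>} \<union> set xs) = ?I"
      using Idl_Idl_Un[of "{}" "set xs"] xc unfolding Idl_empty by simp
    have "faithful_mod R ?P ?I"
    proof (rule ccontr)
      assume "\<not> faithful_mod R ?P ?I"
      then obtain a where a: "a \<in> carrier R" "a \<notin> ?I" "\<forall>x\<in>?P. x \<otimes> a \<in> ?I"
        unfolding faithful_mod_def by blast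
      have "\<one> \<notin> colon R ?I a" using a by (simp add: colon_def)
      then obtain M where M: "maximalideal M R" "colon R ?I a \<subseteq> M"
        using ex_maximalideal_above[OF colon_ideal[OF I a(1)]] by blast
      have Pc: "?P \<subseteq> colon R ?I a" using a(3) P.a_subset by (auto simp: colon_def)
      have "length ps - 1 \<le> length xs"
        by (rule cohen_macaulay_local_at[OF cm M(1) ps _ _ xs(3) a(1) Pc M(2)]) (use Pc M(2) xs(1) in blast)+
      then show False using xs(2) Suc.prems by simp
    qed
    then obtain x where x: "x \<in> ?P" "nzd_mod R ?I x" using ex.common_nzd[OF I I I] by blast
    have "wreg R {\<zero>\<^bsub>R\<^esub>} (xs @ [x])" using wreg_append_one[OF zeroideal xc] xs(3) x(2) Ie by simp
    moreover have "set (xs @ [x]) \<subseteq> ?P" "length (xs @ [x]) = Suc g" using xs x by auto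
    ultimately show ?case unfolding grade_ge_iff_wreg by blast
  qed simp
  then show ?thesis by blast
qed

section \<open>Polynomial rings over a set of variables\<close>

text \<open>The construction of \<open>poly_ring\<close> for an arbitrary set of variables. Infinitely many variables make room
  for a fresh one at every step, within a single ring.\<close>

definition mpoly :: "('a, 'm) ring_scheme \<Rightarrow> nat set \<Rightarrow> (nat multiset \<Rightarrow> 'a) ring" where
  "mpoly R V =
     \<lparr>carrier = ring.indexed_pset R V (carrier R),
      monoid.mult = (\<lambda>f g u. \<Oplus>\<^bsub>R\<^esub>v\<in>{v. v \<subseteq># u}. f v \<otimes>\<^bsub>R\<^esub> g (u - v)),
      one = ring.indexed_const R \<one>\<^bsub>R\<^esub>, ring.zero = ring.indexed_const R \<zero>\<^bsub>R\<^esub>,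
      add = ring.indexed_padd R\<rparr>"

lemma poly_ring_eq_mpoly: "poly_ring R m = mpoly R {..<m}"
  by (simp add: Defs.poly_ring_def mpoly_def)

definition mon :: "('a, 'm) ring_scheme \<Rightarrow> 'a \<Rightarrow> nat multiset \<Rightarrow> nat multiset \<Rightarrow> 'a" where
  "mon R c u = (\<lambda>w. if w = u then c else \<zero>\<^bsub>R\<^esub>)"

lemma finite_submultisets: "finite {v. v \<subseteq># (u :: 'b multiset)}"
proof (induction u)
  case (add x u)
  have "v \<in> {v. v \<subseteq># u} \<union> add_mset x ` {v. v \<subseteq># u}" if v: "v \<subseteq># add_mset x u" for v
  proof (cases "x \<in># v")
    case True
    then obtain v' where "v = add_mset x v'" by (metis insert_DiffM)
    then show ?thesis using v by simp
  next
    case False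
    then have "v - {#x#} = v" by (rule diff_single_trivial)
    moreover have "v - {#x#} \<subseteq># u" using v by (simp add: subset_eq_diff_conv)
    ultimately show ?thesis by simp
  qed
  then have "{v. v \<subseteq># add_mset x u} \<subseteq> {v. v \<subseteq># u} \<union> add_mset x ` {v. v \<subseteq># u}" by blast
  then show ?case using add finite_subset by blast
qed simp

locale mpolys = cring R for R (structure) +
  fixes V :: "nat set"
begin

abbreviation T where "T \<equiv> mpoly R V"

lemma T_zero: "\<zero>\<^bsub>T\<^esub> = (\<lambda>u. \<zero>)" by (simp add: mpoly_def indexed_zero_def)
lemma indexed_const_eq_mon: "indexed_const c = mon R c {#}" by (simp add: indexed_const_def mon_def)
lemma T_one: "\<one>\<^bsub>T\<^esub> = mon R \<one> {#}" by (simp add: mpoly_def indexed_const_eq_mon)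
lemma T_add: "f \<oplus>\<^bsub>T\<^esub> g = (\<lambda>u. f u \<oplus> g u)" by (simp add: mpoly_def indexed_padd_def)
lemma T_mult: "(f \<otimes>\<^bsub>T\<^esub> g) u = (\<Oplus>v\<in>{v. v \<subseteq># u}. f v \<otimes> g (u - v))" by (simp add: mpoly_def)

lemma mon_in_pset: "c \<in> carrier R \<Longrightarrow> set_mset u \<subseteq> V \<Longrightarrow> mon R c u \<in> indexed_pset V (carrier R)"
proof (induction u)
  case empty
  then show ?case using indexed_pset.indexed_const by (simp add: indexed_const_eq_mon[symmetric])
next
  case (add i u)
  have "mon R c (add_mset i u) = indexed_pmult (mon R c u) i"
  proof
    fix w
    show "mon R c (add_mset i u) w = indexed_pmult (mon R c u) i w"
      by (cases "i \<in># w") (auto simp: mon_def indexed_pmult_def dest!: multi_member_split)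
  qed
  then show ?case using add indexed_pset.indexed_pmult by auto
qed

lemma T_carrier:
  "f \<in> carrier T \<longleftrightarrow> (\<forall>u. f u \<in> carrier R) \<and> finite {u. f u \<noteq> \<zero>} \<and> (\<forall>u. f u \<noteq> \<zero> \<longrightarrow> set_mset u \<subseteq> V)"
proof
  assume "f \<in> carrier T"
  then have "f \<in> indexed_pset V (carrier R)" by (simp add: mpoly_def)
  then show "(\<forall>u. f u \<in> carrier R) \<and> finite {u. f u \<noteq> \<zero>} \<and> (\<forall>u. f u \<noteq> \<zero> \<longrightarrow> set_mset u \<subseteq> V)"
  proof (induction rule: indexed_pset.induct)
    case (indexed_const k)
    have "{u. indexed_const k u \<noteq> \<zero>} \<subseteq> {{#}}" by (auto simp: indexed_const_def)
    then have "finite {u. indexed_const k u \<noteq> \<zero>}" by (rule finite_subset) simp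
    then show ?case using indexed_const by (auto simp: indexed_const_def)
  next
    case (indexed_padd f g)
    have "{u. indexed_padd f g u \<noteq> \<zero>} \<subseteq> {u. f u \<noteq> \<zero>} \<union> {u. g u \<noteq> \<zero>}" by (auto simp: indexed_padd_def)
    then have "finite {u. indexed_padd f g u \<noteq> \<zero>}" by (rule finite_subset) (use indexed_padd in simp)
    moreover have "set_mset u \<subseteq> V" if u: "indexed_padd f g u \<noteq> \<zero>" for u
    proof -
      have "f u \<noteq> \<zero> \<or> g u \<noteq> \<zero>" using u by (auto simp: indexed_padd_def)
      then show ?thesis using indexed_padd by blast
    qed
    ultimately show ?case using indexed_padd by (simp add: indexed_padd_def)
  next
    case (indexed_pmult f i)
    have "{u. indexed_pmult f i u \<noteq> \<zero>} \<subseteq> add_mset i ` {u. f u \<noteq> \<zero>}"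
      by (force simp: indexed_pmult_def split: if_splits)
    then have "finite {u. indexed_pmult f i u \<noteq> \<zero>}" by (rule finite_subset) (use indexed_pmult in simp)
    moreover have "set_mset u \<subseteq> V" if u: "indexed_pmult f i u \<noteq> \<zero>" for u
    proof -
      obtain u' where u': "u = add_mset i u'" "f u' \<noteq> \<zero>"
        using u by (auto simp: indexed_pmult_def dest!: multi_member_split split: if_splits)
      then show ?thesis using indexed_pmult by auto
    qed
    ultimately show ?case using indexed_pmult by (simp add: indexed_pmult_def)
  qed
next
  assume f: "(\<forall>u. f u \<in> carrier R) \<and> finite {u. f u \<noteq> \<zero>} \<and> (\<forall>u. f u \<noteq> \<zero> \<longrightarrow> set_mset u \<subseteq> V)"
  have "f \<in> indexed_pset V (carrier R)"
    if "finite F" "\<forall>u. f u \<in> carrier R" "{u. f u \<noteq> \<zero>} \<subseteq> F" "\<forall>u\<in>F. set_mset u \<subseteq> V" for F f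
    using that
  proof (induction F arbitrary: f rule: finite_induct)
    case empty
    then have "f = indexed_const \<zero>" by (auto simp: indexed_zero_def)
    then show ?case using indexed_pset.indexed_const[of \<zero> "carrier R"] by simp
  next
    case (insert v F)
    have "f = indexed_padd (f(v := \<zero>)) (mon R (f v) v)"
      using insert.prems(1) by (auto simp: indexed_padd_def mon_def)
    moreover have "f(v := \<zero>) \<in> indexed_pset V (carrier R)"
      by (rule insert.IH) (use insert in auto)
    moreover have "mon R (f v) v \<in> indexed_pset V (carrier R)" using insert by (intro mon_in_pset) auto
    ultimately show ?case using indexed_pset.indexed_padd by metis
  qed
  from this[of "{u. f u \<noteq> \<zero>}" f] show "f \<in> carrier T" using f by (simp add: mpoly_def)
qed

lemma coeff_closed: "f \<in> carrier T \<Longrightarrow> f u \<in> carrier R" using T_carrier by blast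

lemma T_carrierI:
  assumes "\<And>u. f u \<in> carrier R" "{u. f u \<noteq> \<zero>} \<subseteq> F" "finite F" "\<And>u. f u \<noteq> \<zero> \<Longrightarrow> set_mset u \<subseteq> V"
  shows "f \<in> carrier T"
  using assms finite_subset T_carrier by auto

lemma mon_closed: "c \<in> carrier R \<Longrightarrow> set_mset u \<subseteq> V \<Longrightarrow> mon R c u \<in> carrier T"
  using mon_in_pset by (simp add: mpoly_def)

lemma T_zero_closed: "\<zero>\<^bsub>T\<^esub> \<in> carrier T" by (simp add: T_carrier T_zero)

lemma T_add_closed: "f \<in> carrier T \<Longrightarrow> g \<in> carrier T \<Longrightarrow> f \<oplus>\<^bsub>T\<^esub> g \<in> carrier T"
  using indexed_pset.indexed_padd by (simp add: mpoly_def)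

text \<open>Every polynomial is a sum of monomials; zero is covered as the monomial with coefficient zero.\<close>

lemma mpoly_induct [consumes 1, case_names mon add]:
  assumes f: "f \<in> carrier T"
    and mon: "\<And>c u. c \<in> carrier R \<Longrightarrow> set_mset u \<subseteq> V \<Longrightarrow> P (mon R c u)"
    and add: "\<And>f g. f \<in> carrier T \<Longrightarrow> g \<in> carrier T \<Longrightarrow> P f \<Longrightarrow> P g \<Longrightarrow> P (f \<oplus>\<^bsub>T\<^esub> g)"
  shows "P f"
proof -
  have "P f" if "finite F" "\<forall>u. f u \<in> carrier R" "{u. f u \<noteq> \<zero>} \<subseteq> F" "\<forall>u\<in>F. set_mset u \<subseteq> V" for F f
    using that
  proof (induction F arbitrary: f rule: finite_induct)
    case empty
    then have "f = mon R \<zero> {#}" by (auto simp: mon_def)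
    then show ?case using mon[of \<zero> "{#}"] by simp
  next
    case (insert v F)
    have "f = f(v := \<zero>) \<oplus>\<^bsub>T\<^esub> mon R (f v) v"
      using insert.prems(1) by (auto simp: T_add mon_def)
    moreover have "P (f(v := \<zero>))" by (rule insert.IH) (use insert in auto)
    moreover have "f(v := \<zero>) \<in> carrier T"
      by (rule T_carrierI[of _ F]) (use insert in \<open>auto split: if_splits\<close>)
    moreover have "mon R (f v) v \<in> carrier T" "P (mon R (f v) v)"
      using insert by (auto intro!: mon_closed mon)
    ultimately show ?case using add by metis
  qed
  from this[of "{u. f u \<noteq> \<zero>}" f] show ?thesis using f by (simp add: T_carrier)
qed

lemma mon_mult_apply:
  assumes c: "c \<in> carrier R" and g: "\<And>u. g u \<in> carrier R"
  shows "(mon R c u \<otimes>\<^bsub>T\<^esub> g) w = (if u \<subseteq># w then c \<otimes> g (w - u) else \<zero>)"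
proof -
  have e: "(mon R c u \<otimes>\<^bsub>T\<^esub> g) w = (\<Oplus>v\<in>{v. v \<subseteq># w}. if u = v then c \<otimes> g (w - v) else \<zero>)"
    unfolding T_mult by (rule finsum_cong') (use c g in \<open>auto simp: mon_def\<close>)
  show ?thesis
  proof (cases "u \<subseteq># w")
    case True
    then show ?thesis
      unfolding e using finsum_singleton[of u "{v. v \<subseteq># w}" "\<lambda>v. c \<otimes> g (w - v)"] finite_submultisets[of w] c g
      by simp
  next
    case False
    then have "(\<Oplus>v\<in>{v. v \<subseteq># w}. if u = v then c \<otimes> g (w - v) else \<zero>) = (\<Oplus>v\<in>{v. v \<subseteq># w}. \<zero>)"
      by (intro finsum_cong') auto
    then show ?thesis unfolding e using False by (simp add: finsum_zero)
  qed
qed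

lemma T_l_distr_coeff:
  assumes "\<And>u. f u \<in> carrier R" "\<And>u. g u \<in> carrier R" "\<And>u. h u \<in> carrier R"
  shows "(f \<oplus>\<^bsub>T\<^esub> g) \<otimes>\<^bsub>T\<^esub> h = (f \<otimes>\<^bsub>T\<^esub> h) \<oplus>\<^bsub>T\<^esub> (g \<otimes>\<^bsub>T\<^esub> h)"
proof
  fix u
  have "((f \<oplus>\<^bsub>T\<^esub> g) \<otimes>\<^bsub>T\<^esub> h) u = (\<Oplus>v\<in>{v. v \<subseteq># u}. f v \<otimes> h (u - v) \<oplus> g v \<otimes> h (u - v))"
    unfolding T_mult by (rule finsum_cong') (use assms in \<open>auto simp: T_add l_distr\<close>)
  also have "\<dots> = ((f \<otimes>\<^bsub>T\<^esub> h) \<oplus>\<^bsub>T\<^esub> (g \<otimes>\<^bsub>T\<^esub> h)) u"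
    unfolding T_add T_mult by (rule finsum_addf) (use assms in auto)
  finally show "((f \<oplus>\<^bsub>T\<^esub> g) \<otimes>\<^bsub>T\<^esub> h) u = ((f \<otimes>\<^bsub>T\<^esub> h) \<oplus>\<^bsub>T\<^esub> (g \<otimes>\<^bsub>T\<^esub> h)) u" .
qed

lemma T_r_distr_coeff:
  assumes "\<And>u. f u \<in> carrier R" "\<And>u. g u \<in> carrier R" "\<And>u. h u \<in> carrier R"
  shows "h \<otimes>\<^bsub>T\<^esub> (f \<oplus>\<^bsub>T\<^esub> g) = (h \<otimes>\<^bsub>T\<^esub> f) \<oplus>\<^bsub>T\<^esub> (h \<otimes>\<^bsub>T\<^esub> g)"
proof
  fix u
  have "(h \<otimes>\<^bsub>T\<^esub> (f \<oplus>\<^bsub>T\<^esub> g)) u = (\<Oplus>v\<in>{v. v \<subseteq># u}. h v \<otimes> f (u - v) \<oplus> h v \<otimes> g (u - v))"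
    unfolding T_mult by (rule finsum_cong') (use assms in \<open>auto simp: T_add r_distr\<close>)
  also have "\<dots> = ((h \<otimes>\<^bsub>T\<^esub> f) \<oplus>\<^bsub>T\<^esub> (h \<otimes>\<^bsub>T\<^esub> g)) u"
    unfolding T_add T_mult by (rule finsum_addf) (use assms in auto)
  finally show "(h \<otimes>\<^bsub>T\<^esub> (f \<oplus>\<^bsub>T\<^esub> g)) u = ((h \<otimes>\<^bsub>T\<^esub> f) \<oplus>\<^bsub>T\<^esub> (h \<otimes>\<^bsub>T\<^esub> g)) u" .
qed

lemma mon_mult_mon:
  assumes "c \<in> carrier R" "d \<in> carrier R"
  shows "mon R c u \<otimes>\<^bsub>T\<^esub> mon R d v = mon R (c \<otimes> d) (u + v)"
proof
  fix w
  have "(mon R c u \<otimes>\<^bsub>T\<^esub> mon R d v) w = (if u \<subseteq># w then c \<otimes> mon R d v (w - u) else \<zero>)"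
    by (rule mon_mult_apply) (use assms in \<open>auto simp: mon_def\<close>)
  also have "\<dots> = mon R (c \<otimes> d) (u + v) w"
    using assms by (auto simp: mon_def subset_mset.le_iff_add)
  finally show "(mon R c u \<otimes>\<^bsub>T\<^esub> mon R d v) w = mon R (c \<otimes> d) (u + v) w" .
qed

lemma T_mult_closed: 
  assumes f: "f \<in> carrier T" and g: "g \<in> carrier T"
  shows "f \<otimes>\<^bsub>T\<^esub> g \<in> carrier T"
  using f
proof (induction f rule: mpoly_induct)
  case (mon c u)
  note gc = coeff_closed[OF g]
  show ?case
  proof (rule T_carrierI)
    show "(mon R c u \<otimes>\<^bsub>T\<^esub> g) w \<in> carrier R" for w using mon gc by (simp add: mon_mult_apply)
    show "{w. (mon R c u \<otimes>\<^bsub>T\<^esub> g) w \<noteq> \<zero>} \<subseteq> (\<lambda>w. u + w) ` {w. g w \<noteq> \<zero>}"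
    proof
      fix w assume "w \<in> {w. (mon R c u \<otimes>\<^bsub>T\<^esub> g) w \<noteq> \<zero>}"
      then have "u \<subseteq># w" "c \<otimes> g (w - u) \<noteq> \<zero>"
        using mon_mult_apply[of c g u w] mon(1) gc by (auto split: if_splits)
      then have "w = u + (w - u)" "g (w - u) \<noteq> \<zero>" using mon(1) by (auto)
      then show "w \<in> (\<lambda>w. u + w) ` {w. g w \<noteq> \<zero>}" by blast
    qed
    then show "set_mset w \<subseteq> V" if "(mon R c u \<otimes>\<^bsub>T\<^esub> g) w \<noteq> \<zero>" for w
      using that g mon(2) unfolding T_carrier by force
    show "finite ((\<lambda>w. u + w) ` {w. g w \<noteq> \<zero>})" using g by (simp add: T_carrier)
  qed
next
  case (add f f')
  then show ?case using T_l_distr_coeff[of f f' g] coeff_closed[of f] coeff_closed[of f'] coeff_closed[OF g] T_add_closed by simp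
qed

lemma T_l_distr:
  "f \<in> carrier T \<Longrightarrow> g \<in> carrier T \<Longrightarrow> h \<in> carrier T \<Longrightarrow>
    (f \<oplus>\<^bsub>T\<^esub> g) \<otimes>\<^bsub>T\<^esub> h = (f \<otimes>\<^bsub>T\<^esub> h) \<oplus>\<^bsub>T\<^esub> (g \<otimes>\<^bsub>T\<^esub> h)"
  by (rule T_l_distr_coeff) (auto intro: coeff_closed)

lemma T_r_distr:
  "f \<in> carrier T \<Longrightarrow> g \<in> carrier T \<Longrightarrow> h \<in> carrier T \<Longrightarrow>
    h \<otimes>\<^bsub>T\<^esub> (f \<oplus>\<^bsub>T\<^esub> g) = (h \<otimes>\<^bsub>T\<^esub> f) \<oplus>\<^bsub>T\<^esub> (h \<otimes>\<^bsub>T\<^esub> g)"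
  by (rule T_r_distr_coeff) (auto intro: coeff_closed)

lemma T_comm: "f \<in> carrier T \<Longrightarrow> g \<in> carrier T \<Longrightarrow> f \<otimes>\<^bsub>T\<^esub> g = g \<otimes>\<^bsub>T\<^esub> f"
proof (induction f rule: mpoly_induct)
  case (mon c u)
  show ?case using mon(3)
  proof (induction g rule: mpoly_induct)
    case (mon d v)
    then show ?case using \<open>c \<in> carrier R\<close> by (simp add: mon_mult_mon m_comm add.commute)
  next
    case (add g g')
    then show ?case using mon_closed[OF mon(1,2)] by (simp add: T_l_distr T_r_distr)
  qed
next
  case (add f f')
  then show ?case by (simp add: T_l_distr T_r_distr)
qed

text \<open>Since multiplication is additive in each factor, associativity need only be compared on monomials, which
  avoids rearranging sums over pairs of submultisets.\<close>

lemma T_assoc_mon: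
  assumes c: "c \<in> carrier R" and g: "g \<in> carrier T" and h: "h \<in> carrier T" and u: "set_mset u \<subseteq> V"
  shows "(mon R c u \<otimes>\<^bsub>T\<^esub> g) \<otimes>\<^bsub>T\<^esub> h = mon R c u \<otimes>\<^bsub>T\<^esub> (g \<otimes>\<^bsub>T\<^esub> h)"
  using g
proof (induction g rule: mpoly_induct)
  case (mon d v)
  note hc = coeff_closed[OF h]
  have dh: "(mon R d v \<otimes>\<^bsub>T\<^esub> h) w \<in> carrier R" for w using mon(1) hc by (simp add: mon_mult_apply)
  show ?case
  proof
    fix w
    have iff: "u + v \<subseteq># w \<longleftrightarrow> u \<subseteq># w \<and> v \<subseteq># w - u"
    proof (cases "u \<subseteq># w")
      case True
      then show ?thesis using subset_mset.le_diff_conv2[of u w v] by (simp add: add.commute)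
    next
      case False
      then show ?thesis using subset_mset.order_trans[OF mset_subset_eq_add_left[of u v], of w] by blast
    qed
    show "((mon R c u \<otimes>\<^bsub>T\<^esub> mon R d v) \<otimes>\<^bsub>T\<^esub> h) w = (mon R c u \<otimes>\<^bsub>T\<^esub> (mon R d v \<otimes>\<^bsub>T\<^esub> h)) w"
      unfolding mon_mult_mon[OF c mon(1)] using c mon(1) hc dh
      by (simp add: mon_mult_apply iff m_assoc)
  qed
next
  case (add g g')
  then show ?case using c u h by (simp add: T_l_distr T_r_distr T_mult_closed mon_closed)
qed

lemma T_assoc:
  assumes f: "f \<in> carrier T" and g: "g \<in> carrier T" and h: "h \<in> carrier T"
  shows "(f \<otimes>\<^bsub>T\<^esub> g) \<otimes>\<^bsub>T\<^esub> h = f \<otimes>\<^bsub>T\<^esub> (g \<otimes>\<^bsub>T\<^esub> h)"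
  using f
proof (induction f rule: mpoly_induct)
  case (mon c u)
  then show ?case using T_assoc_mon g h by blast
next
  case (add f f')
  then show ?case using g h by (simp add: T_l_distr T_mult_closed)
qed

lemma mpoly_cring: "cring T"
proof (rule cringI)
  show "abelian_group T"
  proof (rule abelian_groupI)
    fix f assume f: "f \<in> carrier T"
    have "(\<lambda>u. \<ominus> f u) \<in> carrier T"
    proof (rule T_carrierI)
      show "\<ominus> f u \<in> carrier R" for u using coeff_closed[OF f] by simp
      show "{u. \<ominus> f u \<noteq> \<zero>} \<subseteq> {u. f u \<noteq> \<zero>}" by auto
      show "finite {u. f u \<noteq> \<zero>}" using f by (simp add: T_carrier)
      show "set_mset u \<subseteq> V" if "\<ominus> f u \<noteq> \<zero>" for u using that f by (auto simp: T_carrier)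
    qed
    moreover have "(\<lambda>u. \<ominus> f u) \<oplus>\<^bsub>T\<^esub> f = \<zero>\<^bsub>T\<^esub>"
      using coeff_closed[OF f] by (simp add: T_add T_zero l_neg)
    ultimately show "\<exists>g\<in>carrier T. g \<oplus>\<^bsub>T\<^esub> f = \<zero>\<^bsub>T\<^esub>" by blast
  qed (simp add: T_add_closed, simp add: T_zero_closed, auto simp: T_zero T_add a_ac coeff_closed)
  show "Group.comm_monoid T"
  proof (rule comm_monoidI)
    show "\<one>\<^bsub>T\<^esub> \<in> carrier T" unfolding T_one by (rule mon_closed) auto
    show "\<one>\<^bsub>T\<^esub> \<otimes>\<^bsub>T\<^esub> f = f" if f: "f \<in> carrier T" for f
    proof
      show "(\<one>\<^bsub>T\<^esub> \<otimes>\<^bsub>T\<^esub> f) w = f w" for w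
        unfolding T_one using coeff_closed[OF f] by (simp add: mon_mult_apply)
    qed
  qed (fact T_mult_closed T_assoc T_comm)+
  show "(f \<oplus>\<^bsub>T\<^esub> g) \<otimes>\<^bsub>T\<^esub> h = f \<otimes>\<^bsub>T\<^esub> h \<oplus>\<^bsub>T\<^esub> g \<otimes>\<^bsub>T\<^esub> h"
    if "f \<in> carrier T" "g \<in> carrier T" "h \<in> carrier T" for f g h
    by (rule T_l_distr[OF that])
qed

sublocale T: cring T by (rule mpoly_cring)

abbreviation const :: "'a \<Rightarrow> nat multiset \<Rightarrow> 'a" where "const \<equiv> indexed_const"

lemma const_closed: "c \<in> carrier R \<Longrightarrow> const c \<in> carrier T"
  unfolding indexed_const_eq_mon by (rule mon_closed) auto

lemma const_mult_apply: "c \<in> carrier R \<Longrightarrow> f \<in> carrier T \<Longrightarrow> (const c \<otimes>\<^bsub>T\<^esub> f) w = c \<otimes> f w"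
  unfolding indexed_const_eq_mon using mon_mult_apply coeff_closed by simp

lemma const_hom: "const \<in> ring_hom R T"
proof (rule ring_hom_memI)
  show "const (a \<otimes> b) = const a \<otimes>\<^bsub>T\<^esub> const b" if "a \<in> carrier R" "b \<in> carrier R" for a b
    using that by (simp add: indexed_const_eq_mon mon_mult_mon)
qed (simp add: const_closed, auto simp: T_add T_one indexed_const_eq_mon mon_def)

lemma mon_eq_const_mult:
  "c \<in> carrier R \<Longrightarrow> mon R c u = const c \<otimes>\<^bsub>T\<^esub> mon R \<one> u"
  by (simp add: indexed_const_eq_mon mon_mult_mon)

lemma coeff_ideal:
  assumes I: "ideal I R"
  shows "ideal {f \<in> carrier T. \<forall>u. f u \<in> I} T"
proof (rule T.idealI_cring)
  interpret I: ideal I R by fact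
  let ?K = "{f \<in> carrier T. \<forall>u. f u \<in> I}"
  show "h \<otimes>\<^bsub>T\<^esub> f \<in> ?K" if f: "f \<in> ?K" and h: "h \<in> carrier T" for f h
    using h
  proof (induction h rule: mpoly_induct)
    case (mon c u)
    have "f w \<in> carrier R" for w using f coeff_closed by blast
    then have "(mon R c u \<otimes>\<^bsub>T\<^esub> f) w \<in> I" for w
      using mon(1) f I.I_l_closed[of _ c] I.zero_closed by (simp add: mon_mult_apply)
    then show ?case using f mon T_mult_closed mon_closed by auto
  next
    case (add g h)
    then show ?case using f T_l_distr[of g h f] I.a_closed
      by (simp add: T_add_closed) (simp add: T_add)
  qed
  show "f \<oplus>\<^bsub>T\<^esub> g \<in> ?K" if "f \<in> ?K" "g \<in> ?K" for f g
    using that I.a_closed by (simp add: T_add_closed) (simp add: T_add)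
  show "\<zero>\<^bsub>T\<^esub> \<in> ?K" using T_zero_closed I.zero_closed by (simp add: T_zero)
qed blast

lemma mem_Idl_const_iff:
  assumes Y: "Y \<subseteq> carrier R"
  shows "f \<in> Idl\<^bsub>T\<^esub> (const ` Y) \<longleftrightarrow> f \<in> carrier T \<and> (\<forall>u. f u \<in> Idl Y)"
proof
  have I: "ideal (Idl Y) R" by (rule genideal_ideal[OF Y])
  interpret I: ideal "Idl Y" R by (rule I)
  have "const ` Y \<subseteq> {f \<in> carrier T. \<forall>u. f u \<in> Idl Y}"
    using Y const_closed genideal_self[OF Y] I.zero_closed by (auto simp: indexed_const_def)
  then have "Idl\<^bsub>T\<^esub> (const ` Y) \<subseteq> {f \<in> carrier T. \<forall>u. f u \<in> Idl Y}"
    by (rule T.genideal_minimal[OF coeff_ideal[OF I]])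
  then show "f \<in> carrier T \<and> (\<forall>u. f u \<in> Idl Y)" if "f \<in> Idl\<^bsub>T\<^esub> (const ` Y)" using that by blast
  have cY: "const ` Y \<subseteq> carrier T" using Y const_closed by blast
  interpret K: ideal "Idl\<^bsub>T\<^esub> (const ` Y)" T by (rule T.genideal_ideal[OF cY])
  have c: "const a \<in> Idl\<^bsub>T\<^esub> (const ` Y)" if "a \<in> Idl Y" for a
    using ring_hom_Idl[OF is_cring mpoly_cring const_hom Y] that by blast
  assume "f \<in> carrier T \<and> (\<forall>u. f u \<in> Idl Y)"
  then have f: "f \<in> carrier T" "\<forall>u. f u \<in> Idl Y" by auto
  have "f \<in> Idl\<^bsub>T\<^esub> (const ` Y)"
    if "finite F" "f \<in> carrier T" "\<forall>u. f u \<in> Idl Y" "{u. f u \<noteq> \<zero>} \<subseteq> F" "\<forall>u\<in>F. set_mset u \<subseteq> V" for F f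
    using that
  proof (induction F arbitrary: f rule: finite_induct)
    case empty
    then have "f = \<zero>\<^bsub>T\<^esub>" by (auto simp: T_zero)
    then show ?case using K.zero_closed by simp
  next
    case (insert v F)
    have fc: "f u \<in> carrier R" for u using insert coeff_closed by blast
    have "f = f(v := \<zero>) \<oplus>\<^bsub>T\<^esub> mon R (f v) v" using fc by (auto simp: T_add mon_def)
    moreover have "f(v := \<zero>) \<in> Idl\<^bsub>T\<^esub> (const ` Y)"
    proof (rule insert.IH)
      show "f(v := \<zero>) \<in> carrier T"
        by (rule T_carrierI[of _ F]) (use insert fc in \<open>auto split: if_splits\<close>)
    qed (use insert I.zero_closed in auto)
    moreover have "mon R (f v) v \<in> Idl\<^bsub>T\<^esub> (const ` Y)"
      unfolding mon_eq_const_mult[OF fc]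
      by (rule K.I_r_closed[OF c mon_closed]) (use insert in auto)
    ultimately show ?case using K.a_closed by metis
  qed
  from this[of "{u. f u \<noteq> \<zero>}" f] show "f \<in> Idl\<^bsub>T\<^esub> (const ` Y)" using f by (simp add: T_carrier)
qed

lemma const_mem_Idl: "Y \<subseteq> carrier R \<Longrightarrow> c \<in> Idl Y \<Longrightarrow> const c \<in> Idl\<^bsub>T\<^esub> (const ` Y)"
  using ring_hom_Idl[OF is_cring mpoly_cring const_hom] by blast

text \<open>\<open>R[t]\<close> is free over \<open>R\<close>: divisibility by a constant is tested on coefficients.\<close>

lemma nzd_mod_const:
  assumes Y: "Y \<subseteq> carrier R" and x: "x \<in> carrier R" and nz: "nzd_mod R (Idl Y) x"
  shows "nzd_mod T (Idl\<^bsub>T\<^esub> (const ` Y)) (const x)"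
  unfolding nzd_mod_def
proof (intro ballI impI)
  fix f assume f: "f \<in> carrier T" and h: "const x \<otimes>\<^bsub>T\<^esub> f \<in> Idl\<^bsub>T\<^esub> (const ` Y)"
  then have "x \<otimes> f u \<in> Idl Y" for u
    using mem_Idl_const_iff[OF Y] const_mult_apply[OF x f] by metis
  then show "f \<in> Idl\<^bsub>T\<^esub> (const ` Y)"
    using f mem_Idl_const_iff[OF Y] nzd_modD[OF nz coeff_closed[OF f]] by blast
qed

lemma wreg_const:
  assumes "set xs \<subseteq> carrier R" "wreg R {\<zero>} xs"
  shows "wreg T {\<zero>\<^bsub>T\<^esub>} (map const xs)"
  by (rule wreg_map[OF is_cring mpoly_cring subset_refl _ nzd_mod_const assms]) (use const_closed in blast)

end

section \<open>Generic elements\<close>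

text \<open>The coefficient of degree \<open>i\<close> in the product of \<open>c\<^sub>0 + c\<^sub>1 t + \<dots>\<close> with \<open>b\<^sub>0 + b\<^sub>1 t + \<dots>\<close>.\<close>

fun conv :: "('a, 'm) ring_scheme \<Rightarrow> 'a list \<Rightarrow> (nat \<Rightarrow> 'a) \<Rightarrow> nat \<Rightarrow> 'a" where
  "conv R [] b i = \<zero>\<^bsub>R\<^esub>"
| "conv R (c # cs) b 0 = c \<otimes>\<^bsub>R\<^esub> b 0"
| "conv R (c # cs) b (Suc i) = c \<otimes>\<^bsub>R\<^esub> b (Suc i) \<oplus>\<^bsub>R\<^esub> conv R cs b i"

context cring
begin

lemma conv_closed:
  "set cs \<subseteq> carrier R \<Longrightarrow> (\<And>i. b i \<in> carrier R) \<Longrightarrow> conv R cs b i \<in> carrier R"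
proof (induction cs arbitrary: i)
  case (Cons c cs)
  then show ?case by (cases i) auto
qed simp

lemma conv_in_ideal:
  assumes I: "ideal I R"
  shows "set cs \<subseteq> carrier R \<Longrightarrow> (\<And>c i. c \<in> set cs \<Longrightarrow> c \<otimes> b i \<in> I) \<Longrightarrow> conv R cs b i \<in> I"
proof (induction cs arbitrary: i)
  case Nil
  then show ?case using additive_subgroup.zero_closed[OF ideal.axioms(1)[OF I]] by simp
next
  case (Cons c cs)
  show ?case
    by (cases i) (use Cons additive_subgroup.a_closed[OF ideal.axioms(1)[OF I]] in auto)
qed

lemma conv_scale:
  assumes "e \<in> carrier R" "set cs \<subseteq> carrier R" "\<And>i. b i \<in> carrier R"
  shows "conv R cs (\<lambda>i. e \<otimes> b i) i = e \<otimes> conv R cs b i"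
  using assms(2)
proof (induction cs arbitrary: i)
  case (Cons c cs)
  then show ?case using assms(1,3) conv_closed[OF _ assms(3), of cs]
    by (cases i) (auto simp: m_lcomm r_distr)
qed (use assms in simp)

text \<open>In degree \<open>length us + d\<close> the product contains \<open>c b\<^sub>d\<close>; the other terms involve either a coefficient \<open>b\<^sub>i\<close> with
  \<open>i > d\<close> or a coefficient from \<open>vs\<close>, so they lie in \<open>I\<close>.\<close>

lemma conv_top_term:
  assumes I: "ideal I R" and b: "\<And>i. b i \<in> carrier R"
    and cs: "set us \<subseteq> carrier R" "c \<in> carrier R" "set vs \<subseteq> carrier R"
    and hi: "\<And>i. i > d \<Longrightarrow> b i \<in> I" and vs: "\<And>v i. v \<in> set vs \<Longrightarrow> v \<otimes> b i \<in> I"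
    and h: "conv R (us @ c # vs) b (length us + d) \<in> I"
  shows "c \<otimes> b d \<in> I"
proof -
  interpret I: ideal I R by fact
  show ?thesis using cs(1) h
  proof (induction us)
    case Nil
    show ?case
    proof (cases d)
      case 0
      then show ?thesis using Nil by simp
    next
      case (Suc d')
      have v: "conv R vs b d' \<in> I" by (rule conv_in_ideal[OF I cs(3) vs])
      have "conv R vs b d' \<oplus> c \<otimes> b d \<in> I"
        using Nil(2) Suc a_comm[of "c \<otimes> b d" "conv R vs b d'"] cs(2) b conv_closed[OF cs(3) b] by simp
      then show ?thesis using ideal_add_left_cancel[OF I v] cs(2) b by simp
    qed
  next
    case (Cons u us)
    have "u \<otimes> b (Suc (length us + d)) \<in> I" using Cons.prems(1) hi by (intro I.I_l_closed) auto
    moreover have "conv R (us @ c # vs) b (length us + d) \<in> carrier R"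
      using Cons.prems(1) cs by (intro conv_closed b) auto
    ultimately have "conv R (us @ c # vs) b (length us + d) \<in> I"
      using Cons.prems(2) ideal_add_left_cancel[OF I] by simp
    then show ?case using Cons.IH Cons.prems(1) by simp
  qed
qed

text \<open>McCoy's theorem modulo \<open>I\<close>, by induction on the number \<open>d\<close> of possibly nonzero coefficients \<open>b\<^sub>i\<close>. Working down
  from the last coefficient \<open>c\<close> of the first factor, \<open>c b\<^sub>d\<close> vanishes, so \<open>c b\<close> has fewer coefficients and vanishes by
  induction. Thus all \<open>c b\<^sub>i\<close> vanish, and faithfulness applies.\<close>

lemma mccoy:
  assumes I: "ideal I R" and cs: "set cs \<subseteq> carrier R" and f: "faithful_mod R (set cs) I"
    and "\<And>i. b i \<in> carrier R" "\<And>i. i \<ge> d \<Longrightarrow> b i \<in> I" "\<And>i. conv R cs b i \<in> I"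
  shows "b i \<in> I"
  using assms(4-6)
proof (induction d arbitrary: b i)
  case (Suc d)
  interpret I: ideal I R by fact
  have "\<forall>c\<in>set vs. \<forall>i. c \<otimes> b i \<in> I" if "cs = us @ vs" for us vs
    using that
  proof (induction vs arbitrary: us)
    case (Cons c vs)
    have vs: "v \<otimes> b i \<in> I" if "v \<in> set vs" for v i
      using Cons.IH[of "us @ [c]"] Cons.prems that by simp
    have c: "c \<in> carrier R" and cc: "set us \<subseteq> carrier R" "set vs \<subseteq> carrier R" using cs Cons.prems by auto
    have "c \<otimes> b d \<in> I"
      by (rule conv_top_term[OF I Suc.prems(1) cc(1) c cc(2) _ vs])
        (use Suc.prems(2,3) Cons.prems in auto)
    then have hi: "c \<otimes> b i \<in> I" if "i \<ge> d" for i
      using that Suc.prems(2)[of i] I.I_l_closed[OF _ c] by (cases "i = d") auto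
    have "c \<otimes> b i \<in> I" for i
    proof (rule Suc.IH)
      show "c \<otimes> b i \<in> carrier R" for i using c Suc.prems(1) by simp
      show "conv R cs (\<lambda>i. c \<otimes> b i) i \<in> I" for i
        unfolding conv_scale[OF c cs Suc.prems(1)] by (rule I.I_l_closed[OF Suc.prems(3) c])
    qed (rule hi)
    then show ?case using vs by simp
  qed simp
  from this[of "[]" cs] show ?case using f Suc.prems(1) unfolding faithful_mod_def by simp
qed simp

lemma faithful_mod_Idl:
  assumes I: "ideal I R" and Y: "Y \<subseteq> carrier R"
  shows "faithful_mod R (Idl Y) I \<longleftrightarrow> faithful_mod R Y I"
proof -
  have "(\<forall>x\<in>Idl Y. x \<otimes> y \<in> I) \<longleftrightarrow> (\<forall>x\<in>Y. x \<otimes> y \<in> I)" if y: "y \<in> carrier R" for y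
  proof
    assume "\<forall>x\<in>Y. x \<otimes> y \<in> I"
    then have "Y \<subseteq> colon R I y" using Y by (auto simp: colon_def)
    then have "Idl Y \<subseteq> colon R I y" by (rule genideal_minimal[OF colon_ideal[OF I y]])
    then show "\<forall>x\<in>Idl Y. x \<otimes> y \<in> I" by (auto simp: colon_def)
  qed (use genideal_self[OF Y] in blast)
  then show ?thesis unfolding faithful_mod_def by blast
qed

end

context mpolys
begin

definition free_of :: "nat \<Rightarrow> (nat multiset \<Rightarrow> 'a) \<Rightarrow> bool" where
  "free_of t f \<longleftrightarrow> (\<forall>u. t \<in># u \<longrightarrow> f u = \<zero>)"

text \<open>The coefficient of \<open>t\<^sup>i\<close> in \<open>g\<close>, a polynomial in the other variables.\<close>

definition var_coeff :: "nat \<Rightarrow> nat \<Rightarrow> (nat multiset \<Rightarrow> 'a) \<Rightarrow> nat multiset \<Rightarrow> 'a" where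
  "var_coeff t i g = (\<lambda>u. if t \<in># u then \<zero> else g (u + replicate_mset i t))"

lemma var_coeff_closed:
  assumes g: "g \<in> carrier T"
  shows "var_coeff t i g \<in> carrier T"
proof (rule T_carrierI)
  show "var_coeff t i g u \<in> carrier R" for u using coeff_closed[OF g] by (simp add: var_coeff_def)
  show "{u. var_coeff t i g u \<noteq> \<zero>} \<subseteq> (\<lambda>u. u - replicate_mset i t) ` {u. g u \<noteq> \<zero>}"
  proof
    fix u assume "u \<in> {u. var_coeff t i g u \<noteq> \<zero>}"
    then have "g (u + replicate_mset i t) \<noteq> \<zero>" by (auto simp: var_coeff_def split: if_splits)
    then show "u \<in> (\<lambda>u. u - replicate_mset i t) ` {u. g u \<noteq> \<zero>}"
      by (intro image_eqI[of _ _ "u + replicate_mset i t"]) auto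
  qed
  show "finite ((\<lambda>u. u - replicate_mset i t) ` {u. g u \<noteq> \<zero>})" using g by (simp add: T_carrier)
  show "set_mset u \<subseteq> V" if "var_coeff t i g u \<noteq> \<zero>" for u
  proof -
    have "g (u + replicate_mset i t) \<noteq> \<zero>" using that by (auto simp: var_coeff_def split: if_splits)
    then have "set_mset (u + replicate_mset i t) \<subseteq> V" using g unfolding T_carrier by blast
    then show ?thesis by simp
  qed
qed

lemma var_coeff_add: "var_coeff t i (f \<oplus>\<^bsub>T\<^esub> g) = var_coeff t i f \<oplus>\<^bsub>T\<^esub> var_coeff t i g"
  by (auto simp: var_coeff_def T_add)

lemma var_coeff_free_mult:
  assumes h: "h \<in> carrier T" and hf: "free_of t h" and g: "g \<in> carrier T"
  shows "var_coeff t i (h \<otimes>\<^bsub>T\<^esub> g) = h \<otimes>\<^bsub>T\<^esub> var_coeff t i g"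
proof -
  interpret T': mpolys R "V - {t}" ..
  have sub: "carrier T'.T \<subseteq> carrier T"
  proof
    fix f assume "f \<in> carrier T'.T"
    then show "f \<in> carrier T" unfolding T_carrier T'.T_carrier by blast
  qed
  have "h \<in> carrier T'.T" using h hf by (auto simp: T_carrier T'.T_carrier free_of_def)
  then show ?thesis
  proof (induction h rule: T'.mpoly_induct)
    case (mon c u)
    have tu: "t \<notin># u" using mon by auto
    have gc: "g w \<in> carrier R" "var_coeff t i g w \<in> carrier R" for w using coeff_closed g var_coeff_closed by auto
    show ?case
    proof
      fix w
      show "var_coeff t i (mon R c u \<otimes>\<^bsub>T\<^esub> g) w = (mon R c u \<otimes>\<^bsub>T\<^esub> var_coeff t i g) w"
      proof (cases "t \<in># w")
        case True
        have "t \<in># w - u" using True tu by (simp add: in_diff_count not_in_iff)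
        then show ?thesis
          using True mon(1) gc mon_mult_apply[OF mon(1), of "var_coeff t i g" u w] by (simp add: var_coeff_def)
      next
        case False
        \<comment> \<open>The monomial \<open>u\<close> does not involve \<open>t\<close>, so powers of \<open>t\<close> do not affect divisibility by \<open>u\<close>.\<close>
        have 1: "u \<subseteq># w + replicate_mset i t \<longleftrightarrow> u \<subseteq># w"
        proof
          assume h: "u \<subseteq># w + replicate_mset i t"
          show "u \<subseteq># w"
            unfolding subseteq_mset_def
          proof
            fix x show "count u x \<le> count w x"
              using h tu unfolding subseteq_mset_def by (cases "x = t") (auto simp: not_in_iff dest: spec[of _ x])
          qed
        qed (simp add: subset_mset.add_increasing2)
        have 2: "w + replicate_mset i t - u = (w - u) + replicate_mset i t" if "u \<subseteq># w"
          using that by (simp add: subset_mset.add_diff_assoc2 add.commute)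
        have 3: "t \<notin># w - u" using False by (meson in_diffD)
        have "var_coeff t i (mon R c u \<otimes>\<^bsub>T\<^esub> g) w = (mon R c u \<otimes>\<^bsub>T\<^esub> g) (w + replicate_mset i t)"
          using False by (simp add: var_coeff_def)
        also have "\<dots> = (if u \<subseteq># w + replicate_mset i t then c \<otimes> g (w + replicate_mset i t - u) else \<zero>)"
          by (rule mon_mult_apply[OF mon(1) gc(1)])
        also have "\<dots> = (if u \<subseteq># w then c \<otimes> var_coeff t i g (w - u) else \<zero>)"
          using 1 2 3 by (simp add: var_coeff_def)
        also have "\<dots> = (mon R c u \<otimes>\<^bsub>T\<^esub> var_coeff t i g) w"
          by (rule mon_mult_apply[OF mon(1) gc(2), symmetric])
        finally show ?thesis .
      qed
    qed
  next
    case (add f f')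
    have "f \<in> carrier T" "f' \<in> carrier T" using add sub by auto
    moreover have "f \<oplus>\<^bsub>T'.T\<^esub> f' = f \<oplus>\<^bsub>T\<^esub> f'" by (simp add: T_add T'.T_add)
    ultimately show ?case using add g var_coeff_closed by (simp add: T_l_distr var_coeff_add)
  qed
qed

definition var where "var t = mon R \<one> {#t#}"

lemma var_closed: "t \<in> V \<Longrightarrow> var t \<in> carrier T"
  unfolding var_def by (rule mon_closed) auto

lemma var_mult_apply:
  "f \<in> carrier T \<Longrightarrow> (var t \<otimes>\<^bsub>T\<^esub> f) w = (if t \<in># w then f (w - {#t#}) else \<zero>)"
  unfolding var_def using mon_mult_apply[of \<one> f "{#t#}" w] coeff_closed[of f] by simp

lemma var_coeff_var_mult_0: "f \<in> carrier T \<Longrightarrow> var_coeff t 0 (var t \<otimes>\<^bsub>T\<^esub> f) = \<zero>\<^bsub>T\<^esub>"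
  by (auto simp: var_coeff_def var_mult_apply T_zero)

lemma var_coeff_var_mult_Suc: "f \<in> carrier T \<Longrightarrow> var_coeff t (Suc i) (var t \<otimes>\<^bsub>T\<^esub> f) = var_coeff t i f"
  by (auto simp: var_coeff_def var_mult_apply)

lemma degree_in_var_bounded:
  assumes g: "g \<in> carrier T"
  shows "\<exists>n. \<forall>u. count u t \<ge> n \<longrightarrow> g u = \<zero>"
proof -
  let ?C = "(\<lambda>u. count u t) ` {u. g u \<noteq> \<zero>}"
  have "finite ?C" using g by (simp add: T_carrier)
  then obtain n where "\<forall>c\<in>?C. c < n" using finite_nat_set_iff_bounded by blast
  then show ?thesis by (intro exI[of _ n]) (auto simp: not_less[symmetric])
qed

lemma mem_ideal_if_var_coeffs:
  assumes I: "ideal I T" and t: "t \<in> V" and g: "g \<in> carrier T" and h: "\<And>i. var_coeff t i g \<in> I"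
  shows "g \<in> I"
proof -
  interpret I: ideal I T by fact
  have "g \<in> I" if "g \<in> carrier T" "\<And>i. var_coeff t i g \<in> I" "\<forall>u. count u t \<ge> n \<longrightarrow> g u = \<zero>" for n g
    using that
  proof (induction n arbitrary: g)
    case 0
    then have "g = \<zero>\<^bsub>T\<^esub>" by (auto simp: T_zero)
    then show ?case using I.zero_closed by simp
  next
    case (Suc n)
    let ?s = "\<lambda>u. g (add_mset t u)"
    have s: "?s \<in> carrier T"
    proof (rule T_carrierI)
      show "g (add_mset t u) \<in> carrier R" for u using coeff_closed Suc by blast
      show "{u. g (add_mset t u) \<noteq> \<zero>} \<subseteq> (\<lambda>u. u - {#t#}) ` {u. g u \<noteq> \<zero>}"
        by (rule subsetI, rule image_eqI[where x = "add_mset t _"]) auto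
      show "finite ((\<lambda>u. u - {#t#}) ` {u. g u \<noteq> \<zero>})" using Suc.prems(1) by (simp add: T_carrier)
      show "set_mset u \<subseteq> V" if "g (add_mset t u) \<noteq> \<zero>" for u
        using that Suc.prems(1) unfolding T_carrier by fastforce
    qed
    have "var_coeff t i ?s = var_coeff t (Suc i) g" for i unfolding var_coeff_def by (rule ext) simp
    then have "var_coeff t i ?s \<in> I" for i using Suc.prems(2)[of "Suc i"] by simp
    moreover have "\<forall>u. count u t \<ge> n \<longrightarrow> g (add_mset t u) = \<zero>" using Suc.prems(3) by simp
    ultimately have "?s \<in> I" using Suc.IH[OF s] by blast
    then have "var t \<otimes>\<^bsub>T\<^esub> ?s \<in> I" using I.I_l_closed var_closed[OF t] by blast
    moreover have "g = var_coeff t 0 g \<oplus>\<^bsub>T\<^esub> var t \<otimes>\<^bsub>T\<^esub> ?s"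
      using coeff_closed[OF Suc.prems(1)] by (auto simp: var_coeff_def T_add var_mult_apply[OF s])
    ultimately show ?case using Suc.prems(2)[of 0] I.a_closed by metis
  qed
  then show ?thesis using degree_in_var_bounded[OF g, of t] g h by blast
qed

text \<open>Taking the coefficient of \<open>t\<^sup>i\<close> is linear over the polynomials free of \<open>t\<close>. The ideal \<open>?K\<close> quantifies over all
  multiples so that it is closed under multiplication by polynomials involving \<open>t\<close>.\<close>

lemma var_coeff_mem_ideal:
  assumes Y: "Y \<subseteq> carrier T" and Yf: "\<And>y. y \<in> Y \<Longrightarrow> free_of t y" and g: "g \<in> Idl\<^bsub>T\<^esub> Y"
  shows "var_coeff t i g \<in> Idl\<^bsub>T\<^esub> Y"
proof -
  have IY: "ideal (Idl\<^bsub>T\<^esub> Y) T" by (rule T.genideal_ideal[OF Y])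
  interpret I: ideal "Idl\<^bsub>T\<^esub> Y" T by (rule IY)
  let ?K = "{g \<in> carrier T. \<forall>h\<in>carrier T. \<forall>i. var_coeff t i (h \<otimes>\<^bsub>T\<^esub> g) \<in> Idl\<^bsub>T\<^esub> Y}"
  have "ideal ?K T"
  proof (rule T.idealI_cring)
    have "var_coeff t i \<zero>\<^bsub>T\<^esub> = \<zero>\<^bsub>T\<^esub>" for i by (auto simp: var_coeff_def T_zero)
    then show "\<zero>\<^bsub>T\<^esub> \<in> ?K" using I.zero_closed by simp
    show "h \<otimes>\<^bsub>T\<^esub> f \<in> ?K" if "f \<in> ?K" "h \<in> carrier T" for f h
      using that T.m_assoc[symmetric] by auto
  qed (auto simp: T.r_distr var_coeff_add I.a_closed)
  moreover have "Y \<subseteq> ?K"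
  proof
    fix y assume y: "y \<in> Y"
    have "var_coeff t i (h \<otimes>\<^bsub>T\<^esub> y) \<in> Idl\<^bsub>T\<^esub> Y" if h: "h \<in> carrier T" for h i
    proof -
      have yc: "y \<in> carrier T" using y Y by blast
      have "var_coeff t i (h \<otimes>\<^bsub>T\<^esub> y) = y \<otimes>\<^bsub>T\<^esub> var_coeff t i h"
        using var_coeff_free_mult[OF yc Yf[OF y] h, of i] T.m_comm[OF yc h] by simp
      then show ?thesis using I.I_r_closed[OF _ var_coeff_closed[OF h]] T.genideal_self[OF Y] y by auto
    qed
    then show "y \<in> ?K" using y Y by blast
  qed
  ultimately have "Idl\<^bsub>T\<^esub> Y \<subseteq> ?K" by (rule T.genideal_minimal)
  then have "g \<in> ?K" using g by blast
  then have "var_coeff t i (\<one>\<^bsub>T\<^esub> \<otimes>\<^bsub>T\<^esub> g) \<in> Idl\<^bsub>T\<^esub> Y" by blast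
  then show ?thesis using \<open>g \<in> ?K\<close> by simp
qed

text \<open>The polynomial \<open>c\<^sub>0 + c\<^sub>1 t + \<dots> + c\<^sub>k t\<^sup>k\<close>, a generic element of the ideal generated by the constants \<open>c\<^sub>j\<close>.\<close>

fun generic :: "nat \<Rightarrow> 'a list \<Rightarrow> nat multiset \<Rightarrow> 'a" where
  "generic t [] = \<zero>\<^bsub>T\<^esub>"
| "generic t (c # cs) = const c \<oplus>\<^bsub>T\<^esub> var t \<otimes>\<^bsub>T\<^esub> generic t cs"

lemma generic_closed: "t \<in> V \<Longrightarrow> set cs \<subseteq> carrier R \<Longrightarrow> generic t cs \<in> carrier T"
  by (induction cs) (auto simp: const_closed var_closed)

lemma generic_free_of:
  assumes "t \<in> V" "t' \<noteq> t"
  shows "set cs \<subseteq> carrier R \<Longrightarrow> free_of t' (generic t cs)"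
proof (induction cs)
  case (Cons c cs)
  then have "generic t cs \<in> carrier T" using generic_closed assms by simp
  moreover have "t' \<in># u - {#t#}" if "t' \<in># u" for u using that assms(2) by (simp add: in_diff_count)
  moreover have "generic t cs w = \<zero>" if "t' \<in># w" for w using Cons that by (simp add: free_of_def)
  ultimately show ?case by (auto simp: free_of_def T_add var_mult_apply indexed_const_def)
qed (simp add: free_of_def T_zero)

lemma var_coeff_generic_mult:
  assumes t: "t \<in> V" and g: "g \<in> carrier T"
  shows "set cs \<subseteq> carrier R \<Longrightarrow> var_coeff t i (generic t cs \<otimes>\<^bsub>T\<^esub> g) = conv T (map const cs) (\<lambda>i. var_coeff t i g) i"
proof (induction cs arbitrary: i)
  case Nil
  have "var_coeff t i \<zero>\<^bsub>T\<^esub> = \<zero>\<^bsub>T\<^esub>" by (auto simp: var_coeff_def T_zero)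
  then show ?case using g by simp
next
  case (Cons c cs)
  have c: "c \<in> carrier R" and cs: "set cs \<subseteq> carrier R" using Cons.prems by auto
  have gc: "generic t cs \<in> carrier T" by (rule generic_closed[OF t cs])
  have "generic t (c # cs) \<otimes>\<^bsub>T\<^esub> g = const c \<otimes>\<^bsub>T\<^esub> g \<oplus>\<^bsub>T\<^esub> var t \<otimes>\<^bsub>T\<^esub> (generic t cs \<otimes>\<^bsub>T\<^esub> g)"
    using const_closed[OF c] var_closed[OF t] gc g by (simp add: T.l_distr T.m_assoc)
  then have "var_coeff t i (generic t (c # cs) \<otimes>\<^bsub>T\<^esub> g)
      = var_coeff t i (const c \<otimes>\<^bsub>T\<^esub> g) \<oplus>\<^bsub>T\<^esub> var_coeff t i (var t \<otimes>\<^bsub>T\<^esub> (generic t cs \<otimes>\<^bsub>T\<^esub> g))"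
    by (simp add: var_coeff_add)
  moreover have "var_coeff t i (const c \<otimes>\<^bsub>T\<^esub> g) = const c \<otimes>\<^bsub>T\<^esub> var_coeff t i g"
    by (rule var_coeff_free_mult[OF const_closed[OF c] _ g]) (auto simp: free_of_def indexed_const_def)
  ultimately show ?case
    using Cons.IH[OF cs] var_coeff_var_mult_0[of "generic t cs \<otimes>\<^bsub>T\<^esub> g" t] var_coeff_var_mult_Suc[of "generic t cs \<otimes>\<^bsub>T\<^esub> g" t]
      gc g const_closed[OF c] var_coeff_closed[OF g]
    by (cases i) auto
qed

text \<open>The coefficients of a product with \<open>generic t cs\<close> with respect to a variable \<open>t\<close> that does not occur in \<open>Y\<close> are
  convolutions, so this is McCoy's theorem.\<close>

lemma nzd_mod_generic:
  assumes t: "t \<in> V" and Y: "Y \<subseteq> carrier T" "\<And>y. y \<in> Y \<Longrightarrow> free_of t y"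
    and cs: "set cs \<subseteq> carrier R" and f: "faithful_mod T (const ` set cs) (Idl\<^bsub>T\<^esub> Y)"
  shows "nzd_mod T (Idl\<^bsub>T\<^esub> Y) (generic t cs)"
  unfolding nzd_mod_def
proof (intro ballI impI)
  fix g assume g: "g \<in> carrier T" and h: "generic t cs \<otimes>\<^bsub>T\<^esub> g \<in> Idl\<^bsub>T\<^esub> Y"
  have IY: "ideal (Idl\<^bsub>T\<^esub> Y) T" by (rule T.genideal_ideal[OF Y(1)])
  have cc: "set (map const cs) \<subseteq> carrier T" using cs const_closed by auto
  have ff: "faithful_mod T (set (map const cs)) (Idl\<^bsub>T\<^esub> Y)" using f by simp
  obtain n where n: "\<And>u. count u t \<ge> n \<Longrightarrow> g u = \<zero>" using degree_in_var_bounded[OF g, of t] by blast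
  have "var_coeff t i g = \<zero>\<^bsub>T\<^esub>" if "i \<ge> n" for i using n that by (auto simp: var_coeff_def T_zero)
  then have hi: "var_coeff t i g \<in> Idl\<^bsub>T\<^esub> Y" if "i \<ge> n" for i
    using that additive_subgroup.zero_closed[OF ideal.axioms(1)[OF IY]] by simp
  have "conv T (map const cs) (\<lambda>i. var_coeff t i g) i \<in> Idl\<^bsub>T\<^esub> Y" for i
    using var_coeff_mem_ideal[OF Y h] var_coeff_generic_mult[OF t g cs] by simp
  then have "var_coeff t i g \<in> Idl\<^bsub>T\<^esub> Y" for i
    using T.mccoy[OF IY cc ff, of "\<lambda>i. var_coeff t i g" n i] var_coeff_closed[OF g] hi by simp
  then show "g \<in> Idl\<^bsub>T\<^esub> Y" by (rule mem_ideal_if_var_coeffs[OF IY t g])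
qed

lemma generic_in_ideal:
  assumes I: "ideal I T" and t: "t \<in> V"
  shows "const ` set cs \<subseteq> I \<Longrightarrow> set cs \<subseteq> carrier R \<Longrightarrow> generic t cs \<in> I"
proof (induction cs)
  case (Cons c cs)
  interpret I: ideal I T by fact
  show ?case using Cons I.I_l_closed[OF _ var_closed[OF t]] I.a_closed by auto
qed (use additive_subgroup.zero_closed[OF ideal.axioms(1)[OF I]] in simp)

end

locale mpolys_UNIV = mpolys R UNIV for R (structure)
begin

lemma ex_fresh:
  assumes "finite Y" "Y \<subseteq> carrier T"
  shows "\<exists>t. \<forall>y\<in>Y. free_of t y"
proof -
  let ?F = "\<Union>y\<in>Y. \<Union>u\<in>{u. y u \<noteq> \<zero>}. set_mset u"
  have "finite ?F" using assms by (auto simp: T_carrier)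
  then obtain t where "t \<notin> ?F" using infinite_UNIV_nat ex_new_if_finite by blast
  then show ?thesis unfolding free_of_def by blast
qed

definition fin_gen_ideal :: "(nat multiset \<Rightarrow> 'a) set \<Rightarrow> bool" where
  "fin_gen_ideal I \<longleftrightarrow> (\<exists>Y. finite Y \<and> Y \<subseteq> carrier T \<and> I = Idl\<^bsub>T\<^esub> Y)"

lemma fin_gen_ideal_ideal: "fin_gen_ideal I \<Longrightarrow> ideal I T"
  unfolding fin_gen_ideal_def using T.genideal_ideal by blast

lemma fin_gen_ideal_insert: "fin_gen_ideal I \<Longrightarrow> x \<in> carrier T \<Longrightarrow> fin_gen_ideal (Idl\<^bsub>T\<^esub> (insert x I))"
proof -
  assume I: "fin_gen_ideal I" and x: "x \<in> carrier T"
  obtain Y where Y: "finite Y" "Y \<subseteq> carrier T" "I = Idl\<^bsub>T\<^esub> Y" using I unfolding fin_gen_ideal_def by blast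
  have "Idl\<^bsub>T\<^esub> (insert x I) = Idl\<^bsub>T\<^esub> (insert x Y)" using T.Idl_Idl_Un[OF Y(2), of "{x}"] x Y(3) by simp
  then show ?thesis unfolding fin_gen_ideal_def using Y x by (intro exI[of _ "insert x Y"]) simp
qed

lemma fin_gen_ideal_zero: "fin_gen_ideal {\<zero>\<^bsub>T\<^esub>}"
  unfolding fin_gen_ideal_def using T.Idl_empty by (intro exI[of _ "{}"]) simp

text \<open>The common nonzerodivisor is the generic element of \<open>J\<close> in a variable that occurs in none of the generators of
  the three ideals.\<close>

lemma polynomial_grade_exchange:
  assumes cs: "set cs \<subseteq> carrier R"
  shows "grade_exchange T (Idl\<^bsub>T\<^esub> (const ` set cs)) fin_gen_ideal"
proof (rule grade_exchange.intro[OF mpoly_cring grade_exchange_axioms.intro])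
  let ?J = "Idl\<^bsub>T\<^esub> (const ` set cs)"
  have cc: "const ` set cs \<subseteq> carrier T" using cs const_closed by blast
  have J: "ideal ?J T" by (rule T.genideal_ideal[OF cc])
  show Js: "?J \<subseteq> carrier T" by (rule T.ideal_sub[OF J])
  show "fin_gen_ideal (Idl\<^bsub>T\<^esub> (insert x I))" if "fin_gen_ideal I" "x \<in> ?J" for I x using fin_gen_ideal_insert that Js by blast
  fix I1 I2 I3 assume a: "fin_gen_ideal I1" "fin_gen_ideal I2" "fin_gen_ideal I3" and f: "faithful_mod T ?J I1" "faithful_mod T ?J I2" "faithful_mod T ?J I3"
  obtain Y1 where Y1: "finite Y1" "Y1 \<subseteq> carrier T" "I1 = Idl\<^bsub>T\<^esub> Y1" using a(1) unfolding fin_gen_ideal_def by blast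
  obtain Y2 where Y2: "finite Y2" "Y2 \<subseteq> carrier T" "I2 = Idl\<^bsub>T\<^esub> Y2" using a(2) unfolding fin_gen_ideal_def by blast
  obtain Y3 where Y3: "finite Y3" "Y3 \<subseteq> carrier T" "I3 = Idl\<^bsub>T\<^esub> Y3" using a(3) unfolding fin_gen_ideal_def by blast
  have "finite (Y1 \<union> Y2 \<union> Y3)" "Y1 \<union> Y2 \<union> Y3 \<subseteq> carrier T" using Y1 Y2 Y3 by auto
  then obtain t where t: "\<And>y. y \<in> Y1 \<union> Y2 \<union> Y3 \<Longrightarrow> free_of t y" using ex_fresh by meson
  have "nzd_mod T (Idl\<^bsub>T\<^esub> Y) (generic t cs)"
    if "Y \<subseteq> carrier T" "Y \<subseteq> Y1 \<union> Y2 \<union> Y3" "faithful_mod T ?J (Idl\<^bsub>T\<^esub> Y)" for Y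
    by (rule nzd_mod_generic[OF _ that(1) _ cs])
      (use that t T.faithful_mod_Idl[OF T.genideal_ideal[OF that(1)] cc] in auto)
  then have "nzd_mod T I1 (generic t cs) \<and> nzd_mod T I2 (generic t cs) \<and> nzd_mod T I3 (generic t cs)"
    using Y1 Y2 Y3 f by auto
  moreover have "generic t cs \<in> ?J" by (rule generic_in_ideal[OF J _ _ cs]) (use T.genideal_self[OF cc] in auto)
  ultimately show "\<exists>z\<in>?J. nzd_mod T I1 z \<and> nzd_mod T I2 z \<and> nzd_mod T I3 z" by blast
qed (rule fin_gen_ideal_ideal)

text \<open>By exchange the first element of a regular sequence in \<open>J\<close> can be replaced by the generic element in a
  variable \<open>t\<^sub>k\<close> not used so far; iterating uses up the variables in order.\<close>

lemma wreg_generic: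
  assumes cs: "set cs \<subseteq> carrier R"
    and "finite Y" "Y \<subseteq> carrier T" "\<And>y t. y \<in> Y \<Longrightarrow> t \<ge> k \<Longrightarrow> free_of t y"
    and "grade_ge T (Idl\<^bsub>T\<^esub> (const ` set cs)) (Idl\<^bsub>T\<^esub> Y) n"
  shows "wreg T (Idl\<^bsub>T\<^esub> Y) (map (\<lambda>t. generic t cs) [k..<k + n])"
  using assms(2-)
proof (induction n arbitrary: k Y)
  case (Suc n)
  let ?J = "Idl\<^bsub>T\<^esub> (const ` set cs)"
  interpret ex: grade_exchange T ?J fin_gen_ideal by (rule polynomial_grade_exchange[OF cs])
  have cc: "const ` set cs \<subseteq> carrier T" using cs const_closed by blast
  have fg: "fin_gen_ideal (Idl\<^bsub>T\<^esub> Y)" unfolding fin_gen_ideal_def using Suc.prems by blast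
  have IY: "ideal (Idl\<^bsub>T\<^esub> Y) T" by (rule fin_gen_ideal_ideal[OF fg])
  have gJ: "generic k cs \<in> ?J" by (rule generic_in_ideal[OF T.genideal_ideal[OF cc] _ _ cs]) (use T.genideal_self[OF cc] in auto)
  have gc: "generic k cs \<in> carrier T" by (rule generic_closed[OF _ cs]) simp
  obtain x where "x \<in> ?J" "nzd_mod T (Idl\<^bsub>T\<^esub> Y) x" using Suc.prems(4) by auto
  then have "faithful_mod T ?J (Idl\<^bsub>T\<^esub> Y)" by (rule T.nzd_mod_imp_faithful_mod)
  then have "faithful_mod T (const ` set cs) (Idl\<^bsub>T\<^esub> Y)" using T.faithful_mod_Idl[OF IY cc] by simp
  then have nz: "nzd_mod T (Idl\<^bsub>T\<^esub> Y) (generic k cs)"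
    by (intro nzd_mod_generic cs) (use Suc.prems in auto)
  have e: "Idl\<^bsub>T\<^esub> (insert (generic k cs) (Idl\<^bsub>T\<^esub> Y)) = Idl\<^bsub>T\<^esub> (insert (generic k cs) Y)"
    using T.Idl_Idl_Un[OF Suc.prems(2), of "{generic k cs}"] gc by simp
  have "grade_ge T ?J (Idl\<^bsub>T\<^esub> (insert (generic k cs) Y)) n"
    using ex.grade_ge_step[OF fg gJ nz Suc.prems(4)] e by simp
  moreover have "free_of t y" if "y \<in> insert (generic k cs) Y" "t \<ge> Suc k" for y t
    using that Suc.prems(3) generic_free_of[of k t cs] cs by auto
  ultimately have "wreg T (Idl\<^bsub>T\<^esub> (insert (generic k cs) Y)) (map (\<lambda>t. generic t cs) [Suc k..<Suc k + n])"
    using Suc.prems gc by (intro Suc.IH) auto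
  moreover have "[k..<k + Suc n] = k # [Suc k..<Suc k + n]" by (simp add: upt_conv_Cons)
  ultimately show ?case using nz e by simp
qed simp

end

section \<open>The height bounds the grade\<close>

context mult_subset
begin

text \<open>The radical of the extension of \<open>I\<close> to the localization at \<open>S\<close>, pulled back to the ring.\<close>

definition radical_at :: "'a set \<Rightarrow> 'a set" where
  "radical_at I = {x \<in> carrier R. \<exists>s\<in>S. \<exists>n::nat. s \<otimes> x [^] n \<in> I}"

text \<open>In place of the binomial theorem: one factor \<open>x + y\<close> at a time is split off, and \<open>w\<close> absorbs the \<open>x\<close> or the \<open>y\<close>.\<close>

lemma sum_power_mem:
  assumes I: "ideal I R" and x: "x \<in> carrier R" and y: "y \<in> carrier R"
  shows "w \<in> carrier R \<Longrightarrow> w \<otimes> x [^] (n::nat) \<in> I \<Longrightarrow> w \<otimes> y [^] (m::nat) \<in> I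
    \<Longrightarrow> w \<otimes> (x \<oplus> y) [^] (n + m) \<in> I"
proof (induction "n + m" arbitrary: n m w)
  case 0
  then show ?case by simp
next
  case (Suc k)
  interpret I: ideal I R by fact
  show ?case
  proof (cases "n = 0 \<or> m = 0")
    case True
    then have "w \<in> I" using Suc.prems by auto
    then show ?thesis using I.I_r_closed x y by simp
  next
    case False
    then obtain n' m' where nm: "n = Suc n'" "m = Suc m'" by (meson not0_implies_Suc)
    have px: "x [^] Suc n' = x \<otimes> x [^] n'" and py: "y [^] Suc m' = y \<otimes> y [^] m'"
      using x y by (simp_all add: m_comm)
    have 1: "w \<otimes> x \<otimes> (x \<oplus> y) [^] (n' + m) \<in> I"
    proof (rule Suc.hyps(1))
      show "k = n' + m" using Suc.hyps(2) nm by simp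
      show "w \<otimes> x \<otimes> x [^] n' \<in> I" using Suc.prems(1,2) x px nm by (simp add: m_assoc del: nat_pow_Suc)
      have "w \<otimes> x \<otimes> y [^] m = x \<otimes> (w \<otimes> y [^] m)" using Suc.prems(1) x y by (simp add: m_ac)
      then show "w \<otimes> x \<otimes> y [^] m \<in> I" using I.I_l_closed[OF Suc.prems(3) x] by simp
    qed (use Suc.prems x in simp)
    have 2: "w \<otimes> y \<otimes> (x \<oplus> y) [^] (n + m') \<in> I"
    proof (rule Suc.hyps(1))
      show "k = n + m'" using Suc.hyps(2) nm by simp
      show "w \<otimes> y \<otimes> y [^] m' \<in> I" using Suc.prems(1,3) y py nm by (simp add: m_assoc del: nat_pow_Suc)
      have "w \<otimes> y \<otimes> x [^] n = y \<otimes> (w \<otimes> x [^] n)" using Suc.prems(1) x y by (simp add: m_ac)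
      then show "w \<otimes> y \<otimes> x [^] n \<in> I" using I.I_l_closed[OF Suc.prems(2) y] by simp
    qed (use Suc.prems y in simp)
    have e: "n' + m = n' + m' + 1" "n + m' = n' + m' + 1" "n + m = Suc (n' + m' + 1)" using nm by auto
    define z where "z = (x \<oplus> y) [^] (n' + m' + 1)"
    have zc: "z \<in> carrier R" using x y by (simp add: z_def)
    have "w \<otimes> (x \<oplus> y) [^] (n + m) = w \<otimes> (z \<otimes> (x \<oplus> y))" unfolding e(3) z_def by simp
    also have "\<dots> = w \<otimes> x \<otimes> z \<oplus> w \<otimes> y \<otimes> z" using zc x y Suc.prems(1) by algebra
    also have "\<dots> \<in> I" using 1 2 unfolding e(1,2) z_def by (rule I.a_closed)
    finally show ?thesis .
  qed
qed

lemma radical_at_ideal: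
  assumes I: "ideal I R"
  shows "ideal (radical_at I) R"
proof (rule idealI_cring)
  interpret I: ideal I R by fact
  show "r \<otimes> x \<in> radical_at I" if x: "x \<in> radical_at I" and r: "r \<in> carrier R" for x r
  proof -
    obtain s n where s: "s \<in> S" "s \<otimes> x [^] (n::nat) \<in> I" "x \<in> carrier R" using x unfolding radical_at_def by blast
    have "s \<otimes> (r \<otimes> x) [^] n = r [^] n \<otimes> (s \<otimes> x [^] n)"
      using s r S_carr by (simp add: nat_pow_distrib m_ac)
    then have "s \<otimes> (r \<otimes> x) [^] n \<in> I" using I.I_l_closed[OF s(2), of "r [^] n"] r by simp
    then show ?thesis using s r unfolding radical_at_def by blast
  qed
  have "\<one> \<otimes> \<zero> [^] (1::nat) \<in> I" using I.zero_closed by simp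
  then show "\<zero> \<in> radical_at I" using S_one unfolding radical_at_def by blast
  show "x \<oplus> y \<in> radical_at I" if x: "x \<in> radical_at I" and y: "y \<in> radical_at I" for x y
  proof -
    obtain s n where s: "s \<in> S" "s \<otimes> x [^] (n::nat) \<in> I" "x \<in> carrier R" using x unfolding radical_at_def by blast
    obtain t m where t: "t \<in> S" "t \<otimes> y [^] (m::nat) \<in> I" "y \<in> carrier R" using y unfolding radical_at_def by blast
    note c = S_carr[OF s(1)] S_carr[OF t(1)]
    have "(s \<otimes> t) \<otimes> (x \<oplus> y) [^] (n + m) \<in> I"
    proof (rule sum_power_mem[OF I s(3) t(3)])
      have "s \<otimes> t \<otimes> x [^] n = t \<otimes> (s \<otimes> x [^] n)" using c s(3) by (simp add: m_ac)
      then show "s \<otimes> t \<otimes> x [^] n \<in> I" using I.I_l_closed[OF s(2) c(2)] by simp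
      have "s \<otimes> t \<otimes> y [^] m = s \<otimes> (t \<otimes> y [^] m)" using c t(3) by (simp add: m_ac)
      then show "s \<otimes> t \<otimes> y [^] m \<in> I" using I.I_l_closed[OF t(2) c(1)] by simp
    qed (use c in simp)
    then show ?thesis using S_mult[OF s(1) t(1)] s(3) t(3) unfolding radical_at_def by blast
  qed
qed (auto simp: radical_at_def)

lemma radical_at_supset: "ideal I R \<Longrightarrow> I \<subseteq> radical_at I"
proof
  fix x assume I: "ideal I R" and x: "x \<in> I"
  have xc: "x \<in> carrier R" by (rule ideal.Icarr[OF I x])
  then have "\<one> \<otimes> x [^] (1::nat) \<in> I" using x by simp
  then show "x \<in> radical_at I" using S_one xc unfolding radical_at_def by blast
qed

lemma radical_at_mono: "I \<subseteq> K \<Longrightarrow> radical_at I \<subseteq> radical_at K"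
  unfolding radical_at_def by blast

lemma radical_at_absorb:
  assumes I: "ideal I R" and x: "x \<in> carrier R" and s: "s \<in> S" and h: "s \<otimes> x [^] (n::nat) \<in> radical_at I"
  shows "x \<in> radical_at I"
proof -
  interpret I: ideal I R by fact
  obtain t m where t: "t \<in> S" "t \<otimes> (s \<otimes> x [^] n) [^] (m::nat) \<in> I" using h unfolding radical_at_def by blast
  have "s [^] m \<in> S" for m :: nat by (induction m) (auto simp: S_one S_mult s)
  then have tS: "t \<otimes> s [^] m \<in> S" using t(1) S_mult by blast
  have "(t \<otimes> s [^] m) \<otimes> x [^] (n * m) = t \<otimes> (s \<otimes> x [^] n) [^] m"
    using S_carr[OF s] S_carr[OF t(1)] x by (simp add: nat_pow_distrib nat_pow_pow m_assoc)
  then have "(t \<otimes> s [^] m) \<otimes> x [^] (n * m) \<in> I" using t(2) by simp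
  then show ?thesis using tS x unfolding radical_at_def by blast
qed

end

context cring
begin

text \<open>An ideal maximal among those disjoint from a multiplicative set is prime.\<close>

lemma ex_prime_avoiding:
  assumes I: "ideal I R" and M: "M \<subseteq> carrier R" "\<one> \<in> M" "\<And>s t. s \<in> M \<Longrightarrow> t \<in> M \<Longrightarrow> s \<otimes> t \<in> M"
    and disj: "I \<inter> M = {}"
  shows "\<exists>Q. primeideal Q R \<and> I \<subseteq> Q \<and> Q \<inter> M = {}"
proof -
  let ?S = "{K. ideal K R \<and> I \<subseteq> K \<and> K \<inter> M = {}}"
  have "\<exists>Q\<in>?S. \<forall>K\<in>?S. Q \<subseteq> K \<longrightarrow> K = Q"
  proof (rule subset_Zorn_nonempty)
    show "?S \<noteq> {}" using I disj by blast
    fix C assume C: "C \<noteq> {}" "subset.chain ?S C"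
    then have "subset.chain {I. ideal I R} C" by (auto simp: subset_chain_def)
    then have UC: "ideal (\<Union>C) R" using chain_Union_is_ideal[of C] C(1) by simp
    moreover have CS: "C \<subseteq> ?S" using C(2) by (simp add: subset_chain_def)
    moreover obtain K where "K \<in> C" using C(1) by blast
    ultimately have "I \<subseteq> \<Union>C" "\<Union>C \<inter> M = {}" by blast+
    then show "\<Union>C \<in> ?S" using UC by blast
  qed
  then obtain Q where QS: "Q \<in> ?S" and QM: "\<forall>K\<in>?S. Q \<subseteq> K \<longrightarrow> K = Q" by (elim bexE)
  have Q: "ideal Q R" "I \<subseteq> Q" "Q \<inter> M = {}" using QS by auto
  have mx: "K = Q" if "ideal K R" "I \<subseteq> K" "K \<inter> M = {}" "Q \<subseteq> K" for K
    using QM that by simp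
  interpret Q: ideal Q R by (rule Q(1))
  have meet: "\<exists>i\<in>Q. \<exists>r\<in>carrier R. i \<oplus> r \<otimes> a \<in> M" if a: "a \<in> carrier R" "a \<notin> Q" for a
  proof -
    have "Idl (insert a Q) \<inter> M \<noteq> {}"
      using mx[OF Idl_insert_ideal[OF Q(1) a(1)]] Idl_insert_supset[OF Q(1) a(1)] Idl_insert_self[OF Q(1) a(1)] Q(2) a(2)
      by blast
    then obtain v where "v \<in> Idl (insert a Q)" and v: "v \<in> M" by blast
    then obtain i r where "i \<in> Q" "r \<in> carrier R" "v = i \<oplus> r \<otimes> a"
      unfolding mem_Idl_insert[OF Q(1) a(1)] by blast
    then show ?thesis using v by blast
  qed
  have "primeideal Q R"
  proof (rule primeidealI[OF Q(1) is_cring])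
    show "carrier R \<noteq> Q" using Q(3) M(1,2) by blast
    fix a b assume ab: "a \<in> carrier R" "b \<in> carrier R" "a \<otimes> b \<in> Q"
    show "a \<in> Q \<or> b \<in> Q"
    proof (rule ccontr)
      assume "\<not> (a \<in> Q \<or> b \<in> Q)"
      then obtain i r j t where i: "i \<in> Q" "r \<in> carrier R" "i \<oplus> r \<otimes> a \<in> M" and j: "j \<in> Q" "t \<in> carrier R" "j \<oplus> t \<otimes> b \<in> M"
        using meet[OF ab(1)] meet[OF ab(2)] by blast
      note c = ab(1,2) i(2) j(2) Q.Icarr[OF i(1)] Q.Icarr[OF j(1)]
      have "(i \<oplus> r \<otimes> a) \<otimes> (j \<oplus> t \<otimes> b) = (j \<oplus> t \<otimes> b) \<otimes> i \<oplus> (r \<otimes> a \<otimes> j \<oplus> (r \<otimes> t) \<otimes> (a \<otimes> b))"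
        using c by algebra
      also have "\<dots> \<in> Q"
        using c by (intro Q.a_closed Q.I_l_closed i(1) j(1) ab(3)) auto
      finally show False using M(3)[OF i(3) j(3)] Q(3) by blast
    qed
  qed
  then show ?thesis using Q by blast
qed

text \<open>For \<open>I\<close> inside the prime \<open>P\<close>: the height of \<open>P / I\<close> is at most \<open>n\<close>.\<close>

definition height_above_le :: "'a set \<Rightarrow> 'a set \<Rightarrow> nat \<Rightarrow> bool" where
  "height_above_le I P n \<longleftrightarrow> (\<forall>ps. prime_chain R ps \<and> I \<subseteq> hd ps \<and> last ps = P \<longrightarrow> length ps \<le> Suc n)"

text \<open>A prime containing \<open>I\<close> and avoiding all products \<open>s b\<^sup>n\<close> with \<open>s\<close> outside \<open>Q\<close> is contained in \<open>Q\<close> and misses \<open>b\<close>.\<close>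

lemma ex_prime_below:
  assumes I: "ideal I R" and Q: "primeideal Q R" and b: "b \<in> Q"
    and h: "\<And>s n. s \<in> carrier R \<Longrightarrow> s \<notin> Q \<Longrightarrow> s \<otimes> b [^] (n::nat) \<notin> I"
  shows "\<exists>q. primeideal q R \<and> I \<subseteq> q \<and> q \<subset> Q"
proof -
  interpret Q: primeideal Q R by fact
  have bc: "b \<in> carrier R" using b by (rule Q.Icarr)
  have oneQ: "\<one> \<notin> Q" using Q.one_imp_carrier Q.I_notcarr by blast
  define M where "M = {s \<otimes> b [^] (n::nat) | s n. s \<in> carrier R - Q}"
  have MI: "s \<otimes> b [^] n \<in> M" if "s \<in> carrier R" "s \<notin> Q" for s and n :: nat
    unfolding M_def using that by blast
  have "\<exists>q. primeideal q R \<and> I \<subseteq> q \<and> q \<inter> M = {}"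
  proof (rule ex_prime_avoiding[OF I])
    show "M \<subseteq> carrier R" unfolding M_def using bc by auto
    show "\<one> \<in> M" using MI[OF one_closed oneQ, of 0] by simp
    show "I \<inter> M = {}" unfolding M_def using h by blast
    fix x y assume "x \<in> M" "y \<in> M"
    then obtain s t n m where x: "x = s \<otimes> b [^] (n::nat)" "s \<in> carrier R" "s \<notin> Q"
      and y: "y = t \<otimes> b [^] (m::nat)" "t \<in> carrier R" "t \<notin> Q" unfolding M_def by blast
    have "x \<otimes> y = (s \<otimes> t) \<otimes> b [^] (n + m)" using x y bc by (simp add: nat_pow_mult[symmetric] m_ac)
    moreover have "s \<otimes> t \<notin> Q" using Q.I_prime x y by blast
    ultimately show "x \<otimes> y \<in> M" using MI[of "s \<otimes> t" "n + m"] x y by simp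
  qed
  then obtain q where q: "primeideal q R" "I \<subseteq> q" "q \<inter> M = {}" by blast
  have qc: "q \<subseteq> carrier R" by (rule ideal_sub[OF primeideal.axioms(1)[OF q(1)]])
  have "q \<subseteq> Q" using MI[of _ 0] q(3) qc by auto
  moreover have "b \<notin> q" using MI[OF one_closed oneQ, of 1] q(3) bc by auto
  ultimately show ?thesis using q b by blast
qed

text \<open>One generator can be dropped, up to radical and locally at \<open>P\<close>: the elements of \<open>bs\<close> are modified by multiples of
  \<open>a\<close> so that \<open>a\<close> becomes superfluous. The induction passes to the boundary ideal \<open>I' = b + (radical_at I : b)\<close>. It
  is contained in no prime that is minimal over \<open>I\<close>, so if it lies in \<open>P\<close> the height of \<open>P\<close> drops by one modulo \<open>I'\<close>.
  The induction hypothesis gives \<open>s a\<^sup>n = y + l + u b\<close> with \<open>y b\<close> in the radical of \<open>I\<close> and \<open>l\<close> in the ideal of the new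
  elements; then \<open>b + a y\<close> replaces \<open>b\<close>, because the product of \<open>b\<close> and \<open>a y\<close> lies in the
  radical, so both do as soon as their sum does.\<close>

lemma kronecker_step:
  assumes P: "primeideal P R"
    and "ideal I R" "I \<subseteq> P" "height_above_le I P (length bs)" "a \<in> P" "set bs \<subseteq> P"
  shows "\<exists>cs. length cs = length bs \<and> set cs \<subseteq> Idl (insert a (set bs)) \<and> set bs \<subseteq> Idl (insert a (set cs))
    \<and> a \<in> mult_subset.radical_at R (carrier R - P) (Idl (I \<union> set cs))"
proof -
  interpret P: primeideal P R by fact
  have oneP: "\<one> \<notin> P" using P.one_imp_carrier P.I_notcarr by blast
  interpret mult_subset R "carrier R - P"
    by (rule mult_subset.intro[OF is_cring mult_subset_axioms.intro]) (use oneP P.I_prime in auto)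
  show ?thesis using assms(2-)
  proof (induction bs arbitrary: I)
    case Nil
    have "a \<in> radical_at I"
    proof (rule ccontr)
      assume "a \<notin> radical_at I"
      then have "s \<otimes> a [^] n \<notin> I" if "s \<in> carrier R" "s \<notin> P" for s and n :: nat
        using that Nil.prems(4) P.Icarr unfolding radical_at_def by blast
      then obtain q where q: "primeideal q R" "I \<subseteq> q" "q \<subset> P"
        using ex_prime_below[OF Nil.prems(1) P Nil.prems(4)] by blast
      have "prime_chain R [q, P]" using q P by (simp add: prime_chain_def)
      then show False using Nil.prems(3) q(2) unfolding height_above_le_def by force
    qed
    then show ?case using Idl_of_ideal[OF Nil.prems(1)] by simp
  next
    case (Cons b bs)
    note I = Cons.prems(1)
    interpret I: ideal I R by (rule I)
    have aP: "a \<in> P" and bP: "b \<in> P" and bsP: "set bs \<subseteq> P" using Cons.prems by auto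
    have ac: "a \<in> carrier R" and bc: "b \<in> carrier R" and bsc: "set bs \<subseteq> carrier R"
      using aP bP bsP P.a_subset by auto
    let ?D = "radical_at I"
    have D: "ideal ?D R" by (rule radical_at_ideal[OF I])
    define K where "K = colon R ?D b"
    have K: "ideal K R" unfolding K_def by (rule colon_ideal[OF D bc])
    have IK: "I \<subseteq> K"
      using radical_at_supset[OF I] ideal.I_r_closed[OF D _ bc] I.a_subset by (auto simp: K_def colon_def)
    define I' where "I' = Idl (insert b K)"
    have I': "ideal I' R" unfolding I'_def by (rule Idl_insert_ideal[OF K bc])
    show ?case
    proof (cases "I' \<subseteq> P")
      case False
      have "\<not> K \<subseteq> P"
      proof
        assume "K \<subseteq> P"
        then have "I' \<subseteq> P" unfolding I'_def by (intro genideal_minimal P.is_ideal) (use bP in blast)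
        then show False using False by blast
      qed
      then obtain y where y: "y \<in> carrier R" "y \<otimes> b \<in> ?D" "y \<notin> P" unfolding K_def colon_def by blast
      have "b \<in> ?D" by (rule radical_at_absorb[OF I bc, of y 1]) (use y bc in auto)
      \<comment> \<open>Here \<open>b\<close> is already in the radical of \<open>I\<close>, and its place is free to take up \<open>a\<close>.\<close>
      let ?cs = "(b \<oplus> a) # bs"
      have c: "insert a (set ?cs) \<subseteq> carrier R" "insert a (set (b # bs)) \<subseteq> carrier R" using ac bc bsc by auto
      interpret J1: ideal "Idl (insert a (set ?cs))" R by (rule genideal_ideal[OF c(1)])
      interpret J2: ideal "Idl (insert a (set (b # bs)))" R by (rule genideal_ideal[OF c(2)])
      note s1 = genideal_self[OF c(1)] and s2 = genideal_self[OF c(2)]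
      have Ic: "I \<union> set ?cs \<subseteq> carrier R" using I.a_subset c by auto
      let ?L = "Idl (I \<union> set ?cs)"
      have L: "ideal ?L R" by (rule genideal_ideal[OF Ic])
      interpret DL: ideal "radical_at ?L" R by (rule radical_at_ideal[OF L])
      have "I \<subseteq> ?L" using genideal_self[OF Ic] by blast
      then have bD: "b \<in> radical_at ?L" using \<open>b \<in> ?D\<close> radical_at_mono by blast
      have "b \<oplus> a \<in> radical_at ?L" using genideal_self[OF Ic] radical_at_supset[OF L] by auto
      then have aD: "a \<in> radical_at ?L" using ideal_add_left_cancel[OF DL.is_ideal bD ac] by blast
      have "b = (b \<oplus> a) \<oplus> \<ominus> a" using ac bc by algebra
      also have "\<dots> \<in> Idl (insert a (set ?cs))" by (rule J1.a_closed[OF _ J1.a_inv_closed]) (use s1 in auto)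
      finally have "b \<in> Idl (insert a (set ?cs))" .
      then have "set (b # bs) \<subseteq> Idl (insert a (set ?cs))" using s1 by auto
      moreover have "set ?cs \<subseteq> Idl (insert a (set (b # bs)))" using s2 J2.a_closed[of b a] by auto
      ultimately show ?thesis using aD by (intro exI[of _ ?cs]) simp
    next
      case True
      have "height_above_le I' P (length bs)"
        unfolding height_above_le_def
      proof (intro allI impI, elim conjE)
        fix ps assume ps: "prime_chain R ps" "I' \<subseteq> hd ps" "last ps = P"
        obtain Q ps' where Q: "ps = Q # ps'" using ps(1) by (cases ps) (auto simp: prime_chain_def)
        have pQ: "primeideal Q R" and IQ: "I' \<subseteq> Q" using ps Q by (auto simp: prime_chain_def)
        interpret Q: primeideal Q R by (rule pQ)
        have KQ: "K \<subseteq> Q" and bQ: "b \<in> Q"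
          using IQ Idl_insert_supset[OF K bc] Idl_insert_self[OF K bc] unfolding I'_def by auto
        have "s \<otimes> b [^] n \<notin> I" if s: "s \<in> carrier R" "s \<notin> Q" for s and n :: nat
        proof
          assume h: "s \<otimes> b [^] n \<in> I"
          show False
          proof (cases n)
            case 0
            then show False using h s IK KQ by auto
          next
            case (Suc n')
            have "\<one> \<otimes> (s \<otimes> b) [^] n = s [^] n' \<otimes> (s \<otimes> b [^] n)"
              using s bc Suc by (simp add: nat_pow_distrib m_ac)
            then have "\<one> \<otimes> (s \<otimes> b) [^] n \<in> I" using I.I_l_closed[OF h] s by simp
            then have "s \<otimes> b \<in> ?D" using S_one s bc unfolding radical_at_def by blast
            then have "s \<in> K" using s unfolding K_def colon_def by blast
            then show False using KQ s by blast
          qed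
        qed
        then obtain q where q: "primeideal q R" "I \<subseteq> q" "q \<subset> Q" using ex_prime_below[OF I pQ bQ] by blast
        have "q \<subset> p" if "p \<in> set ps" for p using that q(3) ps(1) unfolding Q prime_chain_def by auto
        then have "prime_chain R (q # ps)" using ps(1) q(1) by (simp add: prime_chain_def)
        then have "length (q # ps) \<le> Suc (length (b # bs))"
          using Cons.prems(3) q(2) ps(3) Q unfolding height_above_le_def by fastforce
        then show "length ps \<le> Suc (length bs)" by simp
      qed
      then obtain cs where cs: "length cs = length bs" "set cs \<subseteq> Idl (insert a (set bs))"
        "set bs \<subseteq> Idl (insert a (set cs))" "a \<in> radical_at (Idl (I' \<union> set cs))"
        using Cons.IH[OF I' True _ aP bsP] by blast
      have csc: "set cs \<subseteq> carrier R"
        using cs(2) ideal_sub[OF genideal_ideal[of "insert a (set bs)"]] ac bsc by auto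
      have Kc: "K \<subseteq> carrier R" by (rule ideal_sub[OF K])
      obtain s n where s: "s \<in> carrier R - P" "s \<otimes> a [^] (n::nat) \<in> Idl (I' \<union> set cs)"
        using cs(4) unfolding radical_at_def by blast
      have "Idl (I' \<union> set cs) = Idl (insert b (K \<union> set cs))"
        unfolding I'_def using Idl_Idl_Un[of "insert b K" "set cs"] Kc bc csc by simp
      also have "\<dots> = Idl (insert b (Idl (K \<union> set cs)))"
        using Idl_Idl_Un[of "K \<union> set cs" "{b}"] Kc bc csc by simp
      finally have "s \<otimes> a [^] n \<in> Idl (insert b (Idl (K \<union> set cs)))" using s by simp
      then obtain w u where w: "w \<in> Idl (K \<union> set cs)" and u: "u \<in> carrier R" and e1: "s \<otimes> a [^] n = w \<oplus> u \<otimes> b"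
        using mem_Idl_insert[OF genideal_ideal bc, of "K \<union> set cs"] Kc csc by auto
      have Jcs: "ideal (Idl (set cs)) R" by (rule genideal_ideal[OF csc])
      have "Idl (K \<union> set cs) = Idl (K \<union> Idl (set cs))"
        using Idl_Idl_Un[OF csc Kc] by (simp add: Un_commute)
      also have "\<dots> = K <+> Idl (set cs)" by (rule union_genideal[OF K Jcs])
      finally obtain y l where y: "y \<in> K" and l: "l \<in> Idl (set cs)" and e2: "w = y \<oplus> l"
        using w unfolding set_add_def' by auto
      have yc: "y \<in> carrier R" and lc: "l \<in> carrier R" using y l Kc ideal_sub[OF Jcs] by auto
      let ?c = "b \<oplus> a \<otimes> y"
      let ?cs = "?c # cs"
      have Ic: "I \<union> set ?cs \<subseteq> carrier R" using I.a_subset csc ac bc yc by auto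
      let ?L = "Idl (I \<union> set ?cs)"
      have L: "ideal ?L R" by (rule genideal_ideal[OF Ic])
      interpret DL: ideal "radical_at ?L" R by (rule radical_at_ideal[OF L])
      have IL: "I \<union> set ?cs \<subseteq> ?L" by (rule genideal_self[OF Ic])
      have LD: "?L \<subseteq> radical_at ?L" by (rule radical_at_supset[OF L])
      have cD: "?c \<in> radical_at ?L" using IL LD by auto
      have "y \<otimes> b \<in> ?D" using y unfolding K_def colon_def by blast
      then have ybD: "y \<otimes> b \<in> radical_at ?L" using radical_at_mono[of I ?L] IL by blast
      \<comment> \<open>\<open>b\<^sup>2 = b (b + a y) - a (y b)\<close> lies in the radical, hence so do \<open>b\<close> and \<open>a y = (b + a y) - b\<close>.\<close>
      have "\<one> \<otimes> b [^] (2::nat) = b \<otimes> ?c \<oplus> \<ominus> (a \<otimes> (y \<otimes> b))"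
        using ac bc yc by (simp add: numeral_2_eq_2, algebra)
      also have "\<dots> \<in> radical_at ?L" by (intro DL.a_closed DL.a_inv_closed DL.I_l_closed cD ybD bc ac)
      finally have bD: "b \<in> radical_at ?L" by (rule radical_at_absorb[OF L bc S_one])
      have ayD: "a \<otimes> y \<in> radical_at ?L" using ideal_add_left_cancel[OF DL.is_ideal bD] cD ac yc by simp
      have "Idl (set cs) \<subseteq> ?L" by (rule genideal_minimal[OF L]) (use IL in auto)
      then have lD: "l \<in> radical_at ?L" using l LD by blast
      have "s \<otimes> a [^] Suc n = (s \<otimes> a [^] n) \<otimes> a" using s(1) ac by (simp add: m_assoc)
      also have "\<dots> = a \<otimes> y \<oplus> (a \<otimes> l \<oplus> (u \<otimes> a) \<otimes> b)" unfolding e1 e2 using ac yc lc u bc by algebra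
      also have "\<dots> \<in> radical_at ?L"
        by (intro DL.a_closed DL.I_l_closed ayD lD bD ac m_closed u)
      finally have aD: "a \<in> radical_at ?L" by (rule radical_at_absorb[OF L ac s(1)])
      have c: "insert a (set ?cs) \<subseteq> carrier R" "insert a (set (b # bs)) \<subseteq> carrier R" using ac bc bsc csc yc by auto
      interpret J1: ideal "Idl (insert a (set ?cs))" R by (rule genideal_ideal[OF c(1)])
      interpret J2: ideal "Idl (insert a (set (b # bs)))" R by (rule genideal_ideal[OF c(2)])
      note s1 = genideal_self[OF c(1)] and s2 = genideal_self[OF c(2)]
      have "b = ?c \<oplus> \<ominus> (y \<otimes> a)" using ac bc yc by algebra
      also have "\<dots> \<in> Idl (insert a (set ?cs))"
        by (rule J1.a_closed[OF _ J1.a_inv_closed[OF J1.I_l_closed[OF _ yc]]]) (use s1 in auto)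
      finally have "b \<in> Idl (insert a (set ?cs))" .
      moreover have "set bs \<subseteq> Idl (insert a (set ?cs))"
        using cs(3) Idl_mono[of "insert a (set cs)" "insert a (set ?cs)"] c(1) by auto
      moreover have "?c \<in> Idl (insert a (set (b # bs)))"
        using s2 J2.a_closed J2.I_r_closed[OF _ yc, of a] by auto
      moreover have "set cs \<subseteq> Idl (insert a (set (b # bs)))"
        using cs(2) Idl_mono[of "insert a (set bs)" "insert a (set (b # bs))"] c(2) by auto
      ultimately show ?thesis using aD cs(1) by (intro exI[of _ ?cs]) simp
    qed
  qed
qed

lemma kronecker:
  assumes P: "primeideal P R" and h: "height_above_le {\<zero>} P n" and "set gs \<subseteq> P"
  shows "\<exists>ys. length ys = n \<and> set ys \<subseteq> P
    \<and> set gs \<subseteq> mult_subset.radical_at R (carrier R - P) (Idl (set ys))"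
  using assms(3)
proof (induction gs)
  case Nil
  have "\<zero> \<in> P" using P by (simp add: additive_subgroup.zero_closed ideal.axioms(1) primeideal.axioms(1))
  then show ?case by (intro exI[of _ "replicate n \<zero>"]) auto
next
  case (Cons g gs)
  interpret P: primeideal P R by fact
  have oneP: "\<one> \<notin> P" using P.one_imp_carrier P.I_notcarr by blast
  interpret mult_subset R "carrier R - P"
    by (rule mult_subset.intro[OF is_cring mult_subset_axioms.intro]) (use oneP P.I_prime in auto)
  obtain ys where ys: "length ys = n" "set ys \<subseteq> P" "set gs \<subseteq> radical_at (Idl (set ys))"
    using Cons by auto
  have gP: "g \<in> P" using Cons.prems by simp
  obtain cs where cs: "length cs = length ys" "set cs \<subseteq> Idl (insert g (set ys))"
    "set ys \<subseteq> Idl (insert g (set cs))" "g \<in> radical_at (Idl ({\<zero>} \<union> set cs))"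
    using kronecker_step[OF P zeroideal _ _ gP ys(2)] h ys(1) P.zero_closed by auto
  have "Idl (insert g (set ys)) \<subseteq> P" by (rule genideal_minimal[OF P.is_ideal]) (use gP ys in blast)
  then have csP: "set cs \<subseteq> P" using cs(2) by blast
  then have csc: "set cs \<subseteq> carrier R" using P.a_subset by blast
  have L: "ideal (Idl (set cs)) R" by (rule genideal_ideal[OF csc])
  have D: "ideal (radical_at (Idl (set cs))) R" by (rule radical_at_ideal[OF L])
  have "Idl ({\<zero>} \<union> set cs) = Idl (set cs)"
    using Idl_Idl_Un[of "{}" "set cs"] csc unfolding Idl_empty by simp
  then have gD: "g \<in> radical_at (Idl (set cs))" using cs(4) by simp
  have "Idl (insert g (set cs)) \<subseteq> radical_at (Idl (set cs))"
    by (rule genideal_minimal[OF D]) (use gD genideal_self[OF csc] radical_at_supset[OF L] in blast)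
  then have "Idl (set ys) \<subseteq> radical_at (Idl (set cs))" using cs(3) by (intro genideal_minimal[OF D]) blast
  then have "radical_at (Idl (set ys)) \<subseteq> radical_at (radical_at (Idl (set cs)))" by (rule radical_at_mono)
  also have "\<dots> \<subseteq> radical_at (Idl (set cs))"
    using radical_at_absorb[OF L] by (auto simp: radical_at_def[of "radical_at _"])
  finally have "set gs \<subseteq> radical_at (Idl (set cs))" using ys(3) by blast
  then show ?case using cs(1) ys(1) csP gD by (intro exI[of _ cs]) simp
qed

lemma one_mem_if_power_mem:
  assumes I: "ideal I R" and x: "x \<in> carrier R" "nzd_mod R I x" and h: "x [^] (n::nat) \<in> I"
  shows "\<one> \<in> I"
  using h
proof (induction n)
  case (Suc n)
  have "x [^] Suc n = x \<otimes> x [^] n" using x(1) m_comm[of x "x [^] n"] by simp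
  then have "x [^] n \<in> I" using nzd_modD[OF x(2), of "x [^] n"] x(1) Suc.prems by (simp del: nat_pow_Suc)
  then show ?case by (rule Suc.IH)
qed simp

lemma mem_if_power_mult_mem:
  assumes x: "x \<in> carrier R" "nzd_mod R I x" and a: "a \<in> carrier R" and h: "x [^] (n::nat) \<otimes> a \<in> I"
  shows "a \<in> I"
  using h
proof (induction n)
  case 0
  then show ?case using a by simp
next
  case (Suc n)
  have "x [^] Suc n \<otimes> a = x \<otimes> (x [^] n \<otimes> a)" using x(1) a by (simp add: m_ac)
  then show ?case using Suc nzd_modD[OF x(2), of "x [^] n \<otimes> a"] x(1) a by simp
qed

end

context mpolys_UNIV
begin

text \<open>Induction on the number of generators \<open>ys\<close>. The generic element \<open>z = y + t (\<dots>)\<close> of the ideal of \<open>y # ys\<close> is a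
  nonzerodivisor modulo \<open>I\<close>, and by exchange \<open>J\<close> has grade one less modulo \<open>I + z\<close>. Modulo \<open>z\<close> the element \<open>y\<close> lies
  in the ideal generated by the remaining \<open>ys\<close>.\<close>

lemma radical_generators_step:
  assumes cs: "set cs \<subseteq> carrier R" and J: "J = Idl\<^bsub>T\<^esub> (const ` set cs)"
    and "fin_gen_ideal I" "set ys \<subseteq> set cs" "\<And>x. x \<in> J \<Longrightarrow> \<exists>n::nat. x [^]\<^bsub>T\<^esub> n \<in> Idl\<^bsub>T\<^esub> (const ` set ys \<union> I)"
    "grade_ge T J I (Suc (length ys))"
  shows "\<one>\<^bsub>T\<^esub> \<in> Idl\<^bsub>T\<^esub> (const ` set ys \<union> I)"
  using assms(3-)
proof (induction ys arbitrary: I)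
  case Nil
  have I: "ideal I T" by (rule fin_gen_ideal_ideal[OF Nil.prems(1)])
  have cc: "const ` set cs \<subseteq> carrier T" using cs const_closed by blast
  obtain x where x: "x \<in> J" "nzd_mod T I x" using Nil.prems(4) by auto
  have "x \<in> carrier T" using x(1) T.ideal_sub[OF T.genideal_ideal[OF cc]] unfolding J by blast
  moreover obtain n :: nat where "x [^]\<^bsub>T\<^esub> n \<in> I" using Nil.prems(3)[OF x(1)] T.Idl_of_ideal[OF I] by auto
  ultimately have "\<one>\<^bsub>T\<^esub> \<in> I" using T.one_mem_if_power_mem[OF I _ x(2)] by blast
  then show ?case using T.Idl_of_ideal[OF I] by simp
next
  case (Cons y ys)
  note fI = Cons.prems(1)
  have I: "ideal I T" by (rule fin_gen_ideal_ideal[OF fI])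
  interpret I: ideal I T by (rule I)
  interpret ex: grade_exchange T J fin_gen_ideal unfolding J by (rule polynomial_grade_exchange[OF cs])
  have cc: "const ` set cs \<subseteq> carrier T" using cs const_closed by blast
  have JI: "ideal J T" unfolding J by (rule T.genideal_ideal[OF cc])
  have yc: "set (y # ys) \<subseteq> carrier R" using Cons.prems(2) cs by blast
  have cyc: "const ` set (y # ys) \<subseteq> carrier T" using yc const_closed by blast
  obtain x where x: "x \<in> J" "nzd_mod T I x" using Cons.prems(4) by auto
  have xc: "x \<in> carrier T" using x(1) ex.J by blast
  have f: "faithful_mod T (const ` set (y # ys)) I"
    unfolding faithful_mod_def
  proof (intro ballI impI)
    fix a assume a: "a \<in> carrier T" and h: "\<forall>c\<in>const ` set (y # ys). c \<otimes>\<^bsub>T\<^esub> a \<in> I"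
    have "I \<subseteq> colon T I a" using I.a_subset I.I_r_closed[OF _ a] unfolding colon_def by blast
    moreover have "const ` set (y # ys) \<subseteq> colon T I a" using h cyc unfolding colon_def by blast
    ultimately have "const ` set (y # ys) \<union> I \<subseteq> colon T I a" by blast
    then have sub: "Idl\<^bsub>T\<^esub> (const ` set (y # ys) \<union> I) \<subseteq> colon T I a"
      by (rule T.genideal_minimal[OF T.colon_ideal[OF I a]])
    obtain n :: nat where "x [^]\<^bsub>T\<^esub> n \<in> Idl\<^bsub>T\<^esub> (const ` set (y # ys) \<union> I)" using Cons.prems(3)[OF x(1)] by blast
    then have "x [^]\<^bsub>T\<^esub> n \<otimes>\<^bsub>T\<^esub> a \<in> I" using sub by (auto simp: colon_def)
    then show "a \<in> I" by (rule T.mem_if_power_mult_mem[OF xc x(2) a])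
  qed
  obtain Y where Y: "finite Y" "Y \<subseteq> carrier T" "I = Idl\<^bsub>T\<^esub> Y" using fI unfolding fin_gen_ideal_def by blast
  obtain t where t: "\<And>y. y \<in> Y \<Longrightarrow> free_of t y" using ex_fresh[OF Y(1,2)] by blast
  define z where "z = generic t (y # ys)"
  have nz: "nzd_mod T I z"
    unfolding Y(3) z_def by (rule nzd_mod_generic[OF _ Y(2) t yc]) (use f Y(3) in auto)
  have zc: "z \<in> carrier T" unfolding z_def by (rule generic_closed[OF _ yc]) simp
  have yJ: "const ` set (y # ys) \<subseteq> J" using Cons.prems(2) T.genideal_self[OF cc] unfolding J by blast
  have zJ: "z \<in> J" unfolding z_def by (rule generic_in_ideal[OF JI _ yJ yc]) simp
  define I' where "I' = Idl\<^bsub>T\<^esub> (insert z I)"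
  have fI': "fin_gen_ideal I'" unfolding I'_def by (rule fin_gen_ideal_insert[OF fI zc])
  have I': "ideal I' T" by (rule fin_gen_ideal_ideal[OF fI'])
  have zI': "z \<in> I'" and II': "I \<subseteq> I'"
    unfolding I'_def using T.Idl_insert_self[OF I zc] T.Idl_insert_supset[OF I zc] by auto
  have g: "grade_ge T J I' (Suc (length ys))"
    unfolding I'_def by (rule ex.grade_ge_step[OF fI zJ nz]) (use Cons.prems(4) in simp)
  let ?A = "Idl\<^bsub>T\<^esub> (const ` set (y # ys) \<union> I)" and ?B = "Idl\<^bsub>T\<^esub> (const ` set ys \<union> I')"
  have Ac: "const ` set (y # ys) \<union> I \<subseteq> carrier T" using cyc I.a_subset by blast
  have Bc: "const ` set ys \<union> I' \<subseteq> carrier T" using cyc T.ideal_sub[OF I'] by auto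
  have A: "ideal ?A T" by (rule T.genideal_ideal[OF Ac])
  have B: "ideal ?B T" by (rule T.genideal_ideal[OF Bc])
  interpret B: ideal ?B T by (rule B)
  have sA: "const ` set (y # ys) \<union> I \<subseteq> ?A" by (rule T.genideal_self[OF Ac])
  have sB: "const ` set ys \<union> I' \<subseteq> ?B" by (rule T.genideal_self[OF Bc])
  have "z \<in> ?A" unfolding z_def by (rule generic_in_ideal[OF A _ _ yc]) (use sA in auto)
  then have "I' \<subseteq> ?A" unfolding I'_def by (intro T.genideal_minimal[OF A]) (use sA in blast)
  then have BA: "?B \<subseteq> ?A" by (intro T.genideal_minimal[OF A]) (use sA in auto)
  have ysc: "set ys \<subseteq> carrier R" and y: "y \<in> carrier R" using yc by auto
  have gB: "generic t ys \<in> ?B" by (rule generic_in_ideal[OF B _ _ ysc]) (use sB in auto)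
  have vB: "var t \<otimes>\<^bsub>T\<^esub> generic t ys \<in> ?B" by (rule B.I_l_closed[OF gB var_closed]) simp
  \<comment> \<open>The summand of \<open>z\<close> without \<open>t\<close> is \<open>y\<close>; the others lie in the ideal of \<open>ys\<close>.\<close>
  have "var t \<otimes>\<^bsub>T\<^esub> generic t ys \<oplus>\<^bsub>T\<^esub> const y = z"
    unfolding z_def using T.a_comm[OF B.Icarr[OF vB] const_closed[OF y]] by simp
  then have "const y \<in> ?B"
    using T.ideal_add_left_cancel[OF B vB const_closed[OF y]] zI' sB by auto
  then have AB: "?A \<subseteq> ?B" by (intro T.genideal_minimal[OF B]) (use sB II' in auto)
  have "\<one>\<^bsub>T\<^esub> \<in> ?B"
  proof (rule Cons.IH[OF fI' _ _ g])
    show "set ys \<subseteq> set cs" using Cons.prems(2) by simp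
    show "\<exists>n::nat. x [^]\<^bsub>T\<^esub> n \<in> ?B" if "x \<in> J" for x using Cons.prems(3)[OF that] AB by blast
  qed
  then show ?case using BA by blast
qed

end

text \<open>The sequence stays regular in the polynomial ring, where \<open>radical_generators_step\<close> applies. The elements \<open>ys\<close>
  are adjoined to \<open>cs\<close> so that the generic elements of \<open>(ys)\<close> can take part in the exchange.\<close>

lemma (in cring) grade_le_number_of_radical_generators:
  assumes cs: "set cs \<subseteq> carrier R" and ys: "set ys \<subseteq> carrier R"
    and rad: "\<And>c. c \<in> set cs \<Longrightarrow> \<exists>n::nat. c [^] n \<in> Idl (set ys)"
    and g: "grade_ge R (Idl (set cs)) {\<zero>} (Suc (length ys))"
  shows "\<one> \<in> Idl (set ys)"
proof -
  interpret mpolys_UNIV R ..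
  let ?cs = "cs @ ys"
  let ?J = "Idl\<^bsub>T\<^esub> (const ` set ?cs)"
  have cc: "set ?cs \<subseteq> carrier R" using cs ys by simp
  have ccT: "const ` set ?cs \<subseteq> carrier T" and yT: "const ` set ys \<subseteq> carrier T" using cc const_closed by auto
  have Y: "ideal (Idl\<^bsub>T\<^esub> (const ` set ys)) T" by (rule T.genideal_ideal[OF yT])
  interpret S1: mult_subset T "{\<one>\<^bsub>T\<^esub>}"
    by (rule mult_subset.intro[OF mpoly_cring mult_subset_axioms.intro]) auto
  have powc: "const c [^]\<^bsub>T\<^esub> n = const (c [^] n)" if "c \<in> carrier R" for c and n :: nat
    using ring_hom_ring.hom_nat_pow[OF ring_hom_ringI2[OF ring_axioms T.ring_axioms const_hom] that, of n] by simp
  have cY: "const c \<in> Idl\<^bsub>T\<^esub> (const ` set ys)" if "c \<in> Idl (set ys)" for c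
    by (rule const_mem_Idl[OF ys that])
  have "const c \<in> S1.radical_at (Idl\<^bsub>T\<^esub> (const ` set ys))" if c: "c \<in> set ?cs" for c
  proof -
    have cR: "c \<in> carrier R" using c cc by blast
    have "\<exists>n::nat. c [^] n \<in> Idl (set ys)"
    proof (cases "c \<in> set cs")
      case False
      then have "c [^] (1::nat) \<in> Idl (set ys)" using c genideal_self[OF ys] cR by auto
      then show ?thesis by blast
    qed (rule rad)
    then obtain n :: nat where "c [^] n \<in> Idl (set ys)" by blast
    then have "\<one>\<^bsub>T\<^esub> \<otimes>\<^bsub>T\<^esub> const c [^]\<^bsub>T\<^esub> n \<in> Idl\<^bsub>T\<^esub> (const ` set ys)"
      using powc[OF cR] cY const_closed[OF cR] const_closed[of "c [^] n"] cR by simp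
    then show ?thesis using const_closed[OF cR] unfolding S1.radical_at_def by blast
  qed
  then have Jrad: "?J \<subseteq> S1.radical_at (Idl\<^bsub>T\<^esub> (const ` set ys))"
    by (intro T.genideal_minimal[OF S1.radical_at_ideal[OF Y]]) blast
  have radJ: "\<exists>n::nat. x [^]\<^bsub>T\<^esub> n \<in> Idl\<^bsub>T\<^esub> (const ` set ys)" if x: "x \<in> ?J" for x
  proof -
    have "x \<in> S1.radical_at (Idl\<^bsub>T\<^esub> (const ` set ys))" using x Jrad by blast
    then obtain n :: nat where "x \<in> carrier T" "\<one>\<^bsub>T\<^esub> \<otimes>\<^bsub>T\<^esub> x [^]\<^bsub>T\<^esub> n \<in> Idl\<^bsub>T\<^esub> (const ` set ys)"
      unfolding S1.radical_at_def by blast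
    then show ?thesis by (intro exI[of _ n]) simp
  qed
  have z: "Idl\<^bsub>T\<^esub> (const ` set ys \<union> {\<zero>\<^bsub>T\<^esub>}) = Idl\<^bsub>T\<^esub> (const ` set ys)"
    using T.Idl_Idl_Un[of "{}" "const ` set ys"] yT unfolding T.Idl_empty by simp
  obtain xs where xs: "set xs \<subseteq> Idl (set cs)" "length xs = Suc (length ys)" "wreg R {\<zero>} xs"
    using g unfolding grade_ge_iff_wreg by blast
  have xsc: "set xs \<subseteq> carrier R" using xs(1) ideal_sub[OF genideal_ideal[OF cs]] by blast
  have "wreg T {\<zero>\<^bsub>T\<^esub>} (map const xs)"
    by (rule wreg_const[OF xsc xs(3)])
  moreover have "set (map const xs) \<subseteq> ?J"
  proof -
    have "Idl (set cs) \<subseteq> Idl (set ?cs)" by (rule Idl_mono[OF _ cc]) simp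
    then show ?thesis using xs(1) const_mem_Idl[OF cc] unfolding set_map by blast
  qed
  ultimately have "grade_ge T ?J {\<zero>\<^bsub>T\<^esub>} (Suc (length ys))"
    unfolding grade_ge_iff_wreg using xs(2) by (intro exI[of _ "map const xs"]) simp
  then have "\<one>\<^bsub>T\<^esub> \<in> Idl\<^bsub>T\<^esub> (const ` set ys \<union> {\<zero>\<^bsub>T\<^esub>})"
    by (intro radical_generators_step[OF cc refl fin_gen_ideal_zero]) (use radJ z in auto)
  then have "\<one>\<^bsub>T\<^esub> {#} \<in> Idl (set ys)" unfolding z mem_Idl_const_iff[OF ys] by blast
  then show ?thesis by (simp add: T_one mon_def)
qed

text \<open>The number of variables is arbitrary: in general a prime \<open>p R[t]\<close> can have larger height than \<open>p\<close>, so the bound has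
  to come from Kronecker's theorem in \<open>R\<close> rather than from the height of \<open>p R[t]\<close>.\<close>

lemma (in mpolys) polynomial_grade_le_height:
  assumes P: "primeideal P R" and h: "height_above_le {\<zero>} P n"
    and g: "grade_ge T (Idl\<^bsub>T\<^esub> (const ` P)) {\<zero>\<^bsub>T\<^esub>} (Suc n)"
  shows False
proof -
  interpret P: primeideal P R by fact
  have oneP: "\<one> \<notin> P" using P.one_imp_carrier P.I_notcarr by blast
  interpret loc: mult_subset R "carrier R - P"
    by (rule mult_subset.intro[OF is_cring mult_subset_axioms.intro]) (use oneP P.I_prime in auto)
  have PI: "Idl P = P" by (rule Idl_of_ideal[OF P.is_ideal])
  obtain xs where xs: "set xs \<subseteq> Idl\<^bsub>T\<^esub> (const ` P)" "length xs = Suc n" "wreg T {\<zero>\<^bsub>T\<^esub>} xs"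
    using g unfolding grade_ge_iff_wreg by blast
  have xsT: "x \<in> carrier T" "x u \<in> P" if "x \<in> set xs" for x u
    using that xs(1) PI by (auto simp: mem_Idl_const_iff[OF P.a_subset])
  let ?G = "\<Union>x\<in>set xs. x ` {u. x u \<noteq> \<zero>}"
  have "finite {u. x u \<noteq> \<zero>}" if "x \<in> set xs" for x using xsT(1)[OF that] unfolding T_carrier by blast
  then have "finite ?G" by blast
  then have "\<exists>gs. set gs = ?G" by (rule finite_list)
  then obtain gs where gs: "set gs = ?G" by (elim exE)
  have gP: "set gs \<subseteq> P" unfolding gs using xsT(2) by blast
  then have gc: "set gs \<subseteq> carrier R" using P.a_subset by blast
  obtain ys where ys: "length ys = n" "set ys \<subseteq> P" "set gs \<subseteq> loc.radical_at (Idl (set ys))"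
    using kronecker[OF P h gP] by blast
  have yc: "set ys \<subseteq> carrier R" using ys(2) P.a_subset by blast
  let ?S = "const ` (carrier R - P)"
  interpret TS: mult_subset T ?S
  proof (rule mult_subset.intro[OF mpoly_cring mult_subset_axioms.intro])
    show "?S \<subseteq> carrier T" using const_closed by blast
    show "\<one>\<^bsub>T\<^esub> \<in> ?S" using oneP by (auto simp: T_one indexed_const_eq_mon)
    fix s t assume "s \<in> ?S" "t \<in> ?S"
    then obtain a b where "s = const a" "t = const b" "a \<in> carrier R - P" "b \<in> carrier R - P" by blast
    then have "s \<otimes>\<^bsub>T\<^esub> t = const (a \<otimes> b)" "a \<otimes> b \<in> carrier R - P"
      using ring_hom_mult[OF const_hom, of a b] loc.S_mult[of a b] by auto
    then show "s \<otimes>\<^bsub>T\<^esub> t \<in> ?S" by blast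
  qed
  let ?B = "localization T ?S"
  let ?e = "\<lambda>c. TS.\<eta> (const c)"
  have ec: "?e c \<in> carrier ?B" if "c \<in> carrier R" for c using TS.\<eta>_closed const_closed that by blast
  have eI: "Idl\<^bsub>?B\<^esub> (set (map ?e zs)) = TS.extended (Idl\<^bsub>T\<^esub> (const ` set zs))" if "set zs \<subseteq> carrier R" for zs
  proof -
    have "const ` set zs \<subseteq> carrier T" using that const_closed by blast
    then show ?thesis using TS.ext_eq_Idl[of "const ` set zs"] by (simp add: image_image)
  qed
  have yT: "const ` set ys \<subseteq> carrier T" and gT: "const ` set gs \<subseteq> carrier T" using yc gc const_closed by auto
  have iy: "ideal (Idl\<^bsub>T\<^esub> (const ` set ys)) T" by (rule T.genideal_ideal[OF yT])
  have "\<one>\<^bsub>?B\<^esub> \<in> Idl\<^bsub>?B\<^esub> (set (map ?e ys))"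
  proof (rule TS.B.grade_le_number_of_radical_generators)
    show "set (map ?e gs) \<subseteq> carrier ?B" "set (map ?e ys) \<subseteq> carrier ?B" using ec gc yc by auto
    fix c assume "c \<in> set (map ?e gs)"
    then obtain a where a: "a \<in> set gs" "c = ?e a" by auto
    have ac: "a \<in> carrier R" using a gc by blast
    obtain s k where s: "s \<in> carrier R - P" "s \<otimes> a [^] (k::nat) \<in> Idl (set ys)"
      using ys(3) a(1) unfolding loc.radical_at_def by blast
    have "const s \<otimes>\<^bsub>T\<^esub> const a [^]\<^bsub>T\<^esub> k = const (s \<otimes> a [^] k)"
      using ring_hom_mult[OF const_hom, of s "a [^] k"] s(1) ac
        ring_hom_ring.hom_nat_pow[OF ring_hom_ringI2[OF ring_axioms T.ring_axioms const_hom] ac, of k] by simp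
    also have "\<dots> \<in> Idl\<^bsub>T\<^esub> (const ` set ys)" by (rule const_mem_Idl[OF yc s(2)])
    finally have "TS.\<eta> (const a [^]\<^bsub>T\<^esub> k) \<in> TS.extended (Idl\<^bsub>T\<^esub> (const ` set ys))"
      using TS.\<eta>_mem_ext[OF iy, of "const a [^]\<^bsub>T\<^esub> k"] s(1) const_closed[OF ac] by auto
    moreover have "TS.\<eta> (const a [^]\<^bsub>T\<^esub> k) = c [^]\<^bsub>?B\<^esub> k"
      using ring_hom_ring.hom_nat_pow[OF ring_hom_ringI2[OF T.ring_axioms TS.B.ring_axioms TS.\<eta>_hom] const_closed[OF ac], of k] a(2)
      by simp
    ultimately show "\<exists>k::nat. c [^]\<^bsub>?B\<^esub> k \<in> Idl\<^bsub>?B\<^esub> (set (map ?e ys))" unfolding eI[OF yc] by auto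
  next
    have w: "wreg ?B {\<zero>\<^bsub>?B\<^esub>} (map TS.\<eta> xs)"
      by (rule TS.wreg_localize[OF _ xs(3)]) (use xsT(1) in blast)
    have "set (map TS.\<eta> xs) \<subseteq> Idl\<^bsub>?B\<^esub> (set (map ?e gs))"
      unfolding eI[OF gc] unfolding set_map
    proof (rule image_subsetI)
      fix x assume x: "x \<in> set xs"
      have "x u \<in> Idl (set gs)" for u
      proof (cases "x u = \<zero>")
        case True
        then show ?thesis using additive_subgroup.zero_closed[OF ideal.axioms(1)[OF genideal_ideal[OF gc]]] by simp
      next
        case False
        then have "x u \<in> set gs" unfolding gs using x by blast
        then show ?thesis using genideal_self[OF gc] by blast
      qed
      then have "x \<in> Idl\<^bsub>T\<^esub> (const ` set gs)" using xsT(1)[OF x] by (simp add: mem_Idl_const_iff[OF gc])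
      then show "TS.\<eta> x \<in> TS.extended (Idl\<^bsub>T\<^esub> (const ` set gs))"
        unfolding TS.\<eta>_def TS.extended_def using TS.S_one by blast
    qed
    then show "grade_ge ?B (Idl\<^bsub>?B\<^esub> (set (map ?e gs))) {\<zero>\<^bsub>?B\<^esub>} (Suc (length (map ?e ys)))"
      unfolding grade_ge_iff_wreg using w xs(2) ys(1) by (intro exI[of _ "map TS.\<eta> xs"]) simp
  qed
  then obtain s where s: "s \<in> ?S" "s \<otimes>\<^bsub>T\<^esub> \<one>\<^bsub>T\<^esub> \<in> Idl\<^bsub>T\<^esub> (const ` set ys)"
    unfolding eI[OF yc] TS.\<eta>_one[symmetric] using TS.\<eta>_mem_ext[OF iy T.one_closed] by blast
  then obtain a where a: "a \<in> carrier R - P" "const a \<in> Idl\<^bsub>T\<^esub> (const ` set ys)" using const_closed by auto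
  have "const a {#} \<in> Idl (set ys)" using a(2) unfolding mem_Idl_const_iff[OF yc] by blast
  moreover have "Idl (set ys) \<subseteq> P" by (rule genideal_minimal[OF P.is_ideal ys(2)])
  ultimately show False using a(1) by (auto simp: indexed_const_def)
qed

section \<open>Changing variables and coefficients\<close>

locale mpoly_restrict = mpolys R V + W: mpolys R W for R (structure) and V W +
  assumes VW: "V \<subseteq> W"
begin

lemma sub_carrier: "carrier T \<subseteq> carrier W.T"
proof
  fix f assume "f \<in> carrier T"
  then show "f \<in> carrier W.T" using VW unfolding T_carrier W.T_carrier by blast
qed

lemma ops_eq: "f \<oplus>\<^bsub>W.T\<^esub> g = f \<oplus>\<^bsub>T\<^esub> g" "f \<otimes>\<^bsub>W.T\<^esub> g = f \<otimes>\<^bsub>T\<^esub> g" "\<zero>\<^bsub>W.T\<^esub> = \<zero>\<^bsub>T\<^esub>"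
  by (simp_all add: mpoly_def)

lemma generic_eq: "W.generic t cs = generic t cs"
  by (induction cs) (simp_all add: ops_eq)

text \<open>Setting to zero the monomials that involve a variable outside \<open>V\<close>; this retraction is linear over \<open>R[V]\<close>.\<close>

definition proj :: "(nat multiset \<Rightarrow> 'a) \<Rightarrow> nat multiset \<Rightarrow> 'a" where
  "proj f = (\<lambda>u. if set_mset u \<subseteq> V then f u else \<zero>)"

lemma proj_closed:
  assumes f: "f \<in> carrier W.T"
  shows "proj f \<in> carrier T"
proof (rule T_carrierI)
  show "proj f u \<in> carrier R" for u using W.coeff_closed[OF f] by (simp add: proj_def)
  show "{u. proj f u \<noteq> \<zero>} \<subseteq> {u. f u \<noteq> \<zero>}" by (auto simp: proj_def)
  show "finite {u. f u \<noteq> \<zero>}" using f unfolding W.T_carrier by blast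
  show "set_mset u \<subseteq> V" if "proj f u \<noteq> \<zero>" for u using that by (auto simp: proj_def split: if_splits)
qed

lemma proj_id: "f \<in> carrier T \<Longrightarrow> proj f = f"
  unfolding T_carrier proj_def by (rule ext) (metis (no_types))

lemma proj_add: "proj (f \<oplus>\<^bsub>W.T\<^esub> g) = proj f \<oplus>\<^bsub>T\<^esub> proj g"
  by (auto simp: proj_def T_add W.T_add)

lemma proj_mult:
  assumes h: "h \<in> carrier T" and f: "f \<in> carrier W.T"
  shows "proj (h \<otimes>\<^bsub>W.T\<^esub> f) = h \<otimes>\<^bsub>T\<^esub> proj f"
  using h
proof (induction h rule: mpoly_induct)
  case (mon c u)
  have pc: "proj f w \<in> carrier R" for w using coeff_closed[OF proj_closed[OF f]] .
  show ?case
  proof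
    fix w
    have "set_mset (w - u) \<subseteq> V \<longleftrightarrow> set_mset w \<subseteq> V" if "u \<subseteq># w"
    proof -
      have "w = u + (w - u)" using that by simp
      then have "set_mset w = set_mset u \<union> set_mset (w - u)" by (metis set_mset_union)
      then show ?thesis using mon(2) by blast
    qed
    moreover have "(mon R c u \<otimes>\<^bsub>W.T\<^esub> f) w = (if u \<subseteq># w then c \<otimes> f (w - u) else \<zero>)"
      by (rule W.mon_mult_apply[OF mon(1) W.coeff_closed[OF f]])
    moreover have "(mon R c u \<otimes>\<^bsub>T\<^esub> proj f) w = (if u \<subseteq># w then c \<otimes> proj f (w - u) else \<zero>)"
      by (rule mon_mult_apply[OF mon(1) pc])
    ultimately show "proj (mon R c u \<otimes>\<^bsub>W.T\<^esub> f) w = (mon R c u \<otimes>\<^bsub>T\<^esub> proj f) w"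
      using mon(1) by (simp add: proj_def)
  qed
next
  case (add g h)
  have "g \<in> carrier W.T" "h \<in> carrier W.T" using add sub_carrier by auto
  then have "proj ((g \<oplus>\<^bsub>T\<^esub> h) \<otimes>\<^bsub>W.T\<^esub> f) = proj (g \<otimes>\<^bsub>W.T\<^esub> f) \<oplus>\<^bsub>T\<^esub> proj (h \<otimes>\<^bsub>W.T\<^esub> f)"
    using W.T_l_distr[of g h f] f proj_add by (simp add: ops_eq(1))
  then show ?case using add proj_closed[OF f] by (simp add: T_l_distr)
qed

lemma proj_Idl:
  assumes Y: "Y \<subseteq> carrier T" and g: "g \<in> Idl\<^bsub>W.T\<^esub> Y"
  shows "proj g \<in> Idl\<^bsub>T\<^esub> Y"
proof -
  interpret I: ideal "Idl\<^bsub>T\<^esub> Y" T by (rule T.genideal_ideal[OF Y])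
  let ?K = "{g \<in> carrier W.T. \<forall>h\<in>carrier W.T. proj (h \<otimes>\<^bsub>W.T\<^esub> g) \<in> Idl\<^bsub>T\<^esub> Y}"
  have "ideal ?K W.T"
  proof (rule W.T.idealI_cring)
    have "proj \<zero>\<^bsub>W.T\<^esub> = \<zero>\<^bsub>T\<^esub>" by (auto simp: proj_def T_zero W.T_zero)
    then show "\<zero>\<^bsub>W.T\<^esub> \<in> ?K" using I.zero_closed by simp
    show "h \<otimes>\<^bsub>W.T\<^esub> f \<in> ?K" if "f \<in> ?K" "h \<in> carrier W.T" for f h
      using that W.T.m_assoc[symmetric] by auto
  qed (auto simp: W.T.r_distr proj_add I.a_closed)
  moreover have "Y \<subseteq> ?K"
  proof
    fix y assume y: "y \<in> Y"
    have yT: "y \<in> carrier T" and yc: "y \<in> carrier W.T" using y Y sub_carrier by auto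
    have "proj (h \<otimes>\<^bsub>W.T\<^esub> y) \<in> Idl\<^bsub>T\<^esub> Y" if h: "h \<in> carrier W.T" for h
    proof -
      have "proj (h \<otimes>\<^bsub>W.T\<^esub> y) = y \<otimes>\<^bsub>T\<^esub> proj h"
        using proj_mult[OF yT h] W.T.m_comm[OF yc h] by simp
      then show ?thesis using I.I_r_closed[OF _ proj_closed[OF h]] T.genideal_self[OF Y] y by auto
    qed
    then show "y \<in> ?K" using yc by blast
  qed
  ultimately have "Idl\<^bsub>W.T\<^esub> Y \<subseteq> ?K" by (rule W.T.genideal_minimal)
  then have "g \<in> ?K" using g by blast
  then have "proj (\<one>\<^bsub>W.T\<^esub> \<otimes>\<^bsub>W.T\<^esub> g) \<in> Idl\<^bsub>T\<^esub> Y" by blast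
  then show ?thesis using \<open>g \<in> ?K\<close> by simp
qed

lemma Idl_sub:
  assumes Y: "Y \<subseteq> carrier T"
  shows "Idl\<^bsub>T\<^esub> Y \<subseteq> Idl\<^bsub>W.T\<^esub> Y"
proof -
  have "(\<lambda>f. f) \<in> ring_hom T W.T"
    by (rule ring_hom_memI) (use sub_carrier in \<open>auto simp: ops_eq T_one W.T_one\<close>)
  then show ?thesis using ring_hom_Idl[OF mpoly_cring W.mpoly_cring _ Y, of "\<lambda>f. f"] by simp
qed

text \<open>\<open>R[V]\<close> is a direct summand of \<open>R[W]\<close> as a module over itself, by \<open>proj\<close>, so ideals of \<open>R[V]\<close> are contracted from
  \<open>R[W]\<close>.\<close>

lemma wreg_restrict:
  assumes xs: "set xs \<subseteq> carrier T" "wreg W.T {\<zero>\<^bsub>W.T\<^esub>} xs"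
  shows "wreg T {\<zero>\<^bsub>T\<^esub>} xs"
proof -
  have "wreg T {\<zero>\<^bsub>T\<^esub>} (map (\<lambda>x. x) xs)"
  proof (rule wreg_map[OF W.mpoly_cring mpoly_cring sub_carrier _ _ xs])
    fix Y x assume Y: "Y \<subseteq> carrier T" and x: "x \<in> carrier T" and nz: "nzd_mod W.T (Idl\<^bsub>W.T\<^esub> Y) x"
    have "nzd_mod T (Idl\<^bsub>T\<^esub> Y) x"
      unfolding nzd_mod_def
    proof (intro ballI impI)
      fix y assume y: "y \<in> carrier T" "x \<otimes>\<^bsub>T\<^esub> y \<in> Idl\<^bsub>T\<^esub> Y"
      then have "x \<otimes>\<^bsub>W.T\<^esub> y \<in> Idl\<^bsub>W.T\<^esub> Y" using Idl_sub[OF Y] by (auto simp: ops_eq)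
      then have "y \<in> Idl\<^bsub>W.T\<^esub> Y" using nz y(1) sub_carrier by (auto simp: nzd_mod_def)
      then show "y \<in> Idl\<^bsub>T\<^esub> Y" using proj_Idl[OF Y] proj_id[OF y(1)] by metis
    qed
    then show "nzd_mod T (Idl\<^bsub>T\<^esub> ((\<lambda>x. x) ` Y)) x" by simp
  qed simp
  then show ?thesis by simp
qed

end

definition pmap :: "('a \<Rightarrow> 'b) \<Rightarrow> (nat multiset \<Rightarrow> 'a) \<Rightarrow> nat multiset \<Rightarrow> 'b" where
  "pmap h f = (\<lambda>u. h (f u))"

locale mpoly_hom = A: mpolys A V + B: mpolys B V for A :: "('a, 'm) ring_scheme" and B :: "('b, 'k) ring_scheme" and V +
  fixes h :: "'a \<Rightarrow> 'b"
  assumes h: "h \<in> ring_hom A B"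
begin

lemma h_zero: "h \<zero>\<^bsub>A\<^esub> = \<zero>\<^bsub>B\<^esub>" using ring_hom_zero[OF h A.ring_axioms B.ring_axioms] .

lemma pmap_closed:
  assumes f: "f \<in> carrier A.T"
  shows "pmap h f \<in> carrier B.T"
proof (rule B.T_carrierI)
  show "pmap h f u \<in> carrier B" for u using A.coeff_closed[OF f] ring_hom_closed[OF h] by (simp add: pmap_def)
  show "{u. pmap h f u \<noteq> \<zero>\<^bsub>B\<^esub>} \<subseteq> {u. f u \<noteq> \<zero>\<^bsub>A\<^esub>}" using h_zero by (auto simp: pmap_def)
  show "finite {u. f u \<noteq> \<zero>\<^bsub>A\<^esub>}" using f unfolding A.T_carrier by blast
  show "set_mset u \<subseteq> V" if "pmap h f u \<noteq> \<zero>\<^bsub>B\<^esub>" for u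
  proof -
    have "f u \<noteq> \<zero>\<^bsub>A\<^esub>" using that h_zero by (auto simp: pmap_def)
    then show ?thesis using f unfolding A.T_carrier by blast
  qed
qed

lemma pmap_add: "f \<in> carrier A.T \<Longrightarrow> g \<in> carrier A.T \<Longrightarrow> pmap h (f \<oplus>\<^bsub>A.T\<^esub> g) = pmap h f \<oplus>\<^bsub>B.T\<^esub> pmap h g"
  using ring_hom_add[OF h A.coeff_closed A.coeff_closed] by (auto simp: pmap_def A.T_add B.T_add)

lemma pmap_mon: "pmap h (mon A c u) = mon B (h c) u"
  using h_zero by (auto simp: pmap_def mon_def)

lemma pmap_mult:
  assumes f: "f \<in> carrier A.T" and g: "g \<in> carrier A.T"
  shows "pmap h (f \<otimes>\<^bsub>A.T\<^esub> g) = pmap h f \<otimes>\<^bsub>B.T\<^esub> pmap h g"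
  using f
proof (induction f rule: A.mpoly_induct)
  case (mon c u)
  have hc: "h c \<in> carrier B" using ring_hom_closed[OF h mon(1)] .
  have pg: "pmap h g w \<in> carrier B" for w by (rule B.coeff_closed[OF pmap_closed[OF g]])
  show ?case
  proof
    fix w
    have "pmap h (mon A c u \<otimes>\<^bsub>A.T\<^esub> g) w = (if u \<subseteq># w then h c \<otimes>\<^bsub>B\<^esub> pmap h g (w - u) else \<zero>\<^bsub>B\<^esub>)"
      using ring_hom_mult[OF h mon(1) A.coeff_closed[OF g]] h_zero A.mon_mult_apply[OF mon(1) A.coeff_closed[OF g]]
      by (simp add: pmap_def)
    also have "\<dots> = (mon B (h c) u \<otimes>\<^bsub>B.T\<^esub> pmap h g) w" by (rule B.mon_mult_apply[OF hc pg, symmetric])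
    finally show "pmap h (mon A c u \<otimes>\<^bsub>A.T\<^esub> g) w = (pmap h (mon A c u) \<otimes>\<^bsub>B.T\<^esub> pmap h g) w" unfolding pmap_mon .
  qed
next
  case (add f f')
  then show ?case using g by (simp add: A.T_l_distr B.T_l_distr pmap_add pmap_closed A.T_mult_closed)
qed

lemma pmap_hom: "pmap h \<in> ring_hom A.T B.T"
  by (rule ring_hom_memI)
    (simp_all add: pmap_closed pmap_add pmap_mult A.T_one B.T_one pmap_mon ring_hom_one[OF h])

lemma pmap_const: "pmap h (A.const c) = B.const (h c)"
  using pmap_mon[of c "{#}"] by (simp add: A.indexed_const_eq_mon B.indexed_const_eq_mon)

lemma pmap_generic:
  assumes t: "t \<in> V"
  shows "set cs \<subseteq> carrier A \<Longrightarrow> pmap h (A.generic t cs) = B.generic t (map h cs)"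
proof (induction cs)
  case Nil
  then show ?case using h_zero by (auto simp: pmap_def A.T_zero B.T_zero)
next
  case (Cons c cs)
  have g: "A.generic t cs \<in> carrier A.T" using A.generic_closed[OF t] Cons.prems by simp
  have "pmap h (A.var t) = B.var t" unfolding A.var_def B.var_def pmap_mon ring_hom_one[OF h] ..
  then show ?case
    using Cons g A.const_closed[of c] A.var_closed[OF t]
    by (simp add: pmap_add pmap_mult pmap_const A.T_mult_closed)
qed

lemma pmap_Idl:
  "Y \<subseteq> carrier A.T \<Longrightarrow> f \<in> Idl\<^bsub>A.T\<^esub> Y \<Longrightarrow> pmap h f \<in> Idl\<^bsub>B.T\<^esub> (pmap h ` Y)"
  using ring_hom_Idl[OF A.mpoly_cring B.mpoly_cring pmap_hom] by blast

end

section \<open>Direct limits\<close>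

context direct_system
begin

lemma below_common:
  assumes "i \<in> \<Gamma>" "j \<in> \<Gamma>"
  obtains k where "k \<in> \<Gamma>" "below i k" "below j k"
  using directed[OF assms] by blast

lemma ex_common_index:
  assumes "finite E" "E \<subseteq> carrier L"
  shows "\<exists>k\<in>\<Gamma>. \<forall>e\<in>E. \<exists>x\<in>carrier (A k). e = cls k x"
  using assms
proof (induction E rule: finite_induct)
  case empty
  then show ?case using nonempty by blast
next
  case (insert e E)
  then obtain k where k: "k \<in> \<Gamma>" "\<forall>e\<in>E. \<exists>x\<in>carrier (A k). e = cls k x" by auto
  have "e \<in> carrier L" using insert.prems by simp
  then obtain i x where i: "i \<in> \<Gamma>" "x \<in> carrier (A i)" "e = cls i x" by (rule limit_carrierE)
  obtain n where n: "n \<in> \<Gamma>" "below k n" "below i n" using below_common[OF k(1) i(1)] by blast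
  have lift: "\<exists>y\<in>carrier (A n). cls j z = cls n y" if "j \<in> \<Gamma>" "below j n" "z \<in> carrier (A j)" for j z
    using cls_hom[OF that(1) n(1) that(2,3)] hom_closed[OF that(1) n(1) that(2,3)] by metis
  have "\<exists>y\<in>carrier (A n). e' = cls n y" if e': "e' \<in> insert e E" for e'
  proof (cases "e' = e")
    case True
    then show ?thesis using lift[OF i(1) n(3) i(2)] i(3) by simp
  next
    case False
    then obtain x' where x': "x' \<in> carrier (A k)" "e' = cls k x'" using e' k(2) by blast
    then show ?thesis using lift[OF k(1) n(2) x'(1)] by simp
  qed
  then show ?case using n(1) by blast
qed

lemma contraction_prime:
  assumes "i \<in> \<Gamma>" "primeideal Q L"
  shows "primeideal (limit_contraction \<Gamma> below A \<phi> Q i) (A i)"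
proof -
  interpret Ai: cring "A i" by (rule cring[OF assms(1)])
  interpret L: cring L by (rule direct_limit_cring)
  interpret h: ring_hom_ring "A i" L "cls i"
    by (rule ring_hom_ringI2[OF Ai.ring_axioms L.ring_axioms limit_map_ring_hom[OF assms(1)]])
  show ?thesis
    unfolding limit_contraction_def by (rule h.primeideal_vimage[OF Ai.is_cring assms(2)])
qed

text \<open>For each pair \<open>p \<subset> q\<close> in the chain an element of \<open>q - p\<close> is chosen; beyond an index at which all these elements
  are represented, the contractions are still distinct.\<close>

lemma contraction_prime_chain:
  assumes ps: "prime_chain L ps"
  shows "\<exists>k\<in>\<Gamma>. \<forall>i\<in>\<Gamma>. below k i \<longrightarrow> prime_chain (A i) (map (\<lambda>Q. limit_contraction \<Gamma> below A \<phi> Q i) ps)"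
proof -
  define e where "e p q = (SOME x. x \<in> q - p)" for p q :: "('i \<times> 'a) set set"
  have e: "e p q \<in> q - p" if "p \<subset> q" for p q using that unfolding e_def by (intro someI_ex[of "\<lambda>x. x \<in> q - p"]) blast
  let ?E = "{e p q | p q. p \<in> set ps \<and> q \<in> set ps \<and> p \<subset> q}"
  have pr: "primeideal q L" if "q \<in> set ps" for q using ps that by (simp add: prime_chain_def)
  have "?E \<subseteq> (\<lambda>(p, q). e p q) ` (set ps \<times> set ps)" by auto
  then have "finite ?E" by (rule finite_subset) simp
  moreover have "?E \<subseteq> carrier L"
  proof
    fix x assume "x \<in> ?E"
    then obtain p q where "q \<in> set ps" "p \<subset> q" "x = e p q" by blast
    then have x: "x \<in> q" and q: "primeideal q L" using e[of p q] pr by auto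
    show "x \<in> carrier L" by (rule ideal.Icarr[OF primeideal.axioms(1)[OF q] x])
  qed
  ultimately obtain k where k: "k \<in> \<Gamma>" "\<forall>e\<in>?E. \<exists>x\<in>carrier (A k). e = cls k x" using ex_common_index[of ?E] by blast
  have "prime_chain (A i) (map (\<lambda>Q. limit_contraction \<Gamma> below A \<phi> Q i) ps)" if i: "i \<in> \<Gamma>" "below k i" for i
  proof -
    let ?c = "\<lambda>Q. limit_contraction \<Gamma> below A \<phi> Q i"
    have "?c p \<subset> ?c q" if pq: "p \<in> set ps" "q \<in> set ps" "p \<subset> q" for p q
    proof -
      have "e p q \<in> ?E" using pq by blast
      then have "\<exists>x\<in>carrier (A k). e p q = cls k x" by (rule bspec[OF k(2)])
      then obtain x where x: "x \<in> carrier (A k)" "e p q = cls k x" by (elim bexE)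
      then have "cls i (\<phi> k i x) = e p q" "\<phi> k i x \<in> carrier (A i)"
        using cls_hom[OF k(1) i x(1)] hom_closed[OF k(1) i x(1)] by auto
      then have "\<phi> k i x \<in> ?c q" "\<phi> k i x \<notin> ?c p" using e[OF pq(3)] by (auto simp: limit_contraction_def)
      moreover have "?c p \<subseteq> ?c q" using pq(3) by (auto simp: limit_contraction_def)
      ultimately show ?thesis by blast
    qed
    then have "sorted_wrt (\<lambda>p q. ?c p \<subset> ?c q) ps"
      using ps sorted_wrt_mono_rel[of ps "(\<subset>)" "\<lambda>p q. ?c p \<subset> ?c q"] by (simp add: prime_chain_def)
    moreover have "\<forall>Q\<in>set (map ?c ps). primeideal Q (A i)"
      using contraction_prime[OF i(1)] pr by auto
    ultimately show ?thesis using ps by (simp add: prime_chain_def sorted_wrt_map)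
  qed
  then show ?thesis using k(1) by blast
qed

abbreviation PA where "PA i \<equiv> mpoly (A i) UNIV"
abbreviation PL where "PL \<equiv> mpoly L UNIV"

lemma mpolys_A: "i \<in> \<Gamma> \<Longrightarrow> mpolys (A i)"
  by (rule mpolys.intro[OF cring])

lemma mpolys_L: "mpolys L"
  by (rule mpolys.intro[OF direct_limit_cring])

lemma mpoly_hom_cls: "i \<in> \<Gamma> \<Longrightarrow> mpoly_hom (A i) L (cls i)"
  by (intro mpoly_hom.intro mpoly_hom_axioms.intro mpolys_A mpolys_L limit_map_ring_hom)

lemma mpoly_hom_trans: "i \<in> \<Gamma> \<Longrightarrow> j \<in> \<Gamma> \<Longrightarrow> below i j \<Longrightarrow> mpoly_hom (A i) (A j) (\<phi> i j)"
  by (intro mpoly_hom.intro mpoly_hom_axioms.intro mpolys_A hom)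

lemma pmap_cls_trans:
  assumes "i \<in> \<Gamma>" "j \<in> \<Gamma>" "below i j" "f \<in> carrier (PA i)"
  shows "pmap (cls j) (pmap (\<phi> i j) f) = pmap (cls i) f"
  unfolding pmap_def using cls_hom[OF assms(1-3) mpolys.coeff_closed[OF mpolys_A[OF assms(1)] assms(4)]] by simp

lemma pmap_trans:
  assumes "i \<in> \<Gamma>" "j \<in> \<Gamma>" "k \<in> \<Gamma>" "below i j" "below j k" "f \<in> carrier (PA i)"
  shows "pmap (\<phi> j k) (pmap (\<phi> i j) f) = pmap (\<phi> i k) f"
  unfolding pmap_def using hom_trans[OF assms(1-5) mpolys.coeff_closed[OF mpolys_A[OF assms(1)] assms(6)]] by simp

lemma pmap_trans_closed:
  assumes "i \<in> \<Gamma>" "j \<in> \<Gamma>" "below i j" "f \<in> carrier (PA i)"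
  shows "pmap (\<phi> i j) f \<in> carrier (PA j)"
  using mpoly_hom.pmap_closed[OF mpoly_hom_trans[OF assms(1-3)] assms(4)] .

lemma PA_cring: "i \<in> \<Gamma> \<Longrightarrow> cring (PA i)"
  by (rule mpolys.mpoly_cring[OF mpolys_A])

lemma PL_cring: "cring PL"
  by (rule mpolys.mpoly_cring[OF mpolys_L])

text \<open>The ideal generated by \<open>Y\<close>, a set of polynomials over \<open>A i\<close>, in the polynomial ring over \<open>A j\<close>.\<close>

abbreviation level_ideal where "level_ideal i Y j \<equiv> Idl\<^bsub>PA j\<^esub> (pmap (\<phi> i j) ` Y)"

lemma pmap_image_closed:
  "\<lbrakk>i \<in> \<Gamma>; j \<in> \<Gamma>; below i j; Y \<subseteq> carrier (PA i)\<rbrakk> \<Longrightarrow> pmap (\<phi> i j) ` Y \<subseteq> carrier (PA j)"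
  using pmap_trans_closed by blast

lemma level_ideal_ideal:
  assumes "i \<in> \<Gamma>" "j \<in> \<Gamma>" "below i j" "Y \<subseteq> carrier (PA i)"
  shows "ideal (level_ideal i Y j) (PA j)"
  using ring.genideal_ideal[OF cring.axioms(1)[OF PA_cring[OF assms(2)]] pmap_image_closed[OF assms]] .

lemma level_ideal_up:
  assumes i: "i \<in> \<Gamma>" and j: "j \<in> \<Gamma>" "below i j" and k: "k \<in> \<Gamma>" "below j k"
    and Y: "Y \<subseteq> carrier (PA i)" and g: "g \<in> level_ideal i Y j"
  shows "pmap (\<phi> j k) g \<in> level_ideal i Y k"
proof -
  have "pmap (\<phi> j k) g \<in> Idl\<^bsub>PA k\<^esub> (pmap (\<phi> j k) ` (pmap (\<phi> i j) ` Y))"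
    by (rule mpoly_hom.pmap_Idl[OF mpoly_hom_trans[OF j(1) k] pmap_image_closed[OF i j Y] g])
  moreover have "pmap (\<phi> j k) ` (pmap (\<phi> i j) ` Y) = pmap (\<phi> i k) ` Y"
    unfolding image_image using pmap_trans[OF i j(1) k(1) j(2) k(2)] Y by (intro image_cong) auto
  ultimately show ?thesis by simp
qed

lemma PL_lift:
  assumes "f \<in> carrier PL"
  shows "\<exists>i\<in>\<Gamma>. \<exists>g\<in>carrier (PA i). f = pmap (cls i) g"
  using assms
proof (induction f rule: mpolys.mpoly_induct[OF mpolys_L, consumes 1, case_names mon add])
  case (mon c u)
  obtain i x where i: "i \<in> \<Gamma>" "x \<in> carrier (A i)" "c = cls i x" using mon(1) by (rule limit_carrierE)
  have "mon (A i) x u \<in> carrier (PA i)" by (rule mpolys.mon_closed[OF mpolys_A[OF i(1)] i(2)]) simp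
  moreover have "mon L c u = pmap (cls i) (mon (A i) x u)"
    using mpoly_hom.pmap_mon[OF mpoly_hom_cls[OF i(1)], of x u] i(3) by simp
  ultimately show ?case using i(1) by blast
next
  case (add f g)
  then obtain i f' j g' where f: "i \<in> \<Gamma>" "f' \<in> carrier (PA i)" "f = pmap (cls i) f'"
    and g: "j \<in> \<Gamma>" "g' \<in> carrier (PA j)" "g = pmap (cls j) g'" by blast
  obtain k where k: "k \<in> \<Gamma>" "below i k" "below j k" using below_common[OF f(1) g(1)] by blast
  let ?f = "pmap (\<phi> i k) f'" and ?g = "pmap (\<phi> j k) g'"
  have c: "?f \<in> carrier (PA k)" "?g \<in> carrier (PA k)"
    using pmap_trans_closed f g k by blast+
  have "f = pmap (cls k) ?f" "g = pmap (cls k) ?g"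
    using pmap_cls_trans[OF f(1) k(1,2) f(2)] pmap_cls_trans[OF g(1) k(1,3) g(2)] f(3) g(3) by simp_all
  then have "f \<oplus>\<^bsub>PL\<^esub> g = pmap (cls k) (?f \<oplus>\<^bsub>PA k\<^esub> ?g)"
    using mpoly_hom.pmap_add[OF mpoly_hom_cls[OF k(1)] c] by simp
  moreover have "?f \<oplus>\<^bsub>PA k\<^esub> ?g \<in> carrier (PA k)"
    by (rule mpolys.T_add_closed[OF mpolys_A[OF k(1)] c])
  ultimately show ?case using k(1) by blast
qed

lemma PA_eq_eventually:
  assumes i: "i \<in> \<Gamma>" and f: "f \<in> carrier (PA i)" and g: "g \<in> carrier (PA i)"
    and e: "pmap (cls i) f = pmap (cls i) g"
  shows "\<exists>j\<in>\<Gamma>. below i j \<and> pmap (\<phi> i j) f = pmap (\<phi> i j) g"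
proof -
  interpret mpolys "A i" UNIV by (rule mpolys_A[OF i])
  have fc: "f u \<in> carrier (A i)" and gc: "g u \<in> carrier (A i)" for u using coeff_closed f g by auto
  have "\<exists>j\<in>\<Gamma>. below i j \<and> (\<forall>u\<in>F. \<phi> i j (f u) = \<phi> i j (g u))" if "finite F" for F
    using that
  proof (induction F rule: finite_induct)
    case empty
    then show ?case using i below_refl by blast
  next
    case (insert u F)
    then obtain j where j: "j \<in> \<Gamma>" "below i j" "\<forall>u\<in>F. \<phi> i j (f u) = \<phi> i j (g u)" by blast
    have "cls i (f u) = cls i (g u)" using e unfolding pmap_def by metis
    then obtain k where k: "k \<in> \<Gamma>" "below i k" "\<phi> i k (f u) = \<phi> i k (g u)"
      using cls_eq_iff[OF i i fc gc] by blast
    obtain n where n: "n \<in> \<Gamma>" "below j n" "below k n" using below_common[OF j(1) k(1)] by blast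
    have "\<phi> i n (f v) = \<phi> i n (g v)" if v: "v \<in> insert u F" for v
    proof (cases "v = u")
      case True
      then show ?thesis
        using hom_trans[OF i k(1) n(1) k(2) n(3) fc[of u]] hom_trans[OF i k(1) n(1) k(2) n(3) gc[of u]] k(3) by simp
    next
      case False
      then have "\<phi> i j (f v) = \<phi> i j (g v)" using v j(3) by blast
      then show ?thesis
        using hom_trans[OF i j(1) n(1) j(2) n(2) fc[of v]] hom_trans[OF i j(1) n(1) j(2) n(2) gc[of v]] by simp
    qed
    moreover have "below i n" using below_trans[OF i j(1) n(1) j(2) n(2)] .
    ultimately show ?case using n(1) by blast
  qed
  moreover have "finite ({u. f u \<noteq> \<zero>\<^bsub>A i\<^esub>} \<union> {u. g u \<noteq> \<zero>\<^bsub>A i\<^esub>})"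
    using f g unfolding T_carrier by simp
  ultimately obtain j where j: "j \<in> \<Gamma>" "below i j"
    "\<forall>u\<in>{u. f u \<noteq> \<zero>\<^bsub>A i\<^esub>} \<union> {u. g u \<noteq> \<zero>\<^bsub>A i\<^esub>}. \<phi> i j (f u) = \<phi> i j (g u)"
    by blast
  have "\<phi> i j (f u) = \<phi> i j (g u)" for u
    using j(3) by (cases "f u = \<zero>\<^bsub>A i\<^esub> \<and> g u = \<zero>\<^bsub>A i\<^esub>") auto
  then have "pmap (\<phi> i j) f = pmap (\<phi> i j) g" unfolding pmap_def by simp
  then show ?thesis using j by blast
qed

text \<open>The classes of elements of the ideals at the various levels form an ideal of the limit: two of them, or one of
  them and a factor, can be compared at a common index.\<close>

lemma PL_Idl_lift:
  assumes i: "i \<in> \<Gamma>" and Y: "Y \<subseteq> carrier (PA i)" and f: "f \<in> Idl\<^bsub>PL\<^esub> (pmap (cls i) ` Y)"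
  shows "\<exists>j\<in>\<Gamma>. below i j \<and> (\<exists>g\<in>level_ideal i Y j. f = pmap (cls j) g)"
proof -
  let ?I = "level_ideal i Y"
  let ?K = "{f. \<exists>j\<in>\<Gamma>. below i j \<and> (\<exists>g\<in>?I j. f = pmap (cls j) g)}"
  interpret PL: cring PL by (rule PL_cring)
  note id = level_ideal_ideal[OF i _ _ Y] and up = level_ideal_up[OF i _ _ _ _ Y]
  have gc: "g \<in> carrier (PA j)" if "j \<in> \<Gamma>" "below i j" "g \<in> ?I j" for j g
    using ideal.Icarr[OF id[OF that(1,2)] that(3)] .
  have "ideal ?K PL"
  proof (rule PL.idealI_cring)
    show "?K \<subseteq> carrier PL" using gc mpoly_hom.pmap_closed[OF mpoly_hom_cls] by blast
    have "\<zero>\<^bsub>PA i\<^esub> \<in> ?I i"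
      using additive_subgroup.zero_closed[OF ideal.axioms(1)[OF id[OF i below_refl[OF i]]]] .
    moreover have "pmap (cls i) \<zero>\<^bsub>PA i\<^esub> = \<zero>\<^bsub>PL\<^esub>"
      using ring_hom_zero[OF mpoly_hom.pmap_hom[OF mpoly_hom_cls[OF i]] cring.axioms(1)[OF PA_cring[OF i]] PL.ring_axioms] .
    ultimately show "\<zero>\<^bsub>PL\<^esub> \<in> ?K" using i below_refl[OF i] by (metis (mono_tags, lifting) mem_Collect_eq)
    show "h \<otimes>\<^bsub>PL\<^esub> f \<in> ?K" if f: "f \<in> ?K" and h: "h \<in> carrier PL" for f h
    proof -
      obtain j g where j: "j \<in> \<Gamma>" "below i j" "g \<in> ?I j" "f = pmap (cls j) g" using f by blast
      obtain k h' where k: "k \<in> \<Gamma>" "h' \<in> carrier (PA k)" "h = pmap (cls k) h'" using PL_lift[OF h] by blast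
      obtain n where n: "n \<in> \<Gamma>" "below j n" "below k n" using below_common[OF j(1) k(1)] by blast
      have bi: "below i n" using below_trans[OF i j(1) n(1) j(2) n(2)] .
      have g': "pmap (\<phi> j n) g \<in> ?I n" by (rule up[OF j(1,2) n(1,2) j(3)])
      have h'': "pmap (\<phi> k n) h' \<in> carrier (PA n)" by (rule pmap_trans_closed[OF k(1) n(1,3) k(2)])
      have "pmap (\<phi> k n) h' \<otimes>\<^bsub>PA n\<^esub> pmap (\<phi> j n) g \<in> ?I n"
        by (rule ideal.I_l_closed[OF id[OF n(1) bi] g' h''])
      moreover have "h \<otimes>\<^bsub>PL\<^esub> f = pmap (cls n) (pmap (\<phi> k n) h' \<otimes>\<^bsub>PA n\<^esub> pmap (\<phi> j n) g)"
        using mpoly_hom.pmap_mult[OF mpoly_hom_cls[OF n(1)] h'' gc[OF n(1) bi g']]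
          pmap_cls_trans[OF k(1) n(1,3) k(2)] pmap_cls_trans[OF j(1) n(1,2) gc[OF j(1-3)]] j(4) k(3) by simp
      ultimately show ?thesis using n(1) bi by blast
    qed
    show "f \<oplus>\<^bsub>PL\<^esub> f' \<in> ?K" if f: "f \<in> ?K" and f': "f' \<in> ?K" for f f'
    proof -
      obtain j g where j: "j \<in> \<Gamma>" "below i j" "g \<in> ?I j" "f = pmap (cls j) g" using f by blast
      obtain k g' where k: "k \<in> \<Gamma>" "below i k" "g' \<in> ?I k" "f' = pmap (cls k) g'" using f' by blast
      obtain n where n: "n \<in> \<Gamma>" "below j n" "below k n" using below_common[OF j(1) k(1)] by blast
      have bi: "below i n" using below_trans[OF i j(1) n(1) j(2) n(2)] .
      have 1: "pmap (\<phi> j n) g \<in> ?I n" by (rule up[OF j(1,2) n(1,2) j(3)])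
      have 2: "pmap (\<phi> k n) g' \<in> ?I n" by (rule up[OF k(1,2) n(1,3) k(3)])
      have "pmap (\<phi> j n) g \<oplus>\<^bsub>PA n\<^esub> pmap (\<phi> k n) g' \<in> ?I n"
        by (rule additive_subgroup.a_closed[OF ideal.axioms(1)[OF id[OF n(1) bi]] 1 2])
      moreover have "f \<oplus>\<^bsub>PL\<^esub> f' = pmap (cls n) (pmap (\<phi> j n) g \<oplus>\<^bsub>PA n\<^esub> pmap (\<phi> k n) g')"
        using mpoly_hom.pmap_add[OF mpoly_hom_cls[OF n(1)] gc[OF n(1) bi 1] gc[OF n(1) bi 2]]
          pmap_cls_trans[OF j(1) n(1,2) gc[OF j(1-3)]] pmap_cls_trans[OF k(1) n(1,3) gc[OF k(1-3)]] j(4) k(4) by simp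
      ultimately show ?thesis using n(1) bi by blast
    qed
  qed
  moreover have "pmap (cls i) ` Y \<subseteq> ?K"
  proof (rule image_subsetI)
    fix y assume y: "y \<in> Y"
    have yc: "y \<in> carrier (PA i)" using y Y by blast
    have "pmap (\<phi> i i) y = y"
      unfolding pmap_def using hom_refl[OF i mpolys.coeff_closed[OF mpolys_A[OF i] yc]] by simp
    then have "y \<in> ?I i"
      using ring.genideal_self[OF cring.axioms(1)[OF PA_cring[OF i]] pmap_image_closed[OF i i below_refl[OF i] Y]] y by force
    then show "pmap (cls i) y \<in> ?K" using i below_refl[OF i] by blast
  qed
  ultimately have "Idl\<^bsub>PL\<^esub> (pmap (cls i) ` Y) \<subseteq> ?K" by (rule PL.genideal_minimal)
  then show ?thesis using f by blast
qed

text \<open>A relation \<open>x g \<in> (Y)\<close> over the limit already holds at some index, where \<open>x\<close> can be cancelled.\<close>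

lemma nzd_mod_limit:
  assumes i: "i \<in> \<Gamma>" and Y: "Y \<subseteq> carrier (PA i)" and x: "x \<in> carrier (PA i)"
    and nz: "\<And>j. j \<in> \<Gamma> \<Longrightarrow> below i j \<Longrightarrow> nzd_mod (PA j) (level_ideal i Y j) (pmap (\<phi> i j) x)"
  shows "nzd_mod PL (Idl\<^bsub>PL\<^esub> (pmap (cls i) ` Y)) (pmap (cls i) x)"
  unfolding nzd_mod_def
proof (intro ballI impI)
  let ?I = "level_ideal i Y"
  fix g assume g: "g \<in> carrier PL" and h: "pmap (cls i) x \<otimes>\<^bsub>PL\<^esub> g \<in> Idl\<^bsub>PL\<^esub> (pmap (cls i) ` Y)"
  note Yj = pmap_image_closed[OF i _ _ Y] and id = level_ideal_ideal[OF i _ _ Y]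
    and up = level_ideal_up[OF i _ _ _ _ Y]
  obtain j v where j: "j \<in> \<Gamma>" "below i j" and v: "v \<in> ?I j" "pmap (cls i) x \<otimes>\<^bsub>PL\<^esub> g = pmap (cls j) v"
    using PL_Idl_lift[OF i Y h] by blast
  obtain k g' where k: "k \<in> \<Gamma>" "g' \<in> carrier (PA k)" "g = pmap (cls k) g'" using PL_lift[OF g] by blast
  obtain n where n: "n \<in> \<Gamma>" "below j n" "below k n" using below_common[OF j(1) k(1)] by blast
  have bi: "below i n" using below_trans[OF i j(1) n(1) j(2) n(2)] .
  let ?x = "pmap (\<phi> i n) x" and ?g = "pmap (\<phi> k n) g'" and ?v = "pmap (\<phi> j n) v"
  have vc: "v \<in> carrier (PA j)" by (rule ideal.Icarr[OF id[OF j] v(1)])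
  have c: "?x \<in> carrier (PA n)" "?g \<in> carrier (PA n)" "?v \<in> carrier (PA n)"
    using pmap_trans_closed[OF i n(1) bi x] pmap_trans_closed[OF k(1) n(1,3) k(2)] pmap_trans_closed[OF j(1) n(1,2) vc] .
  have vI: "?v \<in> ?I n" by (rule up[OF j n(1,2) v(1)])
  have xg: "?x \<otimes>\<^bsub>PA n\<^esub> ?g \<in> carrier (PA n)" by (rule mpolys.T_mult_closed[OF mpolys_A[OF n(1)] c(1,2)])
  have "pmap (cls n) (?x \<otimes>\<^bsub>PA n\<^esub> ?g) = pmap (cls n) ?v"
    using mpoly_hom.pmap_mult[OF mpoly_hom_cls[OF n(1)] c(1,2)] pmap_cls_trans[OF i n(1) bi x]
      pmap_cls_trans[OF k(1) n(1,3) k(2)] pmap_cls_trans[OF j(1) n(1,2) vc] k(3) v(2) by simp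
  then obtain q where q: "q \<in> \<Gamma>" "below n q" "pmap (\<phi> n q) (?x \<otimes>\<^bsub>PA n\<^esub> ?g) = pmap (\<phi> n q) ?v"
    using PA_eq_eventually[OF n(1) xg c(3)] by blast
  have biq: "below i q" using below_trans[OF i n(1) q(1) bi q(2)] .
  let ?g' = "pmap (\<phi> n q) ?g"
  have g'c: "?g' \<in> carrier (PA q)" by (rule pmap_trans_closed[OF n(1) q(1,2) c(2)])
  have "pmap (\<phi> i q) x \<otimes>\<^bsub>PA q\<^esub> ?g' = pmap (\<phi> n q) ?v"
    using mpoly_hom.pmap_mult[OF mpoly_hom_trans[OF n(1) q(1,2)] c(1,2)] pmap_trans[OF i n(1) q(1) bi q(2) x] q(3) by simp
  also have "\<dots> \<in> ?I q" by (rule up[OF n(1) bi q(1,2) vI])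
  finally have "?g' \<in> ?I q" using nz[OF q(1) biq] g'c unfolding nzd_mod_def by blast
  then have "pmap (cls q) ?g' \<in> Idl\<^bsub>PL\<^esub> (pmap (cls q) ` (pmap (\<phi> i q) ` Y))"
    by (rule mpoly_hom.pmap_Idl[OF mpoly_hom_cls[OF q(1)] Yj[OF q(1) biq]])
  moreover have "pmap (cls q) ` (pmap (\<phi> i q) ` Y) = pmap (cls i) ` Y"
    unfolding image_image using pmap_cls_trans[OF i q(1) biq] Y by (intro image_cong) auto
  moreover have "pmap (cls q) ?g' = g"
    using pmap_cls_trans[OF n(1) q(1,2) c(2)] pmap_cls_trans[OF k(1) n(1,3) k(2)] k(3) by simp
  ultimately show "g \<in> Idl\<^bsub>PL\<^esub> (pmap (cls i) ` Y)" by simp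
qed

lemma wreg_limit:
  assumes i: "i \<in> \<Gamma>"
    and "Y \<subseteq> carrier (PA i)" "set xs \<subseteq> carrier (PA i)"
    and "\<And>j. j \<in> \<Gamma> \<Longrightarrow> below i j \<Longrightarrow> wreg (PA j) (level_ideal i Y j) (map (pmap (\<phi> i j)) xs)"
  shows "wreg PL (Idl\<^bsub>PL\<^esub> (pmap (cls i) ` Y)) (map (pmap (cls i)) xs)"
  using assms(2-)
proof (induction xs arbitrary: Y)
  case (Cons x xs)
  have x: "x \<in> carrier (PA i)" and xs: "set xs \<subseteq> carrier (PA i)" using Cons.prems by auto
  have j: "nzd_mod (PA j) (level_ideal i Y j) (pmap (\<phi> i j) x)"
    "wreg (PA j) (level_ideal i (insert x Y) j) (map (pmap (\<phi> i j)) xs)" if "j \<in> \<Gamma>" "below i j" for j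
  proof -
    have "pmap (\<phi> i j) ` insert x Y \<subseteq> carrier (PA j)"
      by (rule pmap_image_closed[OF i that]) (use Cons.prems(1) x in blast)
    then have "Idl\<^bsub>PA j\<^esub> (insert (pmap (\<phi> i j) x) (level_ideal i Y j)) = level_ideal i (insert x Y) j"
      using cring.Idl_insert_Idl[OF PA_cring[OF that(1)]] by simp
    then show "nzd_mod (PA j) (level_ideal i Y j) (pmap (\<phi> i j) x)"
      "wreg (PA j) (level_ideal i (insert x Y) j) (map (pmap (\<phi> i j)) xs)"
      using Cons.prems(3)[OF that] by auto
  qed
  have "nzd_mod PL (Idl\<^bsub>PL\<^esub> (pmap (cls i) ` Y)) (pmap (cls i) x)"
    by (rule nzd_mod_limit[OF i Cons.prems(1) x j(1)])
  moreover have "wreg PL (Idl\<^bsub>PL\<^esub> (pmap (cls i) ` insert x Y)) (map (pmap (cls i)) xs)"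
    by (rule Cons.IH[OF _ xs j(2)]) (use Cons.prems(1) x in auto)
  moreover have "pmap (cls i) ` insert x Y \<subseteq> carrier PL"
    using mpoly_hom.pmap_closed[OF mpoly_hom_cls[OF i]] Cons.prems(1) x by blast
  then have "Idl\<^bsub>PL\<^esub> (insert (pmap (cls i) x) (Idl\<^bsub>PL\<^esub> (pmap (cls i) ` Y))) = Idl\<^bsub>PL\<^esub> (pmap (cls i) ` insert x Y)"
    using cring.Idl_insert_Idl[OF PL_cring] by simp
  ultimately show ?case by simp
qed simp

lemma wreg_generic_limit:
  assumes i: "i \<in> \<Gamma>" and cs: "set cs \<subseteq> carrier (A i)"
    and g: "\<And>j. j \<in> \<Gamma> \<Longrightarrow> below i j \<Longrightarrow> grade_ge (A j) (Idl\<^bsub>A j\<^esub> (\<phi> i j ` set cs)) {\<zero>\<^bsub>A j\<^esub>} n"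
  shows "wreg PL {\<zero>\<^bsub>PL\<^esub>} (map (\<lambda>t. mpolys.generic L UNIV t (map (cls i) cs)) [0..<n])"
proof -
  interpret PL: mpolys L UNIV by (rule mpolys_L)
  let ?xs = "map (\<lambda>t. mpolys.generic (A i) UNIV t cs) [0..<n]"
  have xs: "set ?xs \<subseteq> carrier (PA i)"
    using mpolys.generic_closed[OF mpolys_A[OF i] UNIV_I cs] by auto
  have "wreg PL (Idl\<^bsub>PL\<^esub> (pmap (cls i) ` {})) (map (pmap (cls i)) ?xs)"
  proof (rule wreg_limit[OF i _ xs])
    fix j assume j: "j \<in> \<Gamma>" "below i j"
    interpret Aj: mpolys_UNIV "A j" by (rule mpolys_UNIV.intro[OF mpolys_A[OF j(1)]])
    interpret ij: mpoly_hom "A i" "A j" UNIV "\<phi> i j" by (rule mpoly_hom_trans[OF i j])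
    let ?cs = "map (\<phi> i j) cs"
    have cc: "set ?cs \<subseteq> carrier (A j)" using cs hom_closed[OF i j] by auto
    obtain ys where ys: "set ys \<subseteq> Idl\<^bsub>A j\<^esub> (set ?cs)" "length ys = n" "wreg (A j) {\<zero>\<^bsub>A j\<^esub>} ys"
      using g[OF j] unfolding grade_ge_iff_wreg by auto
    have yc: "set ys \<subseteq> carrier (A j)" using ys(1) Aj.ideal_sub[OF Aj.genideal_ideal[OF cc]] by blast
    have "wreg (PA j) {\<zero>\<^bsub>PA j\<^esub>} (map Aj.const ys)"
      by (rule Aj.wreg_const[OF yc ys(3)])
    moreover have "set (map Aj.const ys) \<subseteq> Idl\<^bsub>PA j\<^esub> (Aj.const ` set ?cs)"
      using ys(1) Aj.const_mem_Idl[OF cc] by auto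
    ultimately have "grade_ge (PA j) (Idl\<^bsub>PA j\<^esub> (Aj.const ` set ?cs)) (Idl\<^bsub>PA j\<^esub> {}) n"
      unfolding grade_ge_iff_wreg Aj.T.Idl_empty using ys(2) by (intro exI[of _ "map Aj.const ys"]) simp
    then have "wreg (PA j) (Idl\<^bsub>PA j\<^esub> {}) (map (\<lambda>t. Aj.generic t ?cs) [0..<0 + n])"
      by (intro Aj.wreg_generic[OF cc]) auto
    moreover have "map (pmap (\<phi> i j)) ?xs = map (\<lambda>t. Aj.generic t ?cs) [0..<n]"
      using ij.pmap_generic[OF UNIV_I cs] by simp
    ultimately show "wreg (PA j) (Idl\<^bsub>PA j\<^esub> (pmap (\<phi> i j) ` {})) (map (pmap (\<phi> i j)) ?xs)"
      unfolding image_empty by (simp del: map_map)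
  qed simp
  moreover have "map (pmap (cls i)) ?xs = map (\<lambda>t. PL.generic t (map (cls i) cs)) [0..<n]"
    using mpoly_hom.pmap_generic[OF mpoly_hom_cls[OF i] UNIV_I cs] by simp
  ultimately show ?thesis unfolding image_empty PL.T.Idl_empty by (simp del: map_map)
qed

text \<open>The contraction of \<open>P\<close> to \<open>A i\<close> is finitely generated, and the \<open>n\<close> generic elements on its generators involve only
  the variables below \<open>n\<close>.\<close>

lemma grade_polynomial_ring_ge:
  assumes P: "primeideal P L" and i: "i \<in> \<Gamma>" and noeth: "noetherian_ring (A i)"
    and g: "\<And>j. j \<in> \<Gamma> \<Longrightarrow> below i j \<Longrightarrow>
      grade_ge (A j) (Idl\<^bsub>A j\<^esub> (\<phi> i j ` limit_contraction \<Gamma> below A \<phi> P i)) {\<zero>\<^bsub>A j\<^esub>} n"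
    and m: "n \<le> m"
  shows "grade_ge (mpoly L {..<m}) (Idl\<^bsub>mpoly L {..<m}\<^esub> (ring.indexed_const L ` P)) {\<zero>\<^bsub>mpoly L {..<m}\<^esub>} n"
proof -
  let ?p = "limit_contraction \<Gamma> below A \<phi> P i"
  interpret Ai: cring "A i" by (rule cring[OF i])
  interpret P: primeideal P L by fact
  interpret mpoly_restrict L "{..<m}" UNIV
    by (intro mpoly_restrict.intro mpoly_restrict_axioms.intro mpolys_L) simp
  have pI: "ideal ?p (A i)" using primeideal.axioms(1)[OF contraction_prime[OF i P]] .
  obtain Y where Y: "Y \<subseteq> carrier (A i)" "finite Y" "?p = Idl\<^bsub>A i\<^esub> Y"
    using noetherian_ring.finetely_gen[OF noeth pI] by blast
  obtain cs where cs: "set cs = Y" using finite_list[OF Y(2)] by (elim exE)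
  have cc: "set cs \<subseteq> carrier (A i)" using Y(1) cs by simp
  have csp: "set cs \<subseteq> ?p" unfolding cs Y(3) using Ai.genideal_self[OF Y(1)] .
  have clsP: "set (map (cls i) cs) \<subseteq> P" using csp by (auto simp: limit_contraction_def)
  then have clsc: "set (map (cls i) cs) \<subseteq> carrier L" using P.a_subset by blast
  have gj: "grade_ge (A j) (Idl\<^bsub>A j\<^esub> (\<phi> i j ` set cs)) {\<zero>\<^bsub>A j\<^esub>} n" if j: "j \<in> \<Gamma>" "below i j" for j
  proof -
    interpret Aj: cring "A j" by (rule cring[OF j(1)])
    have ic: "\<phi> i j ` set cs \<subseteq> carrier (A j)" using cc hom_closed[OF i j] by blast
    have "\<phi> i j ` ?p \<subseteq> Idl\<^bsub>A j\<^esub> (\<phi> i j ` set cs)"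
      unfolding Y(3) cs using ring_hom_Idl[OF Ai.is_cring Aj.is_cring hom[OF i j] Y(1)] .
    then have "Idl\<^bsub>A j\<^esub> (\<phi> i j ` ?p) \<subseteq> Idl\<^bsub>A j\<^esub> (\<phi> i j ` set cs)" by (rule Aj.genideal_minimal[OF Aj.genideal_ideal[OF ic]])
    moreover have "\<exists>xs. set xs \<subseteq> Idl\<^bsub>A j\<^esub> (\<phi> i j ` ?p) \<and> length xs = n \<and> wreg (A j) {\<zero>\<^bsub>A j\<^esub>} xs"
      using g[OF j] unfolding grade_ge_iff_wreg .
    ultimately show ?thesis unfolding grade_ge_iff_wreg by blast
  qed
  let ?gs = "map (\<lambda>t. generic t (map (cls i) cs)) [0..<n]"
  have "wreg PL {\<zero>\<^bsub>PL\<^esub>} ?gs"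
    using wreg_generic_limit[OF i cc gj] by (simp add: generic_eq)
  moreover have "set ?gs \<subseteq> carrier T" using generic_closed[OF _ clsc] m by auto
  ultimately have "wreg T {\<zero>\<^bsub>T\<^esub>} ?gs"
    using wreg_restrict[of ?gs] by simp
  moreover have "set ?gs \<subseteq> Idl\<^bsub>T\<^esub> (const ` P)"
  proof -
    have Pc: "const ` P \<subseteq> carrier T" using const_closed P.a_subset by blast
    have "generic t (map (cls i) cs) \<in> Idl\<^bsub>T\<^esub> (const ` P)" if "t < m" for t
      by (rule generic_in_ideal[OF T.genideal_ideal[OF Pc] _ _ clsc])
        (use that clsP T.genideal_self[OF Pc] in auto)
    then show ?thesis using m by auto
  qed
  ultimately show ?thesis unfolding grade_ge_iff_wreg by (intro exI[of _ ?gs]) simp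
qed

end

lemma ex_prime_chain_of_height_ge:
  assumes P: "primeideal P R" and n: "enat n \<le> height R P"
  shows "\<exists>ps. prime_chain R ps \<and> last ps = P \<and> n \<le> length ps - 1"
proof (rule ccontr)
  let ?Q = "{ps. prime_chain R ps \<and> last ps = P}"
  assume neg: "\<not> ?thesis"
  have no: "length ps - 1 < n" if "ps \<in> ?Q" for ps
  proof (rule ccontr)
    assume "\<not> length ps - 1 < n"
    then show False using neg that by auto
  qed
  have "[P] \<in> ?Q" using P by (simp add: prime_chain_def)
  then have n0: "n > 0" using no by fastforce
  have "height R P \<le> enat (n - 1)"
    unfolding height_def
  proof (rule SUP_least)
    fix ps assume "ps \<in> ?Q"
    then have "length ps - 1 < n" by (rule no)
    then show "enat (length ps - 1) \<le> enat (n - 1)" by simp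
  qed
  then have "enat n \<le> enat (n - 1)" using n by (rule order_trans[rotated])
  then show False using n0 by simp
qed

lemma (in cring) height_above_le_height:
  assumes "height R P = enat n"
  shows "height_above_le {\<zero>} P n"
  unfolding height_above_le_def
proof (intro allI impI, elim conjE)
  fix ps assume "prime_chain R ps" "last ps = P"
  then have "enat (length ps - 1) \<le> height R P"
    unfolding height_def by (intro SUP_upper) simp
  then show "length ps \<le> Suc n" using assms by simp
qed

theorem proposition3p5:
  fixes \<Gamma> :: "'i set" and below :: "'i \<Rightarrow> 'i \<Rightarrow> bool"
    and A :: "'i \<Rightarrow> ('a, 'm) ring_scheme" and \<phi> :: "'i \<Rightarrow> 'i \<Rightarrow> 'a \<Rightarrow> 'a"
    and P :: "('i \<times> 'a) set set"
  assumes "direct_system \<Gamma> below A \<phi>"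
    and "\<forall>\<gamma>\<in>\<Gamma>. cohen_macaulay_ring (A \<gamma>)"
    and "primeideal P (direct_limit \<Gamma> below A \<phi>)"
    and "(\<forall>\<delta>\<in>\<Gamma>. \<forall>\<gamma>\<in>\<Gamma>. below \<delta> \<gamma> \<longrightarrow>
            c_grade (A \<gamma>) (limit_contraction \<Gamma> below A \<phi> P \<gamma>) (self_module (A \<gamma>)) =
            c_grade (A \<gamma>) (Idl\<^bsub>A \<gamma>\<^esub> (\<phi> \<delta> \<gamma> ` limit_contraction \<Gamma> below A \<phi> P \<delta>)) (self_module (A \<gamma>)))
       \<or> (\<forall>\<delta>\<in>\<Gamma>. \<forall>\<gamma>\<in>\<Gamma>. below \<delta> \<gamma> \<longrightarrow>
            c_grade (A \<delta>) (limit_contraction \<Gamma> below A \<phi> P \<delta>) (self_module (A \<delta>)) \<le>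
            c_grade (A \<gamma>) (Idl\<^bsub>A \<gamma>\<^esub> (\<phi> \<delta> \<gamma> ` limit_contraction \<Gamma> below A \<phi> P \<delta>)) (self_module (A \<gamma>)))"
  shows "p_grade (direct_limit \<Gamma> below A \<phi>) P (self_module (direct_limit \<Gamma> below A \<phi>))
           = height (direct_limit \<Gamma> below A \<phi>) P"
proof -
  interpret direct_system \<Gamma> below A \<phi> by (rule assms(1))
  note P = assms(3)
  interpret L: cring L by (rule direct_limit_cring)
  interpret P: primeideal P L by (rule P)
  let ?p = "limit_contraction \<Gamma> below A \<phi> P"
  let ?T = "\<lambda>m. mpoly L {..<m}"
  let ?PT = "\<lambda>m. Idl\<^bsub>?T m\<^esub> (L.indexed_const ` P)"
  define c where "c m = c_grade (poly_ring L m) (Idl\<^bsub>poly_ring L m\<^esub> (L.indexed_const ` P))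
    (base_change L (poly_ring L m) L.indexed_const (self_module L))" for m
  have mp: "mpolys L" by (rule mpolys_L)
  have c_ge: "enat n \<le> c m \<longleftrightarrow> grade_ge (?T m) (?PT m) {\<zero>\<^bsub>?T m\<^esub>} n" for n m
    unfolding c_def poly_ring_eq_mpoly
  proof (rule c_grade_ge_iff)
    interpret T: mpolys L "{..<m}" by (rule mp)
    show "weak_regular_sequence T.T (base_change L T.T L.indexed_const (self_module L)) xs \<longleftrightarrow>
        set xs \<subseteq> carrier T.T \<and> wreg T.T {\<zero>\<^bsub>T.T\<^esub>} xs" for xs
      by (rule weak_regular_sequence_base_change[OF direct_limit_cring T.mpoly_cring T.const_hom])
    have "T.const ` P \<subseteq> carrier T.T" using T.const_closed P.a_subset by blast
    then show "?PT m \<subseteq> carrier T.T" by (rule T.T.ideal_sub[OF T.T.genideal_ideal])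
  qed
  \<comment> \<open>The sequence \<open>c\<close> never exceeds the height and eventually reaches every finite number up to it, so the
    height is its limit.\<close>
  have upper: "c m \<le> height L P" for m
  proof (cases "height L P")
    case (enat n)
    show ?thesis
    proof (rule ccontr)
      assume "\<not> ?thesis"
      then have "enat (Suc n) \<le> c m" using enat by (simp add: Suc_ile_eq not_le)
      then show False
        using mpolys.polynomial_grade_le_height[OF mp P L.height_above_le_height[OF enat]] c_ge by blast
    qed
  qed simp
  \<comment> \<open>With \<open>n\<close> variables available, the generic elements give a sequence of length \<open>n\<close>.\<close>
  have lower: "\<exists>m0. \<forall>m\<ge>m0. enat n \<le> c m" if n: "enat n \<le> height L P" for n
  proof -
    obtain ps where ps: "prime_chain L ps" "last ps = P" "n \<le> length ps - 1"
      using ex_prime_chain_of_height_ge[OF P n] by blast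
    obtain \<delta> where \<delta>: "\<delta> \<in> \<Gamma>" and ch: "\<And>\<gamma>. \<gamma> \<in> \<Gamma> \<Longrightarrow> below \<delta> \<gamma> \<Longrightarrow>
        prime_chain (A \<gamma>) (map (\<lambda>Q. limit_contraction \<Gamma> below A \<phi> Q \<gamma>) ps)"
      using contraction_prime_chain[OF ps(1)] by blast
    have cg: "enat n \<le> c_grade (A \<gamma>) (?p \<gamma>) (self_module (A \<gamma>))" if \<gamma>: "\<gamma> \<in> \<Gamma>" "below \<delta> \<gamma>" for \<gamma>
    proof -
      let ?qs = "map (\<lambda>Q. limit_contraction \<Gamma> below A \<phi> Q \<gamma>) ps"
      have cm: "cohen_macaulay_ring (A \<gamma>)" using assms(2) \<gamma>(1) by blast
      have "last ?qs = ?p \<gamma>" using ps(1,2) by (simp add: prime_chain_def last_map)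
      then have "grade_ge (A \<gamma>) (?p \<gamma>) {\<zero>\<^bsub>A \<gamma>\<^esub>} (length ps - 1)"
        using cohen_macaulay_grade_ge_prime_chain[OF cm ch[OF \<gamma>]] by simp
      then have "grade_ge (A \<gamma>) (?p \<gamma>) {\<zero>\<^bsub>A \<gamma>\<^esub>} n" using ps(3) by (rule grade_ge_mono)
      moreover have "?p \<gamma> \<subseteq> carrier (A \<gamma>)" by (auto simp: limit_contraction_def)
      ultimately show ?thesis using cring.c_grade_self_module_ge_iff[OF cring[OF \<gamma>(1)]] by blast
    qed
    have g: "grade_ge (A \<gamma>) (Idl\<^bsub>A \<gamma>\<^esub> (\<phi> \<delta> \<gamma> ` ?p \<delta>)) {\<zero>\<^bsub>A \<gamma>\<^esub>} n" if \<gamma>: "\<gamma> \<in> \<Gamma>" "below \<delta> \<gamma>" for \<gamma>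
    proof -
      interpret A\<gamma>: cring "A \<gamma>" by (rule cring[OF \<gamma>(1)])
      have "\<phi> \<delta> \<gamma> ` ?p \<delta> \<subseteq> carrier (A \<gamma>)" using hom_closed[OF \<delta> \<gamma>] by (auto simp: limit_contraction_def)
      then have sub: "Idl\<^bsub>A \<gamma>\<^esub> (\<phi> \<delta> \<gamma> ` ?p \<delta>) \<subseteq> carrier (A \<gamma>)" by (rule A\<gamma>.ideal_sub[OF A\<gamma>.genideal_ideal])
      have "enat n \<le> c_grade (A \<gamma>) (Idl\<^bsub>A \<gamma>\<^esub> (\<phi> \<delta> \<gamma> ` ?p \<delta>)) (self_module (A \<gamma>))"
        using assms(4)
      proof
        assume "\<forall>\<delta>\<in>\<Gamma>. \<forall>\<gamma>\<in>\<Gamma>. below \<delta> \<gamma> \<longrightarrow> c_grade (A \<gamma>) (?p \<gamma>) (self_module (A \<gamma>)) =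
            c_grade (A \<gamma>) (Idl\<^bsub>A \<gamma>\<^esub> (\<phi> \<delta> \<gamma> ` ?p \<delta>)) (self_module (A \<gamma>))"
        then show ?thesis using cg[OF \<gamma>] \<delta> \<gamma> by simp
      next
        assume "\<forall>\<delta>\<in>\<Gamma>. \<forall>\<gamma>\<in>\<Gamma>. below \<delta> \<gamma> \<longrightarrow> c_grade (A \<delta>) (?p \<delta>) (self_module (A \<delta>)) \<le>
            c_grade (A \<gamma>) (Idl\<^bsub>A \<gamma>\<^esub> (\<phi> \<delta> \<gamma> ` ?p \<delta>)) (self_module (A \<gamma>))"
        then have "c_grade (A \<delta>) (?p \<delta>) (self_module (A \<delta>)) \<le>
            c_grade (A \<gamma>) (Idl\<^bsub>A \<gamma>\<^esub> (\<phi> \<delta> \<gamma> ` ?p \<delta>)) (self_module (A \<gamma>))" using \<delta> \<gamma> by blast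
        then show ?thesis using cg[OF \<delta> below_refl[OF \<delta>]] by (rule order_trans[rotated])
      qed
      then show ?thesis using A\<gamma>.c_grade_self_module_ge_iff[OF sub] by blast
    qed
    have noeth: "noetherian_ring (A \<delta>)" using assms(2) \<delta> by (simp add: cohen_macaulay_ring_def)
    have "enat n \<le> c m" if "m \<ge> n" for m
      unfolding c_ge using grade_polynomial_ring_ge[OF P \<delta> noeth g that] .
    then show ?thesis by blast
  qed
  have "c \<longlonglongrightarrow> height L P"
  proof (rule order_tendstoI)
    fix a assume a: "a < height L P"
    then obtain k where k: "a = enat k" by (cases a) auto
    then have "enat (Suc k) \<le> height L P" using a by (simp add: Suc_ile_eq)
    then obtain m0 where "\<forall>m\<ge>m0. enat (Suc k) \<le> c m" using lower by blast
    then have "\<forall>m\<ge>m0. a < c m" unfolding k by (simp add: Suc_ile_eq)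
    then show "\<forall>\<^sub>F m in sequentially. a < c m" by (auto simp: eventually_sequentially)
  next
    fix a assume "height L P < a"
    then show "\<forall>\<^sub>F m in sequentially. c m < a" using upper by (intro always_eventually) (auto intro: le_less_trans)
  qed
  then have "lim c = height L P" by (rule limI)
  then show ?thesis unfolding p_grade_def c_def .
qed

end
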